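(* Let $m \ge n \ge 1$ be integers, let $0 \le p_m < \cdots < p_1 < 1$ be real numbers, and set $\gamma_j = e^{-2\pi i p_j}$ for $1\le j\le m$. Let $V \in \mathbb{C}^{m\times n}$ be the Vandermonde (nonuniform discrete Fourier transform) matrix with entries $V_{jk} = \gamma_j^{k-1}$, let $\omega = e^{\pi i/n}$, let $F\in\mathbb{C}^{n\times n}$ be the unitary matrix with entries $F_{jk} = \omega^{j(2k-1)}/\sqrt{n}$, and let $C = VF^*\in\mathbb{C}^{m\times n}$. Let $\mathcal{T}$ be a cluster tree for $C$ as described in the context, with column index sets $K_t$ and row index sets $J_t$ for $t\in\mathcal{T}$, and let $0<\epsilon<1$. If $A$ is an HSS column $C_{J_t^c K_t}$ or an HSS row $C_{J_t K_t^c}$ of $C$ for some $t\in\mathcal{T}$, or a submatrix of such a column or row, then $$\operatorname{rank}_\epsilon(A) \le \left\lceil \frac{2\log(4/\epsilon)\,\log(4n)}{\pi^2}\right\rceil .$$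
   Context: Here $(\cdot)^*$ is the Hermitian transpose, $\log$ is the natural logarithm, and $C_{JK}$ denotes the submatrix of $C$ with rows indexed by $J$ and columns indexed by $K$. Displacement relation: with $\Gamma = \operatorname{diag}(\gamma_1,\ldots,\gamma_m)$, $\Lambda = \operatorname{diag}(\omega^2,\omega^4,\ldots,\omega^{2n})$, $u\in\mathbb{C}^m$ with $u_j = \gamma_j^n-1$, $v = (0,\ldots,0,1)^T\in\mathbb{C}^n$ and $w = Fv$, the matrix $C=VF^*$ satisfies $\Gamma C - C\Lambda = uw^*$. (Some $\gamma_j$ may coincide with some $\omega^{2k}$.) Clusters: for $1\le\kappa\le n$, the cluster $\mathscr{I}_\kappa$ is the set of all $j\in\{1,\ldots,m\}$ such that $\gamma_j \in \{\exp(2\pi i t/n) : \kappa-1/2 < t\le \kappa+1/2\}$. Clusters may be empty; together they partition $\{1,\ldots,m\}$. Cluster tree: $\mathcal{T}$ is a finite binary tree with root $0$, in which each non-leaf vertex $t$ has two children $2t+1$ and $2t+2$. To each vertex $t$ is associated a set of column indices $K_t$ such that (i) $K_0=\{1,\ldots,n\}$; (ii) each $K_t$ is contiguous, $K_t=\{\kappa_1,\kappa_1+1,\ldots,\kappa_2\}$ with $1\le\kappa_1\le\kappa_2\le n$; (iii) for each non-leaf $t$, $K_t$ is the disjoint union of $K_{2t+1}$ and $K_{2t+2}$. The row index set is $J_t = \bigcup_{\kappa\in K_t}\mathscr{I}_\kappa$. Complements are $J_t^c = \{1,\ldots,m\}\setminus J_t$ and $K_t^c = \{1,\ldots,n\}\setminus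 K_t$. HSS columns and rows: for $t\in\mathcal{T}$, the HSS column is $A_t^{\rm col} = C_{J_t^c K_t}$ and the HSS row is $A_t^{\rm row} = C_{J_t K_t^c}$. A submatrix is obtained by choosing arbitrary subsets of the row and column indices. $\epsilon$-rank: for $0<\epsilon<1$ and a complex matrix $X$ with singular values $\sigma_1(X)\ge\sigma_2(X)\ge\cdots$ (with $\sigma_i(X)=0$ for $i$ larger than the smaller dimension of $X$), $\operatorname{rank}_\epsilon(X)$ is the smallest integer $k\ge 0$ such that $\sigma_{k+1}(X)\le\epsilon\|X\|_2$, where $\|\cdot\|_2$ is the spectral norm. An empty matrix has $\epsilon$-rank $0$. *)

theory Defs
  imports
    "HOL-Analysis.L2_Norm"
    "HOL-Computational_Algebra.Polynomial"
    "Jordan_Normal_Form.Schur_Decomposition"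
    "Jordan_Normal_Form.DL_Submatrix"
begin

section \<open>Singular values, spectral norm, epsilon-rank\<close>

text \<open>
  The singular values of \<open>X\<close> are the square roots of the eigenvalues of \<open>X\<^sup>* X\<close>, counted with
  algebraic multiplicity and listed in decreasing order. These eigenvalues are real and
  nonnegative, so \<open>Re\<close> loses nothing. The index \<open>i\<close> is 1-based.
\<close>

definition singular_value :: "complex mat \<Rightarrow> nat \<Rightarrow> real" where
  "singular_value X i =
     (if 1 \<le> i \<and> i \<le> min (dim_row X) (dim_col X)
      then rev (sorted_list_of_multiset
             (image_mset (\<lambda>z. sqrt (Re z)) (proots (char_poly (mat_adjoint X * X))))) ! (i - 1)
      else 0)"

definition vec_norm2 :: "complex vec \<Rightarrow> real" where
  "vec_norm2 v = L2_set (\<lambda>i. cmod (v $ i)) {..<dim_vec v}"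

text \<open>The closed unit ball is never empty, so an empty matrix has norm \<open>0\<close>.\<close>

definition spectral_norm :: "complex mat \<Rightarrow> real" where
  "spectral_norm X =
     Sup {vec_norm2 (X *\<^sub>v v) | v. v \<in> carrier_vec (dim_col X) \<and> vec_norm2 v \<le> 1}"

definition eps_rank :: "real \<Rightarrow> complex mat \<Rightarrow> nat" where
  "eps_rank \<epsilon> X = (LEAST k. singular_value X (k + 1) \<le> \<epsilon> * spectral_norm X)"


section \<open>The matrices\<close>

text \<open>
  Indices in the mathematics start at 1, indices of the type \<open>mat\<close> at 0: below, the entry at
  \<open>(j, k)\<close> of a \<open>mat\<close> is the one with mathematical index \<open>(j + 1, k + 1)\<close>. The parameters
  \<open>p\<close> and \<open>\<gamma>\<close>, and all index sets \<open>J\<close>, \<open>K\<close>, use the 1-based mathematical indices.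
\<close>

definition node :: "(nat \<Rightarrow> real) \<Rightarrow> nat \<Rightarrow> complex" where
  "node p j = exp (- 2 * of_real pi * \<i> * of_real (p j))"

definition vandermonde :: "nat \<Rightarrow> nat \<Rightarrow> (nat \<Rightarrow> complex) \<Rightarrow> complex mat" where
  "vandermonde m n \<gamma> = mat m n (\<lambda>(j, k). \<gamma> (j + 1) ^ k)"

definition omega :: "nat \<Rightarrow> complex" where
  "omega n = exp (of_real pi * \<i> / of_nat n)"

definition fourier_mat :: "nat \<Rightarrow> complex mat" where
  "fourier_mat n =
     mat n n (\<lambda>(j, k). omega n ^ ((j + 1) * (2 * (k + 1) - 1)) / of_real (sqrt (real n)))"

definition C_mat :: "nat \<Rightarrow> nat \<Rightarrow> (nat \<Rightarrow> real) \<Rightarrow> complex mat" where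
  "C_mat m n p = vandermonde m n (node p) * mat_adjoint (fourier_mat n)"


section \<open>Clusters, cluster trees, HSS blocks\<close>

definition cluster :: "nat \<Rightarrow> nat \<Rightarrow> (nat \<Rightarrow> real) \<Rightarrow> nat \<Rightarrow> nat set" where
  "cluster m n p \<kappa> =
     {j \<in> {1..m}. node p j \<in>
        (\<lambda>t. exp (2 * of_real pi * \<i> * of_real t / of_nat n)) ` {real \<kappa> - 1/2 <.. real \<kappa> + 1/2}}"

text \<open>
  A binary tree is given by its set of vertices \<open>T\<close>, the children of \<open>t\<close> being
  \<open>2 * t + 1\<close> and \<open>2 * t + 2\<close> and the parent of \<open>t \<noteq> 0\<close> being \<open>(t - 1) div 2\<close>.
  A vertex \<open>t\<close> is a non-leaf iff \<open>2 * t + 1 \<in> T\<close>.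
\<close>

definition binary_tree :: "nat set \<Rightarrow> bool" where
  "binary_tree T \<longleftrightarrow>
     finite T \<and> 0 \<in> T \<and>
     (\<forall>t\<in>T. t \<noteq> 0 \<longrightarrow> (t - 1) div 2 \<in> T) \<and>
     (\<forall>t\<in>T. 2 * t + 1 \<in> T \<longleftrightarrow> 2 * t + 2 \<in> T)"

definition cluster_tree :: "nat \<Rightarrow> nat set \<Rightarrow> (nat \<Rightarrow> nat set) \<Rightarrow> bool" where
  "cluster_tree n T K \<longleftrightarrow>
     binary_tree T \<and>
     K 0 = {1..n} \<and>
     (\<forall>t\<in>T. \<exists>\<kappa>1 \<kappa>2. 1 \<le> \<kappa>1 \<and> \<kappa>1 \<le> \<kappa>2 \<and> \<kappa>2 \<le> n \<and> K t = {\<kappa>1..\<kappa>2}) \<and>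
     (\<forall>t\<in>T. 2 * t + 1 \<in> T \<longrightarrow>
        K t = K (2 * t + 1) \<union> K (2 * t + 2) \<and> K (2 * t + 1) \<inter> K (2 * t + 2) = {})"

definition row_set :: "nat \<Rightarrow> nat \<Rightarrow> (nat \<Rightarrow> real) \<Rightarrow> nat set \<Rightarrow> nat set" where
  "row_set m n p Kt = (\<Union>\<kappa>\<in>Kt. cluster m n p \<kappa>)"

text \<open>The block of \<open>A\<close> with rows \<open>J\<close> and columns \<open>K\<close>, for 1-based index sets.\<close>

definition block :: "complex mat \<Rightarrow> nat set \<Rightarrow> nat set \<Rightarrow> complex mat" where
  "block A J K = submatrix A {i. i + 1 \<in> J} {k. k + 1 \<in> K}"

definition hss_col :: "nat \<Rightarrow> nat \<Rightarrow> (nat \<Rightarrow> real) \<Rightarrow> nat set \<Rightarrow> complex mat" where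
  "hss_col m n p Kt = block (C_mat m n p) ({1..m} - row_set m n p Kt) Kt"

definition hss_row :: "nat \<Rightarrow> nat \<Rightarrow> (nat \<Rightarrow> real) \<Rightarrow> nat set \<Rightarrow> complex mat" where
  "hss_row m n p Kt = block (C_mat m n p) (row_set m n p Kt) ({1..n} - Kt)"

end

theory Submission
  imports
    "HOL-Complex_Analysis.Complex_Analysis"
    "HOL-Computational_Algebra.Fundamental_Theorem_Algebra"
    "HOL-Real_Asymp.Real_Asymp"
    Defs
begin

text \<open>
  For a block, the column nodes lie on one arc of the unit circle and the row nodes on a disjoint arc (or
  conversely). In the coordinate \<open>x = tan \<psi> / \<mu>\<close>, with \<open>\<psi>\<close> half the angle to the centre of the
  first arc, the arcs become \<open>\<bar>x\<bar> \<le> c\<close> and \<open>\<bar>x\<bar> \<ge> 1 / c\<close>. If \<open>B\<close> is a real Blaschke product of degree \<open>N\<close> with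
  \<open>\<bar>B\<bar> \<le> \<delta>\<close> on \<open>[-c, c]\<close>, then by reflection \<open>\<bar>B\<bar> \<ge> 1 / \<delta>\<close> on the second set, and the rank one
  displacement structure makes \<open>A - B(y)\<^sup>-\<^sup>1 A B(x)\<close> (diagonal matrices of node values) a matrix of rank \<open>\<le> N\<close>.
  Hence the singular value with index \<open>N + 1\<close> is at most \<open>\<delta>\<^sup>2\<close> times the norm.

  The extremal \<open>B\<close> is Zolotarev's: with \<open>F\<^sub>r = \<surd>k sn\<close> for the nome \<open>q = r\<^sup>4\<close>, the addition theorem
  turns \<open>\<Prod>\<^sub>j F\<^sub>r (z - s\<^sub>j)\<close> over \<open>N\<close> equidistant \<open>s\<^sub>j\<close> into a Blaschke product in \<open>F\<^sub>r z\<close>, and the product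
  formula for theta functions identifies it with \<open>F\<close> for the nome \<open>q\<^sup>N\<close>, which is at most \<open>2 r\<^sup>N\<close>.
  The addition theorem follows from the maximum modulus principle on an annulus modulo \<open>w \<mapsto> Q w\<close>.

  It remains to see that \<open>c = F\<^sub>r (\<pi> / 2)\<close> is large enough when \<open>q = exp (- \<pi>\<^sup>2 / log (4 n))\<close>. With
  \<open>k = c\<^sup>2\<close> and \<open>q = exp (- 2 h)\<close>, Landen's transformation shows that \<open>h log ((1 - k) / (4 (1 + k)))\<close> increases when \<open>h\<close> is halved,
  and its limit at \<open>0\<close> is \<open>- 4 \<Sum> 1 / (2 m + 1)\<^sup>2 = - \<pi>\<^sup>2 / 2\<close>. So \<open>(1 - k) / (1 + k) \<le> 1 / n\<close>, and the separation of
  the arcs by the angle \<open>\<pi> / n\<close> suffices.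
\<close>

section \<open>The infinite product (w; Q) and its theta function\<close>

text \<open>The q-Pochhammer symbol with infinitely many factors. Theta functions enter the proof
  only through this product, never through their series.\<close>

definition qpoch :: "real \<Rightarrow> complex \<Rightarrow> complex" where
  "qpoch Q w = (\<Prod>j. 1 - of_real Q ^ j * w)"

context
  fixes Q :: real
  assumes Q: "0 < Q" "Q < 1"
begin

lemma convergent_prod_qpoch: "convergent_prod (\<lambda>j. 1 - of_real Q ^ j * w :: complex)"
proof -
  have "summable (\<lambda>j. Q ^ j * norm w)"
    using Q by (intro summable_mult2 summable_geometric) auto
  then have "summable (\<lambda>j. norm ((1 - of_real Q ^ j * w) - 1))"
    using Q by (simp add: norm_mult norm_power)
  then show ?thesis
    by (intro abs_convergent_prod_imp_convergent_prod summable_imp_abs_convergent_prod)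
qed

lemma qpoch_LIMSEQ: "(\<lambda>n. \<Prod>j<n. 1 - of_real Q ^ j * w) \<longlonglongrightarrow> qpoch Q w"
  using convergent_prod_LIMSEQ[OF convergent_prod_qpoch[of w]]
  unfolding qpoch_def LIMSEQ_lessThan_iff_atMost .

lemma qpoch_eq_0_iff: "qpoch Q w = 0 \<longleftrightarrow> (\<exists>j. of_real Q ^ j * w = 1)"
  using has_prod_eq_0_iff[OF convergent_prod_has_prod[OF convergent_prod_qpoch[of w]]]
  unfolding qpoch_def by (auto simp: image_iff)

lemma qpoch_rec: "qpoch Q w = (1 - w) * qpoch Q (of_real Q * w)"
proof (rule LIMSEQ_unique[OF qpoch_LIMSEQ[THEN LIMSEQ_Suc]])
  have "(\<lambda>n. (1 - w) * (\<Prod>j<n. 1 - of_real Q ^ j * (of_real Q * w)))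
          \<longlonglongrightarrow> (1 - w) * qpoch Q (of_real Q * w)"
    by (intro tendsto_intros qpoch_LIMSEQ)
  then show "(\<lambda>n. \<Prod>j<Suc n. 1 - of_real Q ^ j * w) \<longlonglongrightarrow> (1 - w) * qpoch Q (of_real Q * w)"
    by (subst prod.lessThan_Suc_shift) (simp add: mult_ac)
qed

lemma qpoch_cnj: "qpoch Q (cnj w) = cnj (qpoch Q w)"
proof (rule LIMSEQ_unique[OF qpoch_LIMSEQ])
  show "(\<lambda>n. \<Prod>j<n. 1 - of_real Q ^ j * cnj w) \<longlonglongrightarrow> cnj (qpoch Q w)"
    using tendsto_cnj[OF qpoch_LIMSEQ[of w]] by simp
qed

text \<open>On a closed unit disc the factors differ from \<open>1\<close> by at most
  \<open>Q ^ n * R\<close>, so the partial products converge uniformly there and the limit is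
  holomorphic.\<close>

lemma qpoch_holomorphic: "qpoch Q holomorphic_on UNIV"
proof (rule holomorphic_uniform_sequence[OF open_UNIV])
  show "(\<lambda>w. \<Prod>j<n. 1 - of_real Q ^ j * w) holomorphic_on UNIV" for n
    by (intro holomorphic_intros)
next
  fix x :: complex
  define R where "R = norm x + 1"
  have "uniformly_convergent_on (cball x 1) (\<lambda>n w. \<Prod>j<n. 1 - of_real Q ^ j * w)"
  proof (rule uniformly_convergent_on_prod')
    show "uniformly_convergent_on (cball x 1) (\<lambda>N w. \<Sum>n<N. norm ((1 - of_real Q ^ n * w) - 1 :: complex))"
    proof (rule Weierstrass_m_test')
      fix n w assume "w \<in> cball x 1"
      then have "norm w \<le> R"
        unfolding R_def using norm_triangle_sub[of w x] by (auto simp: dist_norm norm_minus_commute)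
      then show "norm (norm ((1 - of_real Q ^ n * w) - 1 :: complex)) \<le> Q ^ n * R"
        using Q by (simp add: norm_mult norm_power)
    next
      show "summable (\<lambda>n. Q ^ n * R)"
        using Q by (intro summable_mult2 summable_geometric) auto
    qed
  qed (auto intro!: continuous_intros)
  then obtain l where l: "uniform_limit (cball x 1) (\<lambda>n w. \<Prod>j<n. 1 - of_real Q ^ j * w) l sequentially"
    by (auto simp: uniformly_convergent_on_def)
  have "l w = qpoch Q w" if "w \<in> cball x 1" for w
    using tendsto_uniform_limitI[OF l that] qpoch_LIMSEQ LIMSEQ_unique by blast
  then have "uniform_limit (cball x 1) (\<lambda>n w. \<Prod>j<n. 1 - of_real Q ^ j * w) (qpoch Q) sequentially"
    using l by (subst uniform_limit_cong') auto
  then show "\<exists>d>0. cball x d \<subseteq> UNIV \<and>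
      uniform_limit (cball x d) (\<lambda>n w. \<Prod>j<n. 1 - of_real Q ^ j * w) (qpoch Q) sequentially"
    by (intro exI[of _ 1]) auto
qed

lemma qpoch_comp_holomorphic [holomorphic_intros]:
  "f holomorphic_on A \<Longrightarrow> (\<lambda>w. qpoch Q (f w)) holomorphic_on A"
  using holomorphic_on_compose_gen[OF _ qpoch_holomorphic, of f A] by (auto simp: o_def)

lemma qpoch_comp_continuous [continuous_intros]:
  "continuous_on A f \<Longrightarrow> continuous_on A (\<lambda>w. qpoch Q (f w))"
  using continuous_on_compose2[OF holomorphic_on_imp_continuous_on[OF qpoch_holomorphic], of A f] by auto

end

text \<open>The polynomial \<open>x ^ N - 1\<close> is squarefree and hence the product of
  \<open>x - z\<close> over its roots \<open>z\<close>. Substituting \<open>inverse x\<close> and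
  scaling by \<open>x ^ N\<close> reverses it, which is why \<open>x = 0\<close> is treated
  apart.\<close>

lemma prod_one_minus_roots_of_unity:
  fixes x :: complex
  assumes "N > 0"
  shows "(\<Prod>j<N. 1 - x * cis (2 * pi * real j / real N)) = 1 - x ^ N"
proof -
  have "(\<Prod>z | z ^ N = 1. x - z) = x ^ N - 1" for x :: complex
  proof -
    define p :: "complex poly" where "p = monom 1 N + [:-1:]"
    have deg: "degree p = N"
      unfolding p_def using assms by (subst degree_add_eq_left) (auto simp: degree_monom_eq)
    have c: "coeff p N = 1" using assms by (cases N) (auto simp: p_def)
    \<comment> \<open>The derivative vanishes at most at \<open>0\<close>, which is not a
      root.\<close>
    have "rsquarefree p"
      unfolding rsquarefree_roots using assms
      by (auto simp: p_def pderiv_add pderiv_pCons pderiv_monom poly_monom power_0_left)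
    then have "Polynomial.smult (lead_coeff p) (\<Prod>z | poly p z = 0. [:-z, 1:]) = p"
      by (rule complex_poly_decompose_rsquarefree)
    then have "p = (\<Prod>z | z ^ N = 1. [:-z, 1:])"
      by (simp add: deg c) (simp add: p_def poly_monom)
    then have "poly p x = (\<Prod>z | z ^ N = 1. x - z)"
      by (simp add: poly_prod)
    then show ?thesis by (simp add: p_def poly_monom)
  qed
  note * = this
  show ?thesis
  proof (cases "x = 0")
    case True then show ?thesis using assms by simp
  next
    case False
    have "(\<Prod>z | z ^ N = 1. 1 - x * z) = (\<Prod>z | z ^ N = 1. x * (inverse x - z))"
      using False by (intro prod.cong) (auto simp: field_simps)
    also have "\<dots> = x ^ N * (inverse x ^ N - 1)"
      by (subst prod.distrib) (simp add: * card_roots_unity_eq assms)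
    also have "\<dots> = 1 - x ^ N"
      using False by (simp add: field_simps)
    finally have "(\<Prod>z | z ^ N = 1. 1 - x * z) = 1 - x ^ N" .
    then show ?thesis
      using prod.reindex_bij_betw[OF Complex.bij_betw_roots_unity[OF assms], of "\<lambda>z. 1 - x * z"] by simp
  qed
qed

text \<open>Over the roots of unity the factors for base \<open>Q\<close> collapse to one factor for
  base \<open>Q ^ N\<close>. The finite products are interchanged before the limit is taken. This is
  the source of the passage from a nome to its \<open>N\<close>-th power.\<close>

lemma qpoch_power:
  assumes Q: "0 < Q" "Q < 1" and "N > 0"
  shows "qpoch (Q ^ N) (x ^ N) = (\<Prod>j<N. qpoch Q (x * cis (2 * pi * real j / real N)))"
proof -
  have QN: "0 < Q ^ N" "Q ^ N < 1"
    using assms by (auto simp: power_less_one_iff)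
  show ?thesis
  proof (rule LIMSEQ_unique[OF qpoch_LIMSEQ[OF QN]])
    have "(\<lambda>n. \<Prod>j<N. \<Prod>i<n. 1 - of_real Q ^ i * (x * cis (2 * pi * real j / real N)))
       \<longlonglongrightarrow> (\<Prod>j<N. qpoch Q (x * cis (2 * pi * real j / real N)))"
      by (intro tendsto_prod qpoch_LIMSEQ Q)
    also have "(\<lambda>n. \<Prod>j<N. \<Prod>i<n. 1 - of_real Q ^ i * (x * cis (2 * pi * real j / real N)))
       = (\<lambda>n. \<Prod>i<n. 1 - of_real (Q ^ N) ^ i * x ^ N)"
      by (subst prod.swap, subst mult.assoc [symmetric], subst prod_one_minus_roots_of_unity[OF assms(3)])
         (simp add: power_mult_distrib power_mult[symmetric] mult.commute)
    finally show "(\<lambda>n. \<Prod>i<n. 1 - of_real (Q ^ N) ^ i * x ^ N) \<longlonglongrightarrow>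
       (\<Prod>j<N. qpoch Q (x * cis (2 * pi * real j / real N)))" .
  qed
qed

text \<open>Up to a constant factor, the product side of Jacobi's triple product in a multiplicative
  variable. For \<open>0 < Q < 1\<close> its zeros off the origin are the integer powers of
  \<open>Q\<close>.\<close>

definition qtheta :: "real \<Rightarrow> complex \<Rightarrow> complex" where
  "qtheta Q w = qpoch Q w * qpoch Q (of_real Q / w)"

context
  fixes Q :: real
  assumes Q: "0 < Q" "Q < 1"
begin

text \<open>The shift drops the factor \<open>1 - w\<close> from one product and adds
  \<open>1 - 1 / w\<close> to the other.\<close>

lemma qtheta_shift:
  assumes "w \<noteq> 0"
  shows "qtheta Q (of_real Q * w) = - qtheta Q w / w"
proof -
  have "qtheta Q (of_real Q * w) = qpoch Q (of_real Q * w) * ((1 - 1 / w) * qpoch Q (of_real Q / w))"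
    unfolding qtheta_def using qpoch_rec[OF Q, of "1 / w"] Q assms by simp
  also have "\<dots> = - ((1 - w) * qpoch Q (of_real Q * w) * qpoch Q (of_real Q / w)) / w"
    using assms by (simp add: field_simps)
  also have "\<dots> = - qtheta Q w / w"
    unfolding qtheta_def using qpoch_rec[OF Q, of w] by simp
  finally show ?thesis .
qed

text \<open>The values at \<open>1 / w\<close> and at \<open>Q * w\<close> consist of the same two
  products in exchanged order.\<close>

lemma qtheta_inverse:
  assumes "w \<noteq> 0"
  shows "qtheta Q (1 / w) = - qtheta Q w / w"
  using qtheta_shift[OF assms] Q assms by (simp add: qtheta_def mult_ac)

lemma qtheta_reflect: "w \<noteq> 0 \<Longrightarrow> qtheta Q (of_real Q / w) = qtheta Q w"
  using Q by (simp add: qtheta_def mult_ac)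

lemma qtheta_1 [simp]: "qtheta Q 1 = 0"
  using qpoch_rec[OF Q, of 1] by (simp add: qtheta_def)

lemma qtheta_comp_holomorphic [holomorphic_intros]:
  "f holomorphic_on A \<Longrightarrow> (\<And>w. w \<in> A \<Longrightarrow> f w \<noteq> 0) \<Longrightarrow> (\<lambda>w. qtheta Q (f w)) holomorphic_on A"
  unfolding qtheta_def by (intro holomorphic_intros Q) auto

lemma qpoch_nonzero:
  assumes "norm w < 1"
  shows "qpoch Q w \<noteq> 0"
proof
  assume "qpoch Q w = 0"
  then obtain j where j: "of_real Q ^ j * w = 1"
    using qpoch_eq_0_iff[OF Q] by blast
  have "norm (of_real Q ^ j * w) = Q ^ j * norm w"
    using Q by (simp add: norm_mult norm_power)
  also have "\<dots> \<le> 1 * norm w"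
    using Q by (intro mult_right_mono power_le_one) auto
  finally show False using j assms by simp
qed

lemma qtheta_nonzero:
  assumes "norm w = 1" "w \<noteq> 1"
  shows "qtheta Q w \<noteq> 0"
proof -
  have "norm (of_real Q * w) < 1" "norm (of_real Q / w) < 1"
    using Q assms by (auto simp: norm_mult norm_divide)
  then have "qpoch Q (of_real Q * w) \<noteq> 0" "qpoch Q (of_real Q / w) \<noteq> 0"
    using qpoch_nonzero by blast+
  then show ?thesis
    unfolding qtheta_def using assms qpoch_rec[OF Q, of w] by simp
qed

end

section \<open>The addition theorem by the maximum modulus principle\<close>

lemma holomorphic_factor_root:
  assumes "f holomorphic_on S" "open S" "f a = 0"
  obtains g where "g holomorphic_on S" "\<And>z. z \<in> S \<Longrightarrow> f z = (z - a) * g z"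
proof
  show "(\<lambda>z. if z = a then deriv f a else (f z - f a) / (z - a)) holomorphic_on S"
    by (rule pole_lemma_open) fact+
qed (use assms in auto)

text \<open>The closed annulus \<open>K\<close> is a fundamental domain for multiplication by
  \<open>q\<^sup>2\<close>, and at most one shift moves a point of the open annulus into it. So the
  modulus of \<open>f\<close> attains its maximum over the open annulus at a point of
  \<open>K\<close>.\<close>

lemma annulus_shift_invariant_constant:
  fixes f :: "complex \<Rightarrow> complex"
  assumes q: "0 < q" "q < 1"
    and holo: "f holomorphic_on {w. q\<^sup>2 < norm w \<and> norm w < 1 / q\<^sup>2}"
    and inv: "\<And>w. 1 < norm w \<Longrightarrow> norm w < 1 / q\<^sup>2 \<Longrightarrow> f (of_real (q\<^sup>2) * w) = f w"
  shows "f constant_on {w. q\<^sup>2 < norm w \<and> norm w < 1 / q\<^sup>2}"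
proof -
  define U where "U = {w :: complex. q\<^sup>2 < norm w \<and> norm w < 1 / q\<^sup>2}"
  define K where "K = {w :: complex. q \<le> norm w \<and> norm w \<le> 1 / q}"
  have q2: "q\<^sup>2 < q" "0 < q\<^sup>2" "1 / q < 1 / q\<^sup>2" "1 < 1 / q"
    using q by (auto simp: power2_eq_square field_simps)
  have "K \<subseteq> U" using q2 by (auto simp: K_def U_def)
  have "open U"
    unfolding U_def by (intro open_Collect_conj open_Collect_less continuous_intros)
  have "connected U"
    unfolding U_def using connected_annulus(1)[of "q\<^sup>2" "0 :: complex" "1 / q\<^sup>2"] by simp
  have "compact K"
  proof -
    have "K = cball 0 (1 / q) \<inter> - ball 0 q"
      by (auto simp: K_def)
    moreover have "closed (- ball 0 q :: complex set)" by auto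
    ultimately show ?thesis by (metis compact_cball compact_Int_closed)
  qed
  moreover have "1 \<in> K" using q2 q by (auto simp: K_def)
  moreover have "continuous_on K (\<lambda>w. norm (f w))"
    using holomorphic_on_imp_continuous_on[OF holo] \<open>K \<subseteq> U\<close>
    unfolding U_def by (intro continuous_intros) (rule continuous_on_subset)
  ultimately obtain w0 where w0: "w0 \<in> K" "\<And>w. w \<in> K \<Longrightarrow> norm (f w) \<le> norm (f w0)"
    using continuous_attains_sup[of K "\<lambda>w. norm (f w)"] by blast
  have "norm (f w) \<le> norm (f w0)" if "w \<in> U" for w
  proof -
    consider "w \<in> K" | "norm w > 1 / q" | "norm w < q"
      by (force simp: K_def)
    then show ?thesis
    proof cases
      case 1
      then show ?thesis by (rule w0)
    next
      case 2
      have w: "1 < norm w" "norm w < 1 / q\<^sup>2"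
        using 2 q2 that by (auto simp: U_def)
      have "norm (of_real (q\<^sup>2) * w) = q\<^sup>2 * norm w"
        by (simp add: norm_mult norm_power)
      moreover have "q\<^sup>2 * norm w \<ge> q\<^sup>2 * (1 / q)"
        using 2 by (intro mult_left_mono) auto
      moreover have "q\<^sup>2 * norm w \<le> 1"
        using w q2 by (simp add: field_simps)
      moreover have "q\<^sup>2 * (1 / q) = q"
        using q by (simp add: power2_eq_square)
      ultimately have "of_real (q\<^sup>2) * w \<in> K"
        using q2(4) unfolding K_def mem_Collect_eq by linarith
      then show ?thesis using w0(2) inv[OF w] by metis
    next
      case 3
      define v where "v = w / of_real (q\<^sup>2)"
      have w: "w = of_real (q\<^sup>2) * v" using q by (simp add: v_def)
      have v: "norm v = norm w / q\<^sup>2" using q by (simp add: v_def norm_divide norm_power)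
      have v1: "1 < norm v" using that q2 unfolding v by (simp add: U_def)
      have v2: "norm v < 1 / q" using 3 q unfolding v by (simp add: power2_eq_square field_simps)
      have "v \<in> K" using v1 v2 q by (simp add: K_def)
      then show ?thesis using w0(2) inv[OF v1] v2 q2 w by force
    qed
  qed
  then show ?thesis
    using maximum_modulus_principle[of f U U w0] holo \<open>open U\<close> \<open>connected U\<close> w0(1) \<open>K \<subseteq> U\<close>
    by (auto simp: U_def)
qed

text \<open>As functions of \<open>w\<close>, both sides pick up the same factor when
  \<open>w\<close> is multiplied by \<open>q\<^sup>2\<close>. In the annulus the left side has only
  the simple zeros \<open>b\<close> and \<open>1 / b\<close>, distinct because \<open>b\<close> is
  neither \<open>1\<close> nor \<open>-1\<close>, and the right side vanishes there too. The
  quotient is holomorphic and shift invariant, hence constant, and \<open>w = 1\<close> determines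
  it.\<close>

lemma qtheta_addition:
  fixes q :: real and b w :: complex
  assumes q: "0 < q" "q < 1" and b: "norm b = 1" "b \<noteq> 1" "b \<noteq> -1"
    and w: "q\<^sup>2 < norm w" "norm w < 1 / q\<^sup>2"
  defines "T \<equiv> qtheta (q\<^sup>2)"
  shows "T (w * b) * T (w / b) * (T q)\<^sup>2 = (T w)\<^sup>2 * (T (q * b))\<^sup>2 - w / b * (T (q * w))\<^sup>2 * (T b)\<^sup>2"
proof -
  define Q where "Q = q\<^sup>2"
  have Q: "0 < Q" "Q < 1" using q by (auto simp: Q_def power_less_one_iff)
  define U where "U = {w :: complex. q\<^sup>2 < norm w \<and> norm w < 1 / q\<^sup>2}"
  have "open U"
    unfolding U_def by (intro open_Collect_conj open_Collect_less continuous_intros)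
  have U0: "w \<noteq> 0" if "w \<in> U" for w using that q by (auto simp: U_def)
  have [simp]: "b \<noteq> 0" "q \<noteq> 0" using b q by auto
  define N where "N w = (T w)\<^sup>2 * (T (q * b))\<^sup>2 - w / b * (T (q * w))\<^sup>2 * (T b)\<^sup>2" for w :: complex
  \<comment> \<open>The theta product of the left side with the linear factors at \<open>b\<close>
    and \<open>1 / b\<close> divided out; no zero in the annulus is left.\<close>
  define E where "E w = qpoch Q (Q * w * b) * qpoch Q (Q / (w * b)) * qpoch Q (Q * w / b) * qpoch Q (Q * b / w)" for w :: complex
  have T_shift: "T (of_real Q * w) = - T w / w" if "w \<noteq> 0" for w
    using qtheta_shift[OF Q that] by (simp add: T_def Q_def)
  have T_inv: "T (1 / w) = - T w / w" if "w \<noteq> 0" for w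
    using qtheta_inverse[OF Q that] by (simp add: T_def Q_def)
  have T_refl: "T (of_real Q / w) = T w" if "w \<noteq> 0" for w
    using qtheta_reflect[OF Q that] by (simp add: T_def Q_def)
  have T1: "T 1 = 0" using qtheta_1[OF Q] by (simp add: T_def Q_def)
  have T_q_div: "T (q / v) = T (q * v)" if "v \<noteq> 0" for v :: complex
    using T_refl[of "q * v"] that by (simp add: Q_def power2_eq_square)
  have D: "T (w * b) * T (w / b) = (w - b) * (w - 1 / b) * E w" if "w \<noteq> 0" for w :: complex
  proof -
    have eq: "(1 - w * b) * (1 - w / b) = (w - b) * (w - 1 / b)"
      by (simp add: field_simps)
    have "T (w * b) = (1 - w * b) * qpoch Q (Q * w * b) * qpoch Q (Q / (w * b))"
      unfolding T_def qtheta_def Q_def[symmetric] by (subst qpoch_rec[OF Q]) (simp add: mult_ac)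
    moreover have "T (w / b) = (1 - w / b) * qpoch Q (Q * w / b) * qpoch Q (Q * b / w)"
      unfolding T_def qtheta_def Q_def[symmetric] by (subst qpoch_rec[OF Q]) (simp add: mult_ac)
    ultimately have "T (w * b) * T (w / b) = ((1 - w * b) * (1 - w / b)) * E w"
      unfolding E_def by (simp only: mult_ac)
    then show ?thesis using eq by simp
  qed
  have E_nz: "E w \<noteq> 0" if "w \<in> U" for w
  proof -
    have "Q * norm w < 1" "Q / norm w < 1"
      using that Q U0[OF that] by (simp_all add: U_def Q_def[symmetric] field_simps)
    then show ?thesis
      unfolding E_def using Q b by (auto intro!: qpoch_nonzero[OF Q] simp: norm_mult norm_divide)
  qed
  have "N holomorphic_on U"
    unfolding N_def T_def Q_def[symmetric] by (intro holomorphic_intros Q) (auto dest: U0)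
  moreover have "N b = 0" unfolding N_def by simp
  ultimately obtain N1 where N1: "N1 holomorphic_on U" "\<And>z. z \<in> U \<Longrightarrow> N z = (z - b) * N1 z"
    using holomorphic_factor_root \<open>open U\<close> by blast
  have bU: "1 / b \<in> U" "b \<in> U" "1 \<in> U"
    using b q by (auto simp: U_def norm_divide power_less_one_iff)
  \<comment> \<open>The two terms of \<open>N\<close> coincide because
    \<open>T (1 / b) = - T b / b\<close> and \<open>T (q / b) = T (q * b)\<close>.\<close>
  have "N (1 / b) = 0"
    unfolding N_def using T_inv[of b] T_q_div[of b] by (simp add: power2_eq_square)
  moreover have "1 / b - b \<noteq> 0"
    using b by (simp add: field_simps) (metis power2_eq_1_iff power2_eq_square)
  ultimately have "N1 (1 / b) = 0"
    using N1(2)[OF bU(1)] by simp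
  then obtain N2 where N2: "N2 holomorphic_on U" "\<And>z. z \<in> U \<Longrightarrow> N1 z = (z - 1 / b) * N2 z"
    using holomorphic_factor_root[OF N1(1) \<open>open U\<close>] by blast
  define R where "R w = N2 w / E w" for w :: complex
  have ND: "N w = R w * (T (w * b) * T (w / b))" if "w \<in> U" for w
    using that N1(2) N2(2) E_nz D U0 unfolding R_def by simp
  have "R holomorphic_on U"
    unfolding R_def E_def by (intro holomorphic_intros N2(1) Q) (use E_nz in \<open>auto simp: E_def dest: U0\<close>)
  moreover have "R (of_real (q\<^sup>2) * w) = R w" if w: "1 < norm w" "norm w < 1 / q\<^sup>2" for w
  proof -
    have w0: "w \<noteq> 0" using w by auto
    have "Q < 1 * norm w" using w Q by linarith
    then have wU: "w \<in> U" using w by (simp add: U_def Q_def)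
    have "Q * 1 < Q * norm w" "Q * norm w < 1"
      using w Q by (auto simp: Q_def field_simps)
    moreover have "1 < 1 / Q" using Q by simp
    moreover have "norm (of_real Q * w) = Q * norm w" using Q by (simp add: norm_mult)
    ultimately have QwU: "of_real Q * w \<in> U"
      unfolding U_def Q_def[symmetric] mem_Collect_eq by linarith
    \<comment> \<open>Off the unit circle \<open>w\<close> meets neither \<open>b\<close> nor
      \<open>1 / b\<close>, so this product can be cancelled.\<close>
    have "T (w * b) * T (w / b) \<noteq> 0"
    proof -
      have "w \<noteq> b" "w \<noteq> 1 / b" using w b by (auto simp: norm_divide)
      then show ?thesis using D[OF w0] E_nz[OF wU] by simp
    qed
    moreover have D': "T (Q * w * b) * T (Q * w / b) = T (w * b) * T (w / b) / w\<^sup>2"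
      using T_shift[of "w * b"] T_shift[of "w / b"] w0 by (simp add: mult_ac power2_eq_square)
    moreover have N': "N (Q * w) = N w / w\<^sup>2"
    proof -
      have "T (of_real q * (of_real Q * w)) = - T (q * w) / (q * w)"
        using T_shift[of "q * w"] w0 by (simp add: mult_ac)
      then have "(T (of_real q * (of_real Q * w)))\<^sup>2 = (T (q * w))\<^sup>2 / (Q * w\<^sup>2)"
        by (simp add: power2_eq_square Q_def)
      moreover have "(T (of_real Q * w))\<^sup>2 = (T w)\<^sup>2 / w\<^sup>2"
        using T_shift[OF w0] by (simp add: power_divide)
      ultimately have "N (Q * w) = (T w)\<^sup>2 / w\<^sup>2 * (T (q * b))\<^sup>2 - Q * w / b * ((T (q * w))\<^sup>2 / (Q * w\<^sup>2)) * (T b)\<^sup>2"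
        unfolding N_def by (simp only:)
      then show ?thesis
        unfolding N_def using w0 Q by (simp add: field_simps)
    qed
    moreover have "R (Q * w) * (T (w * b) * T (w / b) / w\<^sup>2) = R w * (T (w * b) * T (w / b)) / w\<^sup>2"
      using ND[OF wU] ND[OF QwU] D' N' by metis
    ultimately show ?thesis
      using w0 by (simp add: Q_def[symmetric])
  qed
  ultimately have "R constant_on U"
    unfolding U_def using annulus_shift_invariant_constant[OF q] by blast
  \<comment> \<open>At \<open>w = 1\<close> only the second term of \<open>N\<close> survives, and
    \<open>T (1 / b) = - T b / b\<close> makes it a multiple of the theta product.\<close>
  moreover have "R 1 = (T q)\<^sup>2"
  proof -
    have "T b \<noteq> 0" using qtheta_nonzero[OF Q b(1,2)] by (simp add: T_def Q_def)
    then show ?thesis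
      using ND[OF bU(3)] T1 T_inv[of b] by (simp add: N_def power2_eq_square field_simps)
  qed
  moreover have wU: "w \<in> U" using w by (simp add: U_def)
  ultimately have "R w = (T q)\<^sup>2"
    unfolding constant_on_def using bU(3) by metis
  then show ?thesis
    using ND[OF wU] by (simp add: N_def mult_ac)
qed

section \<open>A Jacobi elliptic function on the real line\<close>

text \<open>
  In terms of the nome \<open>q = r\<^sup>4\<close>, up to a common constant factor, \<open>theta_H r\<close> is Jacobi's \<open>\<theta>\<^sub>4\<close> and
  \<open>2 r sin z theta_G r z\<close> is \<open>\<theta>\<^sub>1\<close>, so that \<open>jsn r z = \<surd>k sn (2 K z / \<pi>)\<close>. The parameter \<open>r\<close> avoids fractional powers of \<open>q\<close>.
\<close>

definition theta_G :: "real \<Rightarrow> real \<Rightarrow> real" where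
  "theta_G r z = (norm (qpoch (r ^ 8) (of_real (r ^ 8) * cis (2 * z))))\<^sup>2"

definition theta_H :: "real \<Rightarrow> real \<Rightarrow> real" where
  "theta_H r z = (norm (qpoch (r ^ 8) (of_real (r ^ 4) * cis (2 * z))))\<^sup>2"

definition jsn :: "real \<Rightarrow> real \<Rightarrow> real" where
  "jsn r z = 2 * r * sin z * theta_G r z / theta_H r z"

text \<open>Restores the values excluded in \<open>qtheta_addition\<close>:
  \<open>cis (2 * a)\<close> is \<open>1\<close> or \<open>-1\<close> exactly when
  \<open>sin (2 * a) = 0\<close>. The points \<open>a + 1 / Suc n\<close> avoid this because
  \<open>2 / Suc n\<close> lies strictly between \<open>0\<close> and \<open>pi\<close>.\<close>

lemma eq_by_continuity_sin:
  fixes f g :: "real \<Rightarrow> real"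
  assumes "continuous_on UNIV f" "continuous_on UNIV g"
    and eq: "\<And>a. sin (2 * a) \<noteq> 0 \<Longrightarrow> f a = g a"
  shows "f a = g a"
proof (cases "sin (2 * a) = 0")
  case True
  define x where "x n = a + 1 / real (Suc n)" for n
  have "x \<longlonglongrightarrow> a + 0"
    unfolding x_def by (intro tendsto_intros LIMSEQ_Suc[OF lim_1_over_n])
  then have x: "x \<longlonglongrightarrow> a" by simp
  have "f (x n) = g (x n)" for n
  proof (rule eq)
    have "sin (2 / real (Suc n)) > 0"
    proof (rule sin_gt_zero)
      have "2 / real (Suc n) \<le> 2" by (simp add: field_simps)
      then show "2 / real (Suc n) < pi" using pi_gt3 by linarith
    qed auto
    moreover have "cos (2 * a) \<noteq> 0"
      using True sin_zero_abs_cos_one by force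
    ultimately show "sin (2 * x n) \<noteq> 0"
      unfolding x_def using True by (simp add: distrib_left sin_add)
  qed
  moreover have "(\<lambda>n. f (x n)) \<longlonglongrightarrow> f a" "(\<lambda>n. g (x n)) \<longlonglongrightarrow> g a"
    using assms(1,2) x by (auto intro: continuous_on_tendsto_compose)
  ultimately show ?thesis using LIMSEQ_unique by force
qed (rule eq)

lemma one_minus_cis: "1 - cis (2 * z) = - (2 * \<i> * of_real (sin z) * cis z)"
  by (auto simp: complex_eq_iff cos_double_sin sin_double power2_eq_square)

context
  fixes r :: real
  assumes r: "0 < r" "r < 1"
begin

text \<open>\<open>r ^ 4\<close> takes the place of \<open>q\<close> in
  \<open>qtheta_addition\<close>, which makes \<open>r ^ 8\<close> the base of the products.\<close>

lemma eighth_power_bounds: "0 < r ^ 8" "r ^ 8 < 1" and fourth_power_bounds: "0 < r ^ 4" "r ^ 4 < 1" and fourth_power_square: "(r ^ 4)\<^sup>2 = r ^ 8"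
  using r by (auto simp: power_less_one_iff simp flip: power_mult)

text \<open>For \<open>w\<close> on the unit circle, \<open>r ^ 8 / w\<close> is the conjugate of
  \<open>r ^ 8 * w\<close>. Once \<open>1 - w\<close> is split off, the two products form a squared
  modulus.\<close>

lemma qtheta_cis: "qtheta (r ^ 8) (cis (2 * z)) = - (2 * \<i> * of_real (sin z) * cis z * of_real (theta_G r z))"
proof -
  have "qpoch (r ^ 8) (of_real (r ^ 8) / cis (2 * z)) = cnj (qpoch (r ^ 8) (of_real (r ^ 8) * cis (2 * z)))"
    by (simp add: qpoch_cnj[OF eighth_power_bounds, symmetric] divide_inverse cis_cnj)
  then have "qtheta (r ^ 8) (cis (2 * z)) = (1 - cis (2 * z)) *
     (qpoch (r ^ 8) (of_real (r ^ 8) * cis (2 * z)) * cnj (qpoch (r ^ 8) (of_real (r ^ 8) * cis (2 * z))))"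
    unfolding qtheta_def by (subst qpoch_rec[OF eighth_power_bounds]) simp
  then show ?thesis
    unfolding theta_G_def complex_norm_square[symmetric] one_minus_cis by simp
qed

lemma qtheta_cis_square:
  "(qtheta (r ^ 8) (cis (2 * z)))\<^sup>2 = - 4 * (cis (2 * z) * of_real ((sin z)\<^sup>2 * (theta_G r z)\<^sup>2))"
proof -
  have "(cis z)\<^sup>2 = cis (2 * z)"
    by (simp add: cis_mult power2_eq_square)
  then show ?thesis
    unfolding qtheta_cis by (simp add: power_mult_distrib)
qed

lemma qtheta_cis_mult:
  "qtheta (r ^ 8) (cis (2 * (z + a))) * qtheta (r ^ 8) (cis (2 * (z - a)))
     = - 4 * (cis (2 * z) * of_real (sin (z + a) * sin (z - a) * (theta_G r (z + a) * theta_G r (z - a))))"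
proof -
  have "cis (z + a) * cis (z - a) = cis (2 * z)"
    by (simp add: cis_mult)
  then have "- 4 * (cis (2 * z) * of_real (sin (z + a) * sin (z - a) * (theta_G r (z + a) * theta_G r (z - a))))
     = - 4 * (cis (z + a) * cis (z - a) * of_real (sin (z + a) * sin (z - a) * (theta_G r (z + a) * theta_G r (z - a))))"
    by simp
  moreover have "- (2 * \<i> * s * c * g) * - (2 * \<i> * s' * c' * g') = - 4 * (c * c' * (s * s' * (g * g')))"
    for s c g s' c' g' :: complex
    by (simp add: algebra_simps)
  ultimately show ?thesis
    unfolding qtheta_cis of_real_mult by (simp only:)
qed

text \<open>On the circle of radius \<open>r ^ 4\<close> the point \<open>r ^ 8 / w\<close> is the
  conjugate of \<open>w\<close>, so the two products are conjugate and no phase remains.\<close>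

lemma qtheta_r4_cis: "qtheta (r ^ 8) (of_real (r ^ 4) * cis (2 * z)) = of_real (theta_H r z)"
proof -
  have "of_real (r ^ 8) / (of_real (r ^ 4) * cis (2 * z)) = of_real (r ^ 4) * cnj (cis (2 * z))"
  proof -
    have "complex_of_real (r ^ 8) = of_real (r ^ 4) * of_real (r ^ 4)"
      by (simp flip: power_add)
    moreover have "complex_of_real (r ^ 4) \<noteq> 0" using r by simp
    ultimately have "of_real (r ^ 8) / (of_real (r ^ 4) * cis (2 * z)) = of_real (r ^ 4) / cis (2 * z)"
      by (metis nonzero_mult_divide_mult_cancel_left)
    then show ?thesis by (simp add: divide_inverse cis_cnj)
  qed
  then have "qpoch (r ^ 8) (of_real (r ^ 8) / (of_real (r ^ 4) * cis (2 * z))) =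
     cnj (qpoch (r ^ 8) (of_real (r ^ 4) * cis (2 * z)))"
    by (simp add: qpoch_cnj[OF eighth_power_bounds, symmetric])
  then show ?thesis
    unfolding qtheta_def theta_H_def by (simp only: complex_norm_square)
qed

lemma theta_comp_continuous [continuous_intros]:
  assumes "continuous_on A f"
  shows "continuous_on A (\<lambda>x. theta_G r (f x))" "continuous_on A (\<lambda>x. theta_H r (f x))"
proof -
  have "continuous_on A (\<lambda>x. (norm (qpoch (r ^ 8) (of_real c * cis (2 * f x))))\<^sup>2)" for c
    by (rule continuous_on_power[OF continuous_on_norm[OF qpoch_comp_continuous[OF eighth_power_bounds]]])
       (intro continuous_on_mult continuous_on_const continuous_on_cis assms)
  then show "continuous_on A (\<lambda>x. theta_G r (f x))" "continuous_on A (\<lambda>x. theta_H r (f x))"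
    unfolding theta_G_def theta_H_def by blast+
qed

lemma theta_H_pos: "theta_H r z > 0"
proof -
  have "norm (of_real (r ^ 4) * cis (2 * z)) < 1"
    using fourth_power_bounds by (simp add: norm_mult norm_power)
  from qpoch_nonzero[OF eighth_power_bounds this] show ?thesis by (simp add: theta_H_def)
qed

lemma theta_G_pos: "theta_G r z > 0"
proof -
  have "norm (of_real (r ^ 8) * cis (2 * z)) < 1"
    using eighth_power_bounds by (simp add: norm_mult norm_power)
  from qpoch_nonzero[OF eighth_power_bounds this] show ?thesis by (simp add: theta_G_def)
qed

text \<open>The case \<open>w = cis (2 * z)\<close>, \<open>b = cis (2 * a)\<close> of
  \<open>qtheta_addition\<close>, in which the common factor \<open>- 4 * cis (2 * z)\<close>
  cancels.\<close>

lemma theta_G_addition: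
  "sin (z + a) * sin (z - a) * (theta_G r (z + a) * theta_G r (z - a)) * (theta_H r 0)\<^sup>2 =
     (sin z)\<^sup>2 * (theta_G r z)\<^sup>2 * (theta_H r a)\<^sup>2 - (sin a)\<^sup>2 * (theta_G r a)\<^sup>2 * (theta_H r z)\<^sup>2"
  (is "?L a = ?R a")
proof -
  have generic: "?L a = ?R a" if a: "sin (2 * a) \<noteq> 0" for a :: real
  proof -
    define T where "T = qtheta (r ^ 8)"
    have b: "cis (2 * a) \<noteq> 1" "cis (2 * a) \<noteq> -1"
      using a by (auto simp: complex_eq_iff)
    have "1 < 1 / r ^ 8" using eighth_power_bounds by simp
    then have "T (cis (2 * z) * cis (2 * a)) * T (cis (2 * z) / cis (2 * a)) * (T (of_real (r ^ 4)))\<^sup>2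
       = (T (cis (2 * z)))\<^sup>2 * (T (of_real (r ^ 4) * cis (2 * a)))\<^sup>2
         - cis (2 * z) / cis (2 * a) * (T (of_real (r ^ 4) * cis (2 * z)))\<^sup>2 * (T (cis (2 * a)))\<^sup>2"
      using qtheta_addition[OF fourth_power_bounds, of "cis (2 * a)" "cis (2 * z)"] b eighth_power_bounds
      unfolding fourth_power_square T_def by simp
    moreover have "T (cis (2 * z) * cis (2 * a)) = T (cis (2 * (z + a)))"
       "T (cis (2 * z) / cis (2 * a)) = T (cis (2 * (z - a)))" "T (of_real (r ^ 4)) = T (of_real (r ^ 4) * cis (2 * 0))"
      by (simp_all add: cis_mult cis_divide algebra_simps)
    ultimately have *: "T (cis (2 * (z + a))) * T (cis (2 * (z - a))) * (T (of_real (r ^ 4) * cis (2 * 0)))\<^sup>2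
       = (T (cis (2 * z)))\<^sup>2 * (T (of_real (r ^ 4) * cis (2 * a)))\<^sup>2
         - cis (2 * z) / cis (2 * a) * (T (of_real (r ^ 4) * cis (2 * z)))\<^sup>2 * (T (cis (2 * a)))\<^sup>2"
      by (simp only:)
    define c d where "c = cis (2 * z)" and "d = cis (2 * a)"
    have cd: "c \<noteq> 0" "d \<noteq> 0" by (simp_all add: c_def d_def)
    have cancel: "u * k = v * l - w * m"
      if "- 4 * (c * u) * k = - 4 * (c * v) * l - c / d * m * (- 4 * (d * w))" for u v w k l m
    proof -
      have "4 * c * (u * k) = 4 * c * (v * l - w * m)"
        using that cd by (simp add: field_simps)
      then show ?thesis using cd by simp
    qed
    have "of_real (sin (z + a) * sin (z - a) * (theta_G r (z + a) * theta_G r (z - a))) * (complex_of_real (theta_H r 0))\<^sup>2 =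
       of_real ((sin z)\<^sup>2 * (theta_G r z)\<^sup>2) * (of_real (theta_H r a))\<^sup>2
       - of_real ((sin a)\<^sup>2 * (theta_G r a)\<^sup>2) * (of_real (theta_H r z))\<^sup>2"
      by (rule cancel) (use * in \<open>unfold T_def qtheta_cis_mult qtheta_cis_square qtheta_r4_cis c_def d_def\<close>)
    then have "complex_of_real (sin (z + a) * sin (z - a) * (theta_G r (z + a) * theta_G r (z - a)) * (theta_H r 0)\<^sup>2) =
       of_real ((sin z)\<^sup>2 * (theta_G r z)\<^sup>2 * (theta_H r a)\<^sup>2 - (sin a)\<^sup>2 * (theta_G r a)\<^sup>2 * (theta_H r z)\<^sup>2)"
      by simp
    then show ?thesis
      unfolding of_real_eq_iff .
  qed
  have cont: "continuous_on UNIV ?L" "continuous_on UNIV ?R"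
    by (intro continuous_intros)+
  show ?thesis
    by (rule eq_by_continuity_sin[of ?L ?R a, OF cont]) (rule generic)
qed

text \<open>Now \<open>w = r ^ 4 * cis (2 * z)\<close>. The last term contains the value at
  \<open>r ^ 8 * cis (2 * z)\<close>, which the shift rule brings back to the unit circle; two
  factors \<open>- 4\<close> give the coefficient \<open>16\<close>.\<close>

lemma theta_H_addition:
  "theta_H r (z + a) * theta_H r (z - a) * (theta_H r 0)\<^sup>2 =
     (theta_H r z)\<^sup>2 * (theta_H r a)\<^sup>2 - 16 * r ^ 4 * ((sin z)\<^sup>2 * (theta_G r z)\<^sup>2) * ((sin a)\<^sup>2 * (theta_G r a)\<^sup>2)"
  (is "?L a = ?R a")
proof -
  have generic: "?L a = ?R a" if a: "sin (2 * a) \<noteq> 0" for a :: real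
  proof -
    define T where "T = qtheta (r ^ 8)"
    define w where "w = of_real (r ^ 4) * cis (2 * z)"
    have w0: "w \<noteq> 0" using r by (simp add: w_def)
    have b: "cis (2 * a) \<noteq> 1" "cis (2 * a) \<noteq> -1"
      using a by (auto simp: complex_eq_iff)
    have nw: "norm w = r ^ 4" using r by (simp add: w_def norm_mult norm_power)
    have "r ^ 8 < r ^ 4" "r ^ 4 < 1 / r ^ 8"
    proof -
      have "r ^ 4 * r ^ 4 < r ^ 4 * 1" using fourth_power_bounds by (intro mult_strict_left_mono) auto
      then show "r ^ 8 < r ^ 4" by (simp flip: power_add)
      have "r ^ 4 < 1" "1 \<le> 1 / r ^ 8" using fourth_power_bounds eighth_power_bounds by auto
      then show "r ^ 4 < 1 / r ^ 8" by linarith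
    qed
    then have "T (w * cis (2 * a)) * T (w / cis (2 * a)) * (T (of_real (r ^ 4)))\<^sup>2
       = (T w)\<^sup>2 * (T (of_real (r ^ 4) * cis (2 * a)))\<^sup>2
         - w / cis (2 * a) * (T (of_real (r ^ 4) * w))\<^sup>2 * (T (cis (2 * a)))\<^sup>2"
      using qtheta_addition[OF fourth_power_bounds, of "cis (2 * a)" w] b nw
      unfolding fourth_power_square T_def by simp
    moreover have "T (w * cis (2 * a)) = T (of_real (r ^ 4) * cis (2 * (z + a)))"
       "T (w / cis (2 * a)) = T (of_real (r ^ 4) * cis (2 * (z - a)))" "T (of_real (r ^ 4)) = T (of_real (r ^ 4) * cis (2 * 0))"
      by (simp_all add: w_def cis_mult cis_divide mult.assoc distrib_left right_diff_distrib flip: times_divide_eq_right)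
    moreover have "T (of_real (r ^ 4) * w) = - T (cis (2 * z)) / cis (2 * z)"
      using qtheta_shift[OF eighth_power_bounds, of "cis (2 * z)"]
      by (simp add: T_def w_def mult.assoc[symmetric] flip: power_add of_real_mult of_real_power)
    ultimately have *: "T (of_real (r ^ 4) * cis (2 * (z + a))) * T (of_real (r ^ 4) * cis (2 * (z - a))) * (T (of_real (r ^ 4) * cis (2 * 0)))\<^sup>2
       = (T (of_real (r ^ 4) * cis (2 * z)))\<^sup>2 * (T (of_real (r ^ 4) * cis (2 * a)))\<^sup>2
         - of_real (r ^ 4) * cis (2 * z) / cis (2 * a) * (T (cis (2 * z)) / cis (2 * z))\<^sup>2 * (T (cis (2 * a)))\<^sup>2"
      by (simp add: w_def)
    define c d where "c = cis (2 * z)" and "d = cis (2 * a)"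
    have cd: "c \<noteq> 0" "d \<noteq> 0" by (simp_all add: c_def d_def)
    have "k * c / d * (- 4 * (c * u) / c\<^sup>2) * (- 4 * (d * v)) = 16 * (k * u * v)" for k u v
      using cd by (simp add: field_simps power2_eq_square)
    then have "of_real (r ^ 4) * cis (2 * z) / cis (2 * a) * (T (cis (2 * z)) / cis (2 * z))\<^sup>2 * (T (cis (2 * a)))\<^sup>2
       = 16 * (of_real (r ^ 4) * of_real ((sin z)\<^sup>2 * (theta_G r z)\<^sup>2) * of_real ((sin a)\<^sup>2 * (theta_G r a)\<^sup>2))"
      unfolding T_def power_divide qtheta_cis_square c_def d_def .
    then have "complex_of_real (theta_H r (z + a) * theta_H r (z - a) * (theta_H r 0)\<^sup>2) =
      of_real ((theta_H r z)\<^sup>2 * (theta_H r a)\<^sup>2 - 16 * r ^ 4 * ((sin z)\<^sup>2 * (theta_G r z)\<^sup>2) * ((sin a)\<^sup>2 * (theta_G r a)\<^sup>2))"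
      using * unfolding T_def qtheta_r4_cis by simp
    then show ?thesis
      unfolding of_real_eq_iff .
  qed
  have cont: "continuous_on UNIV ?L" "continuous_on UNIV ?R"
    by (intro continuous_intros)+
  show ?thesis
    by (rule eq_by_continuity_sin[of ?L ?R a, OF cont]) (rule generic)
qed

lemma theta_even: "theta_G r (- z) = theta_G r z" "theta_H r (- z) = theta_H r z"
proof -
  have "cis (2 * - z) = cnj (cis (2 * z))" by (simp add: cis_cnj)
  then have "of_real c * cis (2 * - z) = cnj (of_real c * cis (2 * z))" for c
    by simp
  then show "theta_G r (- z) = theta_G r z" "theta_H r (- z) = theta_H r z"
    unfolding theta_G_def theta_H_def by (simp_all only: qpoch_cnj[OF eighth_power_bounds] complex_mod_cnj)
qed

lemma theta_periodic: "theta_G r (z + pi) = theta_G r z" "theta_H r (z + pi) = theta_H r z"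
proof -
  have "cis (2 * (z + pi)) = cis (2 * z)" by (simp add: distrib_left flip: cis_mult)
  then show "theta_G r (z + pi) = theta_G r z" "theta_H r (z + pi) = theta_H r z"
    unfolding theta_G_def theta_H_def by simp_all
qed

lemma jsn_minus: "jsn r (- z) = - jsn r z"
  by (simp add: jsn_def theta_even)

lemma jsn_pi_minus: "jsn r (pi - z) = jsn r z"
  using theta_periodic[of "- z"] by (simp add: jsn_def theta_even)

lemma jsn_continuous: "continuous_on A (jsn r)"
  unfolding jsn_def using theta_H_pos by (intro continuous_intros) (auto simp: less_imp_neq[symmetric])

lemma jsn_square:
  "(jsn r z)\<^sup>2 * (theta_H r z)\<^sup>2 = 4 * r\<^sup>2 * ((sin z)\<^sup>2 * (theta_G r z)\<^sup>2)"
  using theta_H_pos[of z] by (simp add: jsn_def power_divide power_mult_distrib)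

text \<open>This is \<open>theta_H_addition\<close> divided by its first term on the right;
  \<open>16 * r ^ 4\<close> is the square of the \<open>4 * r\<^sup>2\<close> in
  \<open>jsn_square\<close>.\<close>

lemma jsn_denominator:
  "1 - (jsn r z)\<^sup>2 * (jsn r a)\<^sup>2 =
     theta_H r (z + a) * theta_H r (z - a) * (theta_H r 0)\<^sup>2 / ((theta_H r z)\<^sup>2 * (theta_H r a)\<^sup>2)"
proof -
  have "16 * r ^ 4 * ((sin z)\<^sup>2 * (theta_G r z)\<^sup>2) * ((sin a)\<^sup>2 * (theta_G r a)\<^sup>2)
     = ((jsn r z)\<^sup>2 * (theta_H r z)\<^sup>2) * ((jsn r a)\<^sup>2 * (theta_H r a)\<^sup>2)"
    unfolding jsn_square by (simp add: power2_eq_square power4_eq_xxxx)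
  then have "theta_H r (z + a) * theta_H r (z - a) * (theta_H r 0)\<^sup>2 =
     (1 - (jsn r z)\<^sup>2 * (jsn r a)\<^sup>2) * ((theta_H r z)\<^sup>2 * (theta_H r a)\<^sup>2)"
    using theta_H_addition[of z a] by (simp add: algebra_simps)
  then show ?thesis
    using theta_H_pos[of z] theta_H_pos[of a] by simp
qed

lemma jsn_denominator_pos: "1 - (jsn r z)\<^sup>2 * (jsn r a)\<^sup>2 > 0"
  unfolding jsn_denominator using theta_H_pos by (intro divide_pos_pos mult_pos_pos zero_less_power)

text \<open>The quotient of the addition theorems for \<open>theta_G\<close> and
  \<open>theta_H\<close>. Because \<open>jsn\<close> is sn times the square root of the modulus, the
  modulus itself does not appear.\<close>

lemma jsn_addition:
  "jsn r (z + a) * jsn r (z - a) * (1 - (jsn r z)\<^sup>2 * (jsn r a)\<^sup>2) = (jsn r z)\<^sup>2 - (jsn r a)\<^sup>2"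
proof -
  let ?Hz = "theta_H r z" and ?Ha = "theta_H r a"
  have nz: "?Hz \<noteq> 0" "?Ha \<noteq> 0" "theta_H r (z + a) \<noteq> 0" "theta_H r (z - a) \<noteq> 0"
    using theta_H_pos less_irrefl by metis+
  have gen1: "(2 * r * s1 * g1 / h1) * (2 * r * s2 * g2 / h2) * (h1 * h2 * k / d) = 4 * r\<^sup>2 * (s1 * s2 * (g1 * g2) * k) / d"
    if "h1 \<noteq> 0" "h2 \<noteq> 0" for s1 g1 h1 s2 g2 h2 k d :: real
    using that by (simp add: power2_eq_square)
  have gen2: "4 * r\<^sup>2 * (x * h\<^sup>2 - y * k\<^sup>2) / (k\<^sup>2 * h\<^sup>2) = (4 * r\<^sup>2 * x) / k\<^sup>2 - (4 * r\<^sup>2 * y) / h\<^sup>2"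
    if "h \<noteq> 0" "k \<noteq> 0" for x y h k :: real
    using that by (simp add: field_simps)
  have "jsn r (z + a) * jsn r (z - a) * (1 - (jsn r z)\<^sup>2 * (jsn r a)\<^sup>2) =
     4 * r\<^sup>2 * (sin (z + a) * sin (z - a) * (theta_G r (z + a) * theta_G r (z - a)) * (theta_H r 0)\<^sup>2) / (?Hz\<^sup>2 * ?Ha\<^sup>2)"
    unfolding jsn_denominator unfolding jsn_def by (rule gen1) (rule nz)+
  also have "\<dots> = (4 * r\<^sup>2 * ((sin z)\<^sup>2 * (theta_G r z)\<^sup>2)) / ?Hz\<^sup>2 - (4 * r\<^sup>2 * ((sin a)\<^sup>2 * (theta_G r a)\<^sup>2)) / ?Ha\<^sup>2"
    unfolding theta_G_addition by (rule gen2) (rule nz)+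
  also have "\<dots> = (jsn r z)\<^sup>2 - (jsn r a)\<^sup>2"
    unfolding jsn_square[symmetric] using nz by simp
  finally show ?thesis .
qed

text \<open>\<open>jsn_denominator_pos\<close> with \<open>a = z\<close> bounds the fourth
  power.\<close>

lemma abs_jsn_less_1: "\<bar>jsn r z\<bar> < 1"
proof -
  have "(jsn r z)\<^sup>2 * (jsn r z)\<^sup>2 < 1"
    using jsn_denominator_pos[of z z] by simp
  then have "(jsn r z)\<^sup>2 < 1"
    by (metis mult_le_one not_le zero_le_power2 mult_mono mult_1 zero_le_one)
  then show ?thesis by (simp only: abs_square_less_1)
qed

text \<open>By symmetry about \<open>pi / 2\<close> the product in the addition theorem at
  \<open>pi / 2\<close> is a square, so the difference of squares on its right side is
  nonnegative.\<close>

lemma abs_jsn_le: "\<bar>jsn r z\<bar> \<le> jsn r (pi / 2)"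
proof -
  have pos: "jsn r (pi / 2) > 0"
    unfolding jsn_def using r theta_G_pos theta_H_pos by simp
  have "jsn r (pi / 2 + z) = jsn r (pi / 2 - z)"
    using jsn_pi_minus[of "pi / 2 - z"] by (simp add: algebra_simps)
  then have "(jsn r (pi / 2))\<^sup>2 - (jsn r z)\<^sup>2 = (jsn r (pi / 2 - z))\<^sup>2 * (1 - (jsn r (pi / 2))\<^sup>2 * (jsn r z)\<^sup>2)"
    using jsn_addition[of "pi / 2" z] by (simp add: power2_eq_square)
  also have "\<dots> \<ge> 0"
    using jsn_denominator_pos[of "pi / 2" z] by simp
  finally have "(jsn r z)\<^sup>2 \<le> (jsn r (pi / 2))\<^sup>2" by simp
  then show ?thesis using pos by (simp add: abs_le_square_iff[symmetric])
qed

lemma jsn_half_pi_pos: "jsn r (pi / 2) > 0"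
  unfolding jsn_def using r theta_G_pos theta_H_pos by simp

text \<open>At \<open>pi / 2\<close> every factor of both products is \<open>1\<close> plus a
  positive term, and the terms for \<open>theta_G\<close> are the smaller ones.\<close>

lemma jsn_half_pi_le: "jsn r (pi / 2) \<le> 2 * r"
proof -
  have "norm (qpoch (r ^ 8) (- of_real (r ^ 8))) \<le> norm (qpoch (r ^ 8) (- of_real (r ^ 4)))"
  proof (rule LIMSEQ_le[OF tendsto_norm[OF qpoch_LIMSEQ[OF eighth_power_bounds]] tendsto_norm[OF qpoch_LIMSEQ[OF eighth_power_bounds]]])
    have "norm (\<Prod>j<n. 1 - of_real (r ^ 8) ^ j * - complex_of_real (r ^ 8)) \<le>
       norm (\<Prod>j<n. 1 - of_real (r ^ 8) ^ j * - complex_of_real (r ^ 4))" for n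
      unfolding prod_norm[symmetric]
    proof (rule prod_mono, intro conjI)
      fix j
      have pos: "norm (1 - of_real (r ^ 8) ^ j * - complex_of_real x) = 1 + (r ^ 8) ^ j * x" if "x > 0" for x
      proof -
        have "1 - of_real (r ^ 8) ^ j * - complex_of_real x = of_real (1 + (r ^ 8) ^ j * x)" by simp
        moreover have "1 + (r ^ 8) ^ j * x > 0" using that r by (intro add_pos_nonneg) auto
        ultimately show ?thesis by (simp only: norm_of_real)
      qed
      have "r ^ 8 \<le> r ^ 4" using r by (intro power_decreasing) auto
      then show "norm (1 - of_real (r ^ 8) ^ j * - complex_of_real (r ^ 8)) \<le> norm (1 - of_real (r ^ 8) ^ j * - complex_of_real (r ^ 4))"
        using pos[OF eighth_power_bounds(1)] pos[OF fourth_power_bounds(1)] r by (simp add: mult_left_mono)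
    qed auto
    then show "\<exists>N. \<forall>n\<ge>N. norm (\<Prod>j<n. 1 - of_real (r ^ 8) ^ j * - complex_of_real (r ^ 8)) \<le>
       norm (\<Prod>j<n. 1 - of_real (r ^ 8) ^ j * - complex_of_real (r ^ 4))" by blast
  qed
  then have "theta_G r (pi / 2) \<le> theta_H r (pi / 2)"
    unfolding theta_G_def theta_H_def by (simp add: power_mono)
  then have "theta_G r (pi / 2) / theta_H r (pi / 2) \<le> 1"
    using theta_H_pos[of "pi / 2"] by simp
  then have "2 * r * (theta_G r (pi / 2) / theta_H r (pi / 2)) \<le> 2 * r * 1"
    using r by (intro mult_left_mono) auto
  then show ?thesis unfolding jsn_def by simp
qed

end

section \<open>Multiplication of the argument and the Blaschke product\<close>

text \<open>In \<open>cis (2 * z)\<close> the shifts by \<open>pi * j / N\<close> are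
  multiplications by the \<open>N\<close>-th roots of unity, so \<open>qpoch_power\<close> applies
  to both theta functions and the finite product to the sine. Absolute values remove the
  phases.\<close>

lemma abs_jsn_multiple:
  assumes r: "0 < r" "r < 1" and "N > 0"
  shows "\<bar>jsn (r ^ N) (real N * z)\<bar> = (\<Prod>j<N. \<bar>jsn r (z + pi * real j / real N)\<bar>)"
proof -
  have N: "(r ^ N) ^ k = (r ^ k) ^ N" for k by (simp add: mult.commute flip: power_mult)
  have c: "cis (2 * z) * cis (2 * pi * real j / real N) = cis (2 * (z + pi * real j / real N))" for j
    by (simp add: cis_mult algebra_simps)
  have cN: "cis (2 * (real N * z)) = cis (2 * z) ^ N"
    using Complex.DeMoivre[of "2 * z" N] by (simp only: mult_ac)
  have s: "\<bar>2 * sin x\<bar> = norm (1 - cis (2 * x))" for x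
    unfolding one_minus_cis by (simp add: norm_mult)
  have "\<bar>2 * sin (real N * z)\<bar> = (\<Prod>j<N. \<bar>2 * sin (z + pi * real j / real N)\<bar>)"
    unfolding s cN c[symmetric] prod_norm by (simp add: prod_one_minus_roots_of_unity[OF \<open>N > 0\<close>])
  moreover have q: "norm (qpoch ((r ^ N) ^ 8) (of_real ((r ^ N) ^ k) * cis (2 * (real N * z)))) =
      (\<Prod>j<N. norm (qpoch (r ^ 8) (of_real (r ^ k) * cis (2 * (z + pi * real j / real N)))))" for k
    using qpoch_power[OF eighth_power_bounds[OF r] \<open>N > 0\<close>, of "of_real (r ^ k) * cis (2 * z)"]
    unfolding cN c[symmetric] prod_norm N by (simp add: power_mult_distrib mult_ac)
  have "theta_G (r ^ N) (real N * z) = (\<Prod>j<N. theta_G r (z + pi * real j / real N))"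
    unfolding theta_G_def q prod_power_distrib ..
  moreover have "theta_H (r ^ N) (real N * z) = (\<Prod>j<N. theta_H r (z + pi * real j / real N))"
    unfolding theta_H_def q prod_power_distrib ..
  moreover have F: "\<bar>jsn u x\<bar> = \<bar>u\<bar> * \<bar>2 * sin x\<bar> * theta_G u x / theta_H u x" for u x
    unfolding jsn_def theta_G_def theta_H_def by (simp add: abs_mult)
  ultimately show ?thesis
    unfolding F prod_dividef prod.distrib by (simp add: power_abs)
qed

text \<open>With \<open>x = jsn r z\<close>, the addition theorem evaluates the factors for
  \<open>a j\<close> and \<open>- a j\<close> together. The points \<open>a j\<close> are symmetric,
  so the square of the Blaschke product is the square of the product in
  \<open>abs_jsn_multiple\<close>, a value of \<open>jsn (r ^ N)\<close> up to sign.\<close>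

theorem blaschke_product_small:
  fixes r :: real
  assumes r: "0 < r" "r < 1" and "N > 0"
  obtains a :: "nat \<Rightarrow> real" where "\<And>j. \<bar>a j\<bar> < 1"
    "\<And>x. \<bar>x\<bar> \<le> jsn r (pi / 2) \<Longrightarrow> (\<Prod>j<N. \<bar>x - a j\<bar>) \<le> 2 * r ^ N * (\<Prod>j<N. \<bar>1 - a j * x\<bar>)"
proof
  \<comment> \<open>Spacing \<open>pi / N\<close>, centred at \<open>0\<close>: reversing the order
    of the indices changes the sign.\<close>
  define s where "s j = (2 * real j + 1 - real N) * pi / (2 * real N)" for j
  define a where "a j = jsn r (s j)" for j
  show a1: "\<bar>a j\<bar> < 1" for j
    unfolding a_def by (rule abs_jsn_less_1[OF r])
  fix x assume x: "\<bar>x\<bar> \<le> jsn r (pi / 2)"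
  have x1: "\<bar>x\<bar> < 1" using x abs_jsn_less_1[OF r, of "pi / 2"] by linarith
  have "jsn r (- (pi / 2)) \<le> x" "x \<le> jsn r (pi / 2)"
    using x jsn_minus[OF r] by (auto simp: abs_le_iff)
  then obtain z where z: "jsn r z = x"
    using IVT'[of "jsn r" "- (pi / 2)" x "pi / 2"] jsn_continuous[OF r] by auto
  have d: "1 - a j * x > 0" for j
  proof -
    have "\<bar>a j * x\<bar> < 1" using a1[of j] x1
      by (metis abs_mult abs_ge_zero mult_strict_mono' mult_1)
    then show ?thesis by linarith
  qed
  have a_refl: "a (N - Suc j) = - a j" if "j < N" for j
  proof -
    have "s (N - Suc j) = - s j" using that unfolding s_def by (simp add: of_nat_diff field_simps)
    then show ?thesis by (simp add: a_def jsn_minus[OF r])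
  qed
  have pair: "jsn r (z + s j) * jsn r (z - s j) = (x - a j) / (1 - a j * x) * ((x + a j) / (1 + a j * x))"
    if "j < N" for j
  proof -
    have "1 + a j * x > 0" using d[of "N - Suc j"] a_refl[OF that] by simp
    moreover have "1 - x\<^sup>2 * (a j)\<^sup>2 = (1 - a j * x) * (1 + a j * x)"
      by (simp add: algebra_simps power2_eq_square)
    moreover have "x\<^sup>2 - (a j)\<^sup>2 = (x - a j) * (x + a j)"
      by (simp add: algebra_simps power2_eq_square)
    ultimately have "jsn r (z + s j) * jsn r (z - s j) = (x - a j) * (x + a j) / ((1 - a j * x) * (1 + a j * x))"
      using jsn_addition[OF r, of z "s j"] d[of j] unfolding z a_def[symmetric]
      by (simp add: nonzero_eq_divide_eq)
    then show ?thesis by simp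
  qed
  let ?y = "z - (real N - 1) * pi / (2 * real N)"
  have s1: "z + s j = ?y + pi * real j / real N" for j
    using \<open>N > 0\<close> by (simp add: s_def field_simps)
  have s2: "z - s (N - Suc j) = z + s j" if "j < N" for j
    using that unfolding s_def by (simp add: of_nat_diff field_simps)
  have P: "(\<Prod>j<N. \<bar>jsn r (z + s j)\<bar>) = \<bar>jsn (r ^ N) (real N * ?y)\<bar>"
    unfolding s1 by (rule abs_jsn_multiple[symmetric]) fact+
  have rN: "0 < r ^ N" "r ^ N < 1" using r \<open>N > 0\<close> by (auto simp: power_less_one_iff)
  have le: "(\<Prod>j<N. \<bar>jsn r (z + s j)\<bar>) \<le> 2 * r ^ N"
    unfolding P using abs_jsn_le[OF rN] jsn_half_pi_le[OF rN] order_trans by blast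
  have "(\<Prod>j<N. \<bar>jsn r (z - s j)\<bar>) = (\<Prod>j<N. \<bar>jsn r (z - s (N - Suc j))\<bar>)"
    by (rule prod.nat_diff_reindex[symmetric])
  also have "\<dots> = (\<Prod>j<N. \<bar>jsn r (z + s j)\<bar>)"
    by (intro prod.cong) (auto simp: s2)
  finally have P2: "(\<Prod>j<N. \<bar>jsn r (z - s j)\<bar>) = (\<Prod>j<N. \<bar>jsn r (z + s j)\<bar>)" .
  \<comment> \<open>The pairing determines only \<open>B\<^sup>2\<close>; the root is taken in the
    final inequality.\<close>
  define B where "B = (\<Prod>j<N. \<bar>(x - a j) / (1 - a j * x)\<bar>)"
  have "(\<Prod>j<N. \<bar>(x + a j) / (1 + a j * x)\<bar>) = (\<Prod>j<N. \<bar>(x - a (N - Suc j)) / (1 - a (N - Suc j) * x)\<bar>)"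
    by (intro prod.cong) (auto simp: a_refl)
  also have "\<dots> = B"
    unfolding B_def by (rule prod.nat_diff_reindex)
  finally have "B\<^sup>2 = (\<Prod>j<N. \<bar>(x - a j) / (1 - a j * x)\<bar> * \<bar>(x + a j) / (1 + a j * x)\<bar>)"
    unfolding prod.distrib by (simp add: B_def power2_eq_square)
  also have "\<dots> = (\<Prod>j<N. \<bar>jsn r (z + s j)\<bar> * \<bar>jsn r (z - s j)\<bar>)"
    by (intro prod.cong refl) (simp only: pair lessThan_iff flip: abs_mult)
  also have "\<dots> = (\<Prod>j<N. \<bar>jsn r (z + s j)\<bar>)\<^sup>2"
    unfolding prod.distrib P2 by (simp add: power2_eq_square)
  also have "\<dots> \<le> (2 * r ^ N)\<^sup>2"
    using le by (intro power_mono prod_nonneg) auto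
  finally have "B \<le> 2 * r ^ N"
    by (rule power2_le_imp_le) (use r in simp)
  moreover have "B = (\<Prod>j<N. \<bar>x - a j\<bar>) / (\<Prod>j<N. \<bar>1 - a j * x\<bar>)"
    unfolding B_def abs_divide by (rule prod_dividef)
  moreover have "(\<Prod>j<N. \<bar>1 - a j * x\<bar>) > 0"
    using d by (intro prod_pos) (auto simp: less_imp_neq[symmetric])
  ultimately show "(\<Prod>j<N. \<bar>x - a j\<bar>) \<le> 2 * r ^ N * (\<Prod>j<N. \<bar>1 - a j * x\<bar>)"
    by (simp only: pos_divide_le_eq)
qed

section \<open>Landen's transformation and the nome\<close>

text \<open>The even terms make up a quarter of the sum \<open>pi\<^sup>2 / 6\<close> of all inverse
  squares; grouping in pairs allows them to be subtracted.\<close>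

lemma odd_inverse_squares_sums: "(\<lambda>m. 1 / (2 * real m + 1)\<^sup>2) sums (pi\<^sup>2 / 8)"
proof -
  have sq: "(\<lambda>n. 1 / (real n + 1)\<^sup>2) sums (pi\<^sup>2 / 6)"
    using inverse_squares_sums by (simp add: add.commute)
  have "(\<lambda>n. \<Sum>i\<in>{n * 2..<n * 2 + 2}. 1 / (real i + 1)\<^sup>2) sums (pi\<^sup>2 / 6)"
    by (rule sums_group[OF sq]) simp
  moreover have "(\<lambda>n. 1 / 4 * (1 / (real n + 1)\<^sup>2)) sums (1 / 4 * (pi\<^sup>2 / 6))"
    by (rule sums_mult[OF sq])
  ultimately have "(\<lambda>n. (\<Sum>i\<in>{n * 2..<n * 2 + 2}. 1 / (real i + 1)\<^sup>2) - 1 / 4 * (1 / (real n + 1)\<^sup>2))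
      sums (pi\<^sup>2 / 6 - 1 / 4 * (pi\<^sup>2 / 6))"
    by (rule sums_diff)
  moreover have "(\<Sum>i\<in>{n * 2..<n * 2 + 2}. 1 / (real i + 1)\<^sup>2) - 1 / 4 * (1 / (real n + 1)\<^sup>2) = 1 / (2 * real n + 1)\<^sup>2" for n
  proof -
    have "{n * 2..<n * 2 + 2} = {2 * n, 2 * n + 1}" by auto
    moreover have "(real (2 * n + 1) + 1)\<^sup>2 = 4 * (real n + 1)\<^sup>2"
      by (simp add: power2_eq_square algebra_simps)
    ultimately show ?thesis by simp
  qed
  ultimately show ?thesis by simp
qed

text \<open>A truncation of the series of \<open>- 2 * artanh u\<close>. The derivative of the
  difference is twice a partial geometric sum minus twice the full sum
  \<open>1 / (1 - x\<^sup>2)\<close>, hence not positive.\<close>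

lemma ln_one_minus_div_one_plus_le:
  fixes u :: real
  assumes "0 < u" "u < 1"
  shows "ln ((1 - u) / (1 + u)) \<le> - 2 * (\<Sum>m<M. u ^ (2 * m + 1) / (2 * real m + 1))"
proof -
  define f where "f x = ln (1 - x) - ln (1 + x) + 2 * (\<Sum>m<M. x ^ (2 * m + 1) / (2 * real m + 1))" for x :: real
  have "f u \<le> f 0"
  proof (rule DERIV_nonpos_imp_nonincreasing[of 0 u f])
    fix x assume x: "0 \<le> x" "x \<le> u"
    have "((\<lambda>x. x ^ (2 * m + 1) / (2 * real m + 1)) has_real_derivative (x\<^sup>2) ^ m) (at x)" for m
    proof -
      have "((\<lambda>x. x ^ (2 * m + 1) / (2 * real m + 1)) has_real_derivative
          (real (2 * m + 1) * x ^ (2 * m)) / (2 * real m + 1)) (at x)"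
        using DERIV_cdivide[OF DERIV_pow[of "2 * m + 1" x], of "2 * real m + 1"] by simp
      moreover have "(real (2 * m + 1) * x ^ (2 * m)) / (2 * real m + 1) = (x\<^sup>2) ^ m"
      proof -
        have "real (2 * m + 1) = 2 * real m + 1" "2 * real m + 1 \<noteq> 0" by auto
        then show ?thesis by (simp only: power_mult nonzero_mult_div_cancel_left not_False_eq_True)
      qed
      ultimately show ?thesis by (simp only:)
    qed
    then have "((\<lambda>x. \<Sum>m<M. x ^ (2 * m + 1) / (2 * real m + 1)) has_real_derivative (\<Sum>m<M. (x\<^sup>2) ^ m)) (at x)"
      by (intro DERIV_sum)
    moreover have "((\<lambda>x. ln (1 - x) - ln (1 + x)) has_real_derivative (- 1 / (1 - x) - 1 / (1 + x))) (at x)"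
      using x assms by (auto intro!: derivative_eq_intros)
    ultimately have "(f has_real_derivative (- 1 / (1 - x) - 1 / (1 + x) + 2 * (\<Sum>m<M. (x\<^sup>2) ^ m))) (at x)"
      unfolding f_def by (intro DERIV_add DERIV_cmult)
    moreover have "- 1 / (1 - x) - 1 / (1 + x) + 2 * (\<Sum>m<M. (x\<^sup>2) ^ m) \<le> 0"
    proof -
      have x2: "x\<^sup>2 < 1" using x assms by (simp add: power_less_one_iff)
      have "- 1 / (1 - x) - 1 / (1 + x) = - 2 * (1 / (1 - x\<^sup>2))"
        using x assms by (simp add: field_simps power2_eq_square)
      moreover have "(\<Sum>m<M. (x\<^sup>2) ^ m) = (1 - (x\<^sup>2) ^ M) / (1 - x\<^sup>2)"
        using x2 by (subst sum_gp_strict) auto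
      moreover have "(1 - (x\<^sup>2) ^ M) / (1 - x\<^sup>2) \<le> 1 / (1 - x\<^sup>2)"
        using x2 by (intro divide_right_mono) auto
      ultimately show ?thesis by linarith
    qed
    ultimately show "\<exists>y. (f has_real_derivative y) (at x) \<and> y \<le> 0" by blast
  qed (use assms in auto)
  then show ?thesis
    using assms by (simp add: f_def ln_div)
qed

text \<open>By Landen's transformation this is the complementary modulus for the nome \<open>\<surd>q\<close>.\<close>

definition compl_ratio :: "real \<Rightarrow> real" where
  "compl_ratio r = (1 - (jsn r (pi / 2))\<^sup>2) / (1 + (jsn r (pi / 2))\<^sup>2)"

lemma compl_ratio_pos:
  assumes r: "0 < r" "r < 1"
  shows "compl_ratio r > 0"
proof -
  have "(jsn r (pi / 2))\<^sup>2 < 1"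
    using abs_jsn_less_1[OF r, of "pi / 2"] by (simp only: abs_square_less_1)
  then show ?thesis unfolding compl_ratio_def by (intro divide_pos_pos) (auto intro: add_pos_nonneg)
qed

context
  fixes r :: real
  assumes r: "0 < r" "r < 1"
begin

text \<open>Put \<open>z = pi / 2\<close> and \<open>a = pi / 4\<close> in the addition theorem,
  where symmetry gives \<open>jsn r (3 * pi / 4) = jsn r (pi / 4)\<close>. The case
  \<open>N = 2\<close> of \<open>abs_jsn_multiple\<close> identifies the square of this value with
  \<open>jsn (r\<^sup>2) (pi / 2)\<close>.\<close>

lemma landen: "(jsn r (pi / 2))\<^sup>2 * (1 + (jsn (r\<^sup>2) (pi / 2))\<^sup>2) = 2 * jsn (r\<^sup>2) (pi / 2)"
proof -
  have r2: "0 < r\<^sup>2" "r\<^sup>2 < 1" using r by (auto simp: power_less_one_iff)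
  have q: "jsn r (3 * pi / 4) = jsn r (pi / 4)"
    using jsn_pi_minus[OF r, of "pi / 4"] by simp
  have "\<bar>jsn (r\<^sup>2) (pi / 2)\<bar> = (\<Prod>j<2. \<bar>jsn r (pi / 4 + pi * real j / real 2)\<bar>)"
    using abs_jsn_multiple[OF r, of 2 "pi / 4"] by simp
  also have "\<dots> = (jsn r (pi / 4))\<^sup>2"
    using q by (simp add: numeral_2_eq_2 power2_eq_square flip: abs_mult)
  finally have mu: "jsn (r\<^sup>2) (pi / 2) = (jsn r (pi / 4))\<^sup>2"
    using jsn_half_pi_pos[OF r2] by simp
  have "jsn r (pi / 4) * jsn r (pi / 4) * (1 - (jsn r (pi / 2))\<^sup>2 * (jsn r (pi / 4))\<^sup>2) = (jsn r (pi / 2))\<^sup>2 - (jsn r (pi / 4))\<^sup>2"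
    using jsn_addition[OF r, of "pi / 2" "pi / 4"] q by simp
  then show ?thesis
    unfolding mu by (simp add: algebra_simps power2_eq_square)
qed

text \<open>With \<open>c = jsn (r\<^sup>2) (pi / 2)\<close>, Landen makes the left side the square
  of \<open>(1 - c) / (1 + c)\<close>, which
  \<open>(1 + c)\<^sup>2 \<le> 2 * (1 + c\<^sup>2)\<close> compares with
  \<open>(1 - c\<^sup>2) / (1 + c\<^sup>2)\<close>. After division by \<open>4\<close>, the ratio at
  \<open>r\<close> is at least the square of the ratio at \<open>r\<^sup>2\<close>.\<close>

lemma compl_ratio_landen: "compl_ratio r \<ge> (compl_ratio (r\<^sup>2))\<^sup>2 / 4"
proof -
  have r2: "0 < r\<^sup>2" "r\<^sup>2 < 1" using r by (auto simp: power_less_one_iff)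
  define c where "c = jsn (r\<^sup>2) (pi / 2)"
  have c: "0 < c" "c < 1"
    using jsn_half_pi_pos[OF r2] abs_jsn_less_1[OF r2, of "pi / 2"] by (auto simp: c_def)
  have c2: "c\<^sup>2 < 1" using c by (simp add: power_less_one_iff)
  have pos: "1 + c\<^sup>2 > 0" by (intro add_pos_nonneg) auto
  have "(jsn r (pi / 2))\<^sup>2 = 2 * c / (1 + c\<^sup>2)"
    using landen pos unfolding c_def[symmetric] by (simp add: field_simps)
  then have "1 - (jsn r (pi / 2))\<^sup>2 = (1 + c\<^sup>2 - 2 * c) / (1 + c\<^sup>2)"
      "1 + (jsn r (pi / 2))\<^sup>2 = (1 + c\<^sup>2 + 2 * c) / (1 + c\<^sup>2)"
    using pos by (simp_all add: field_simps)
  then have "compl_ratio r = ((1 + c\<^sup>2 - 2 * c) / (1 + c\<^sup>2)) / ((1 + c\<^sup>2 + 2 * c) / (1 + c\<^sup>2))"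
    unfolding compl_ratio_def by (simp only:)
  also have "\<dots> = (1 + c\<^sup>2 - 2 * c) / (1 + c\<^sup>2 + 2 * c)"
    using pos by simp
  also have "1 + c\<^sup>2 - 2 * c = (1 - c)\<^sup>2"
    by (simp add: power2_eq_square algebra_simps)
  also have "1 + c\<^sup>2 + 2 * c = (1 + c)\<^sup>2"
    by (simp add: power2_eq_square algebra_simps)
  also have "(1 - c)\<^sup>2 / (1 + c)\<^sup>2 = ((1 - c) / (1 + c))\<^sup>2"
    by (simp add: power_divide)
  finally have 1: "compl_ratio r = ((1 - c) / (1 + c))\<^sup>2" .
  have "(1 + c)\<^sup>2 \<le> 2 * (1 + c\<^sup>2)"
    using zero_le_power2[of "1 - c"] by (simp add: power2_eq_square algebra_simps)
  then have "(1 - c\<^sup>2) / (2 * (1 + c\<^sup>2)) \<le> (1 - c\<^sup>2) / (1 + c)\<^sup>2"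
    using c c2 pos by (intro divide_left_mono mult_pos_pos zero_less_power) auto
  also have "(1 - c\<^sup>2) / (1 + c)\<^sup>2 = (1 - c) / (1 + c)"
  proof -
    have "1 - c\<^sup>2 = (1 - c) * (1 + c)" by (simp add: power2_eq_square algebra_simps)
    then show ?thesis using c by (simp add: power2_eq_square)
  qed
  finally have "((1 - c\<^sup>2) / (2 * (1 + c\<^sup>2)))\<^sup>2 \<le> ((1 - c) / (1 + c))\<^sup>2"
    using c2 by (intro power_mono) auto
  moreover have "(compl_ratio (r\<^sup>2))\<^sup>2 / 4 = ((1 - c\<^sup>2) / (2 * (1 + c\<^sup>2)))\<^sup>2"
    unfolding compl_ratio_def c_def[symmetric] by (simp only: power_divide power_mult_distrib) (simp add: mult.commute)
  ultimately show ?thesis unfolding 1 by (simp only:)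
qed

text \<open>The classical formula for the complementary modulus as a squared quotient of theta
  constants. For \<open>k = (jsn r (pi / 2))\<^sup>2\<close>, both Landen and
  \<open>jsn_denominator\<close> at \<open>z = a = pi / 2\<close> evaluate
  \<open>1 - k\<^sup>2\<close>.\<close>

lemma compl_ratio_square_eq: "compl_ratio (r\<^sup>2) = (theta_H r 0 / theta_H r (pi / 2))\<^sup>2"
proof -
  have r2: "0 < r\<^sup>2" "r\<^sup>2 < 1" using r by (auto simp: power_less_one_iff)
  define c where "c = jsn (r\<^sup>2) (pi / 2)"
  have pos: "1 + c\<^sup>2 > 0" by (intro add_pos_nonneg) auto
  have "(jsn r (pi / 2))\<^sup>2 = 2 * c / (1 + c\<^sup>2)"
    using landen pos unfolding c_def[symmetric] by (simp add: field_simps)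
  then have "1 - (jsn r (pi / 2))\<^sup>2 * (jsn r (pi / 2))\<^sup>2 = ((1 + c\<^sup>2)\<^sup>2 - (2 * c)\<^sup>2) / (1 + c\<^sup>2)\<^sup>2"
    using pos by (simp add: diff_divide_distrib power2_eq_square)
  also have "(1 + c\<^sup>2)\<^sup>2 - (2 * c)\<^sup>2 = (1 - c\<^sup>2)\<^sup>2"
    by (simp add: power2_eq_square algebra_simps)
  also have "(1 - c\<^sup>2)\<^sup>2 / (1 + c\<^sup>2)\<^sup>2 = (compl_ratio (r\<^sup>2))\<^sup>2"
    by (simp add: compl_ratio_def c_def power_divide)
  finally have "(compl_ratio (r\<^sup>2))\<^sup>2 = ((theta_H r 0 / theta_H r (pi / 2))\<^sup>2)\<^sup>2"
    using jsn_denominator[OF r, of "pi / 2" "pi / 2"] theta_periodic(2)[OF r, of 0]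
    by (simp add: power2_eq_square)
  then show ?thesis
    by (rule power2_eq_imp_eq) (use compl_ratio_pos[OF r2] in auto)
qed

text \<open>The right sides converge to the left side and decrease, since every factor is at most
  \<open>1\<close>. The exponent \<open>4\<close> combines the square in \<open>theta_H\<close> with
  that in \<open>compl_ratio_square_eq\<close>.\<close>

lemma compl_ratio_square_le:
  "compl_ratio (r\<^sup>2) \<le> (\<Prod>j<n. ((1 - (r ^ 4) ^ (2 * j + 1)) / (1 + (r ^ 4) ^ (2 * j + 1))) ^ 4)"
proof -
  define t where "t j = (r ^ 4) ^ (2 * j + 1)" for j
  have t: "0 < t j" "t j < 1" for j
    unfolding t_def using fourth_power_bounds[OF r] by (simp, subst power_less_one_iff) auto
  define P where "P n = (\<Prod>j<n. ((1 - t j) / (1 + t j)) ^ 4)" for n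
  have coef: "of_real (r ^ 8) ^ j * complex_of_real (r ^ 4) = of_real (t j)" for j
    unfolding t_def by (simp add: add.commute flip: power_mult power_add)
  have n1: "norm (1 - of_real (r ^ 8) ^ j * complex_of_real (r ^ 4)) = 1 - t j" for j
  proof -
    have "1 - complex_of_real (t j) = of_real (1 - t j)" by simp
    then show ?thesis unfolding coef using t[of j] by (simp only: norm_of_real)
  qed
  have n2: "norm (1 - of_real (r ^ 8) ^ j * - complex_of_real (r ^ 4)) = 1 + t j" for j
  proof -
    have "1 - - complex_of_real (t j) = of_real (1 + t j)" by simp
    then show ?thesis unfolding mult_minus_right coef using t[of j] by (simp only: norm_of_real)
  qed
  have "(\<lambda>n. ((norm (\<Prod>j<n. 1 - of_real (r ^ 8) ^ j * complex_of_real (r ^ 4)))\<^sup>2 /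
     (norm (\<Prod>j<n. 1 - of_real (r ^ 8) ^ j * - complex_of_real (r ^ 4)))\<^sup>2)\<^sup>2)
    \<longlonglongrightarrow> (theta_H r 0 / theta_H r (pi / 2))\<^sup>2"
  proof (intro tendsto_power tendsto_divide)
    show "(\<lambda>n. (norm (\<Prod>j<n. 1 - of_real (r ^ 8) ^ j * complex_of_real (r ^ 4)))\<^sup>2) \<longlonglongrightarrow> theta_H r 0"
      unfolding theta_H_def using qpoch_LIMSEQ[OF eighth_power_bounds[OF r], of "of_real (r ^ 4)"]
      by (intro tendsto_power tendsto_norm) simp
    show "(\<lambda>n. (norm (\<Prod>j<n. 1 - of_real (r ^ 8) ^ j * - complex_of_real (r ^ 4)))\<^sup>2) \<longlonglongrightarrow> theta_H r (pi / 2)"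
      unfolding theta_H_def using qpoch_LIMSEQ[OF eighth_power_bounds[OF r], of "- of_real (r ^ 4)"]
      by (intro tendsto_power tendsto_norm) simp
    show "theta_H r (pi / 2) \<noteq> 0" using theta_H_pos[OF r, of "pi / 2"] by simp
  qed
  also have "(\<lambda>n. ((norm (\<Prod>j<n. 1 - of_real (r ^ 8) ^ j * complex_of_real (r ^ 4)))\<^sup>2 /
     (norm (\<Prod>j<n. 1 - of_real (r ^ 8) ^ j * - complex_of_real (r ^ 4)))\<^sup>2)\<^sup>2) = P"
    unfolding P_def prod_norm[symmetric] n1 n2
    by (simp add: prod_dividef prod_power_distrib power_divide flip: power_mult)
  finally have lim: "P \<longlonglongrightarrow> compl_ratio (r\<^sup>2)"
    unfolding compl_ratio_square_eq .
  have "decseq P"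
  proof (rule decseq_SucI)
    fix n
    have q: "0 \<le> (1 - t j) / (1 + t j)" "(1 - t j) / (1 + t j) \<le> 1" for j
      using t[of j] by simp_all
    have "((1 - t n) / (1 + t n)) ^ 4 \<le> 1" "P n \<ge> 0"
      unfolding P_def using q by (intro power_le_one prod_nonneg zero_le_power; blast)+
    then show "P (Suc n) \<le> P n"
      unfolding P_def by (simp add: mult_left_le)
  qed
  then have "compl_ratio (r\<^sup>2) \<le> P n"
    using lim by (rule decseq_ge)
  then show ?thesis unfolding P_def t_def .
qed

end

section \<open>Estimate of the modulus in terms of the nome\<close>

text \<open>The logarithm of each factor is bounded by \<open>M\<close> terms of its series. For
  fixed \<open>m\<close> the contributions of all factors form a geometric series, which is summed
  by letting \<open>n\<close> tend to infinity while \<open>M\<close> stays fixed.\<close>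

lemma ln_compl_ratio_le:
  fixes g :: real
  assumes g: "g > 0"
  shows "ln (compl_ratio (exp (- g / 2))) \<le>
    - 8 * (\<Sum>m<M. exp (- ((2 * real m + 1) * g)) / (1 - (exp (- ((2 * real m + 1) * g)))\<^sup>2) / (2 * real m + 1))"
proof -
  define r where "r = exp (- g / 4)"
  have r: "0 < r" "r < 1" using g by (auto simp: r_def)
  have r2: "r\<^sup>2 = exp (- g / 2)" and r4: "r ^ 4 = exp (- g)"
    by (simp_all add: r_def flip: exp_of_nat_mult)
  have r2': "0 < r\<^sup>2" "r\<^sup>2 < 1" using r by (auto simp: power_less_one_iff)
  define t where "t j = exp (- g) ^ (2 * j + 1)" for j
  have t: "0 < t j" "t j < 1" for j
    unfolding t_def using g by (simp, subst power_less_one_iff) auto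
  define x where "x m = exp (- ((2 * real m + 1) * g))" for m
  have x: "0 < x m" "x m < 1" for m using g by (auto simp: x_def)
  have tx: "t j ^ (2 * m + 1) = x m * ((x m)\<^sup>2) ^ j" for j m
    unfolding t_def x_def by (simp add: algebra_simps flip: exp_of_nat_mult exp_add)
  have bound: "ln (compl_ratio (r\<^sup>2)) \<le> - 8 * (\<Sum>m<M. (\<Sum>j<n. x m * ((x m)\<^sup>2) ^ j) / (2 * real m + 1))" for n
  proof -
    have "ln (compl_ratio (r\<^sup>2)) \<le> ln (\<Prod>j<n. ((1 - t j) / (1 + t j)) ^ 4)"
      using compl_ratio_square_le[OF r, of n] compl_ratio_pos[OF r2'] unfolding r4 t_def by simp
    also have "\<dots> = (\<Sum>j<n. ln (((1 - t j) / (1 + t j)) ^ 4))"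
    proof (rule ln_prod)
      fix j assume "j \<in> {..<n}"
      have "1 - t j > 0" "1 + t j > 0" using t[of j] by auto
      then show "((1 - t j) / (1 + t j)) ^ 4 \<noteq> 0" by simp
    qed auto
    also have "\<dots> = (\<Sum>j<n. 4 * ln ((1 - t j) / (1 + t j)))"
    proof (intro sum.cong refl)
      fix j
      have "1 - t j > 0" "1 + t j > 0" using t[of j] by auto
      then have "(1 - t j) / (1 + t j) > 0" by simp
      then show "ln (((1 - t j) / (1 + t j)) ^ 4) = 4 * ln ((1 - t j) / (1 + t j))"
        by (subst ln_realpow) auto
    qed
    also have "\<dots> \<le> (\<Sum>j<n. 4 * (- 2 * (\<Sum>m<M. t j ^ (2 * m + 1) / (2 * real m + 1))))"
      using t by (intro sum_mono mult_left_mono ln_one_minus_div_one_plus_le) auto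
    also have "\<dots> = - 8 * (\<Sum>m<M. (\<Sum>j<n. x m * ((x m)\<^sup>2) ^ j) / (2 * real m + 1))"
      unfolding tx sum_divide_distrib by (subst sum.swap) (simp add: sum_distrib_left sum_negf)
    finally show ?thesis .
  qed
  have "(\<lambda>n. - 8 * (\<Sum>m<M. (\<Sum>j<n. x m * ((x m)\<^sup>2) ^ j) / (2 * real m + 1)))
     \<longlonglongrightarrow> - 8 * (\<Sum>m<M. (x m * (1 / (1 - (x m)\<^sup>2))) / (2 * real m + 1))"
  proof (intro tendsto_intros)
    fix m
    have "(x m)\<^sup>2 < 1" using x[of m] by (simp add: power_less_one_iff)
    then have "(\<lambda>j. x m * ((x m)\<^sup>2) ^ j) sums (x m * (1 / (1 - (x m)\<^sup>2)))"
      by (intro sums_mult geometric_sums) auto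
    then show "(\<lambda>n. \<Sum>j<n. x m * ((x m)\<^sup>2) ^ j) \<longlonglongrightarrow> x m * (1 / (1 - (x m)\<^sup>2))"
      by (simp add: sums_def)
  qed auto
  then have "ln (compl_ratio (r\<^sup>2)) \<le> - 8 * (\<Sum>m<M. (x m * (1 / (1 - (x m)\<^sup>2))) / (2 * real m + 1))"
    using bound LIMSEQ_le_const by blast
  then show ?thesis by (simp add: r2 x_def)
qed

theorem compl_ratio_le:
  fixes h :: real
  assumes h: "h > 0"
  shows "compl_ratio (exp (- h / 2)) \<le> 4 * exp (- pi\<^sup>2 / (2 * h))"
proof -
  \<comment> \<open>The factor \<open>g\<close> and the subtraction of \<open>ln 4\<close> turn
    \<open>compl_ratio_landen\<close> into \<open>phi (2 * g) \<le> phi g\<close>.\<close>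
  define phi where "phi g = g * (ln (compl_ratio (exp (- g / 2))) - ln 4)" for g :: real
  have pos: "compl_ratio (exp (- g / 2)) > 0" if "g > 0" for g
    using that by (intro compl_ratio_pos) auto
  have halve: "phi (2 * g) \<le> phi g" if g: "g > 0" for g
  proof -
    have "(exp (- g / 2))\<^sup>2 = exp (- (2 * g) / 2)"
      by (simp flip: exp_of_nat_mult)
    then have "(compl_ratio (exp (- (2 * g) / 2)))\<^sup>2 / 4 \<le> compl_ratio (exp (- g / 2))"
      using compl_ratio_landen[of "exp (- g / 2)"] g by simp
    then have "ln ((compl_ratio (exp (- (2 * g) / 2)))\<^sup>2 / 4) \<le> ln (compl_ratio (exp (- g / 2)))"
      using pos[OF g] pos[of "2 * g"] g by (subst ln_le_cancel_iff) auto
    moreover have "ln ((compl_ratio (exp (- (2 * g) / 2)))\<^sup>2 / 4) = 2 * ln (compl_ratio (exp (- (2 * g) / 2))) - ln 4"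
      using pos[of "2 * g"] g by (simp add: ln_div ln_realpow)
    ultimately have "g * (2 * ln (compl_ratio (exp (- (2 * g) / 2))) - 2 * ln 4) \<le> g * (ln (compl_ratio (exp (- g / 2))) - ln 4)"
      using g by (intro mult_left_mono) auto
    then show ?thesis unfolding phi_def by (simp add: algebra_simps)
  qed
  have iter: "phi h \<le> phi (h / 2 ^ n)" for n
  proof (induction n)
    case (Suc n)
    then show ?case using halve[of "h / 2 ^ Suc n"] h by simp
  qed simp
  have partial: "phi h \<le> - 4 * (\<Sum>m<M. 1 / (2 * real m + 1)\<^sup>2)" for M
  proof -
    \<comment> \<open>\<open>g\<close> times the exponential quotient in
      \<open>ln_compl_ratio_le\<close>; as \<open>g\<close> tends to \<open>0\<close>, its
      denominator behaves like \<open>2 * k * g\<close>.\<close>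
    define u where "u k g = g * exp (- (k * g)) / (1 - (exp (- (k * g)))\<^sup>2)" for k g :: real
    have u: "(u k \<longlongrightarrow> 1 / (2 * k)) (at_right 0)" if "k > 0" for k
      unfolding u_def using that by real_asymp (simp add: field_simps)
    have "((\<lambda>g. - 8 * (\<Sum>m<M. u (2 * real m + 1) g / (2 * real m + 1)) - g * ln 4) \<longlongrightarrow>
        - 8 * (\<Sum>m<M. 1 / (2 * (2 * real m + 1)) / (2 * real m + 1)) - 0 * ln 4) (at_right 0)"
      by (intro tendsto_intros u) auto
    moreover have "filterlim (\<lambda>n. h / 2 ^ n) (at_right 0) sequentially"
      using h by real_asymp
    ultimately have "(\<lambda>n. - 8 * (\<Sum>m<M. u (2 * real m + 1) (h / 2 ^ n) / (2 * real m + 1)) - (h / 2 ^ n) * ln 4) \<longlonglongrightarrow>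
        - 8 * (\<Sum>m<M. 1 / (2 * (2 * real m + 1)) / (2 * real m + 1)) - 0 * ln 4"
      by (rule filterlim_compose)
    moreover have "phi h \<le> - 8 * (\<Sum>m<M. u (2 * real m + 1) (h / 2 ^ n) / (2 * real m + 1)) - (h / 2 ^ n) * ln 4" for n
    proof -
      define g where "g = h / 2 ^ n"
      have g: "g > 0" using h by (simp add: g_def)
      have "phi h \<le> g * ln (compl_ratio (exp (- g / 2))) - g * ln 4"
        using iter[of n] by (simp add: phi_def g_def right_diff_distrib)
      also have "g * ln (compl_ratio (exp (- g / 2))) \<le> g * (- 8 * (\<Sum>m<M. exp (- ((2 * real m + 1) * g)) / (1 - (exp (- ((2 * real m + 1) * g)))\<^sup>2) / (2 * real m + 1)))"
        using g by (intro mult_left_mono ln_compl_ratio_le) auto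
      also have "\<dots> = - 8 * (\<Sum>m<M. u (2 * real m + 1) g / (2 * real m + 1))"
        unfolding u_def by (simp add: sum_distrib_left mult_ac sum_negf)
      finally show ?thesis by (simp add: g_def)
    qed
    ultimately have "phi h \<le> - 8 * (\<Sum>m<M. 1 / (2 * (2 * real m + 1)) / (2 * real m + 1)) - 0 * ln 4"
      using LIMSEQ_le_const by blast
    also have "\<dots> = - 4 * (\<Sum>m<M. 1 / (2 * real m + 1)\<^sup>2)"
    proof -
      have "(\<Sum>m<M. 1 / (2 * (2 * real m + 1)) / (2 * real m + 1)) = (\<Sum>m<M. 1 / 2 * (1 / (2 * real m + 1)\<^sup>2))"
      proof (intro sum.cong refl)
        fix m
        have "1 / (2 * k) / k = 1 / 2 * (1 / k\<^sup>2)" for k :: real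
          by (simp add: power2_eq_square)
        then show "1 / (2 * (2 * real m + 1)) / (2 * real m + 1) = 1 / 2 * (1 / (2 * real m + 1)\<^sup>2)" .
      qed
      then show ?thesis by (simp only: sum_distrib_left[symmetric])
    qed
    finally show ?thesis .
  qed
  \<comment> \<open>The bound holds for every \<open>M\<close>, so the full sum over the odd numbers
    may be inserted; it yields \<open>- pi\<^sup>2 / 2\<close>.\<close>
  have "(\<lambda>M. - 4 * (\<Sum>m<M. 1 / (2 * real m + 1)\<^sup>2)) \<longlonglongrightarrow> - 4 * (pi\<^sup>2 / 8)"
    using odd_inverse_squares_sums unfolding sums_def by (intro tendsto_intros)
  then have "phi h \<le> - 4 * (pi\<^sup>2 / 8)"
    using partial LIMSEQ_le_const by blast
  then have "ln (compl_ratio (exp (- h / 2))) - ln 4 \<le> - pi\<^sup>2 / (2 * h)"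
    using h by (simp add: phi_def field_simps)
  then have "ln (compl_ratio (exp (- h / 2)) / 4) \<le> - pi\<^sup>2 / (2 * h)"
    using pos[OF h] by (simp add: ln_div)
  then have "exp (ln (compl_ratio (exp (- h / 2)) / 4)) \<le> exp (- pi\<^sup>2 / (2 * h))"
    by (simp only: exp_le_cancel_iff)
  moreover have "exp (ln (compl_ratio (exp (- h / 2)) / 4)) = compl_ratio (exp (- h / 2)) / 4"
    using pos[OF h] by (intro exp_ln) simp
  ultimately show ?thesis by linarith
qed

section \<open>Singular values and the displacement structure\<close>

text \<open>Vectors are functions of which only the first \<open>n\<close> values count, so linear
  combinations need no carrier conditions.\<close>

definition hinner :: "nat \<Rightarrow> (nat \<Rightarrow> complex) \<Rightarrow> (nat \<Rightarrow> complex) \<Rightarrow> complex" where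
  "hinner n x y = (\<Sum>a<n. x a * cnj (y a))"

lemma hinner_sum_left: "hinner n (\<lambda>a. \<Sum>i\<in>I. c i * r i a) y = (\<Sum>i\<in>I. c i * hinner n (r i) y)"
  unfolding hinner_def sum_distrib_right sum_distrib_left
  by (subst sum.swap) (simp add: mult_ac)

lemma hinner_sum_right: "hinner n x (\<lambda>a. \<Sum>i\<in>I. c i * r i a) = (\<Sum>i\<in>I. cnj (c i) * hinner n x (r i))"
  unfolding hinner_def cnj_sum sum_distrib_left
  by (subst sum.swap) (simp add: mult_ac)

lemma hinner_cong: "(\<And>a. a < n \<Longrightarrow> x a = x' a) \<Longrightarrow> (\<And>a. a < n \<Longrightarrow> y a = y' a) \<Longrightarrow> hinner n x y = hinner n x' y'"
  unfolding hinner_def by (intro sum.cong) auto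

lemma hinner_self: "hinner n x x = of_real (\<Sum>a<n. (cmod (x a))\<^sup>2)"
  unfolding hinner_def by (simp add: complex_norm_square[symmetric])

lemma hinner_self_eq_0_iff: "hinner n x x = 0 \<longleftrightarrow> (\<forall>a<n. x a = 0)"
  unfolding hinner_self of_real_eq_0_iff by (subst sum_nonneg_eq_0_iff) auto

section \<open>Eigenvectors of a hermitian matrix\<close>

text \<open>\<open>e\<close> lists the eigenvalues to be realised; \<open>triangular_family\<close>
  ties it to the matrix.\<close>

locale hermitian_matrix =
  fixes n :: nat and m :: "nat \<Rightarrow> nat \<Rightarrow> complex" and e :: "nat \<Rightarrow> complex"
  assumes herm: "\<And>a b. a < n \<Longrightarrow> b < n \<Longrightarrow> m a b = cnj (m b a)"
begin

definition app :: "(nat \<Rightarrow> complex) \<Rightarrow> nat \<Rightarrow> complex" where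
  "app x a = (\<Sum>b<n. m a b * x b)"

lemma app_sum: "app (\<lambda>a. \<Sum>i\<in>I. c i * r i a) a = (\<Sum>i\<in>I. c i * app (r i) a)"
  unfolding app_def sum_distrib_left by (subst sum.swap) (simp add: mult_ac)

lemma app_add: "app (\<lambda>a. x a + y a) a = app x a + app y a"
  unfolding app_def by (simp add: distrib_left sum.distrib)

lemma hinner_app: "hinner n (app x) y = hinner n x (app y)"
proof -
  have "hinner n (app x) y = (\<Sum>a<n. \<Sum>b<n. m a b * x b * cnj (y a))"
    unfolding hinner_def app_def sum_distrib_right ..
  also have "\<dots> = (\<Sum>b<n. \<Sum>a<n. m a b * x b * cnj (y a))"
    by (rule sum.swap)
  also have "\<dots> = (\<Sum>b<n. \<Sum>a<n. x b * cnj (m b a * y a))"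
    using herm by (intro sum.cong refl) (metis complex_cnj_mult lessThan_iff mult.assoc mult.commute)
  also have "\<dots> = hinner n x (app y)"
    unfolding hinner_def app_def cnj_sum sum_distrib_left ..
  finally show ?thesis .
qed

definition is_eigen :: "complex \<Rightarrow> (nat \<Rightarrow> complex) \<Rightarrow> bool" where
  "is_eigen l x \<longleftrightarrow> (\<forall>a<n. app x a = l * x a)"

lemma hinner_eigen_left: "is_eigen l x \<Longrightarrow> hinner n (app x) y = l * hinner n x y"
  unfolding is_eigen_def hinner_def by (simp add: sum_distrib_left mult.assoc)

lemma hinner_eigen_right: "is_eigen l y \<Longrightarrow> hinner n x (app y) = cnj l * hinner n x y"
  unfolding is_eigen_def hinner_def by (simp add: sum_distrib_left mult_ac)

lemma eigen_real:
  assumes "is_eigen l x" "hinner n x x \<noteq> 0"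
  shows "cnj l = l"
  using hinner_eigen_left[OF assms(1), of x] hinner_eigen_right[OF assms(1), of x] hinner_app[of x x] assms(2) by simp

lemma eigen_orthogonal:
  assumes "is_eigen k x" "is_eigen l y" "hinner n y y \<noteq> 0" "k \<noteq> l"
  shows "hinner n x y = 0"
  using hinner_eigen_left[OF assms(1), of y] hinner_eigen_right[OF assms(2), of x] hinner_app[of x y]
    eigen_real[OF assms(2,3)] assms(4) by simp

text \<open>\<open>k = 0\<close> is what a Schur decomposition yields and \<open>k = n\<close> is a
  diagonalisation, so \<open>k\<close> serves as the induction variable between the two. The vectors
  are neither normalised nor orthogonal within an eigenspace.\<close>

definition triangular_family :: "nat \<Rightarrow> (nat \<Rightarrow> nat \<Rightarrow> complex) \<Rightarrow> bool" where
  "triangular_family k r \<longleftrightarrow>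
     (\<forall>c. (\<forall>a<n. (\<Sum>j<n. c j * r j a) = 0) \<longrightarrow> (\<forall>j<n. c j = 0)) \<and>
     (\<forall>j<n. \<exists>\<beta>. \<forall>a<n. app (r j) a = e j * r j a + (\<Sum>i<j. \<beta> i * r i a)) \<and>
     (\<forall>j<k. is_eigen (e j) (r j))"

text \<open>
  If the \<open>k\<close>-th vector cannot be corrected to an eigenvector, the obstruction \<open>x\<close> starts a Jordan chain
  of length two, which a hermitian matrix does not have.
\<close>

lemma triangular_family_Suc:
  assumes r: "triangular_family k r" and k: "k < n"
  shows "\<exists>r'. triangular_family (Suc k) r'"
proof -
  have inj: "\<And>c. (\<forall>a<n. (\<Sum>j<n. c j * r j a) = 0) \<Longrightarrow> (\<forall>j<n. c j = 0)"
    and tri: "\<And>j. j < n \<Longrightarrow> \<exists>\<beta>. \<forall>a<n. app (r j) a = e j * r j a + (\<Sum>i<j. \<beta> i * r i a)"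
    and eig: "\<And>j. j < k \<Longrightarrow> is_eigen (e j) (r j)"
    using r unfolding triangular_family_def by blast+
  obtain \<beta> where \<beta>: "\<And>a. a < n \<Longrightarrow> app (r k) a = e k * r k a + (\<Sum>i<k. \<beta> i * r i a)"
    using tri[OF k] by blast
  \<comment> \<open>Adding \<open>s i * r i\<close> removes the coefficient \<open>\<beta> i\<close>
    when \<open>e i\<close> differs from \<open>e k\<close>; the terms with equal eigenvalue remain
    and make up \<open>x\<close>.\<close>
  define s where "s i = (if e i = e k then 0 else \<beta> i / (e k - e i))" for i
  define y where "y a = r k a + (\<Sum>i<k. s i * r i a)" for a
  define \<xi> where "\<xi> i = (if e i = e k then \<beta> i else 0)" for i
  define x where "x a = (\<Sum>i<k. \<xi> i * r i a)" for a
  have app_y: "app y a = e k * y a + x a" if "a < n" for a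
  proof -
    have "app y a = app (r k) a + (\<Sum>i<k. s i * app (r i) a)"
      unfolding y_def app_add app_sum ..
    also have "(\<Sum>i<k. s i * app (r i) a) = (\<Sum>i<k. s i * (e i * r i a))"
      using eig that by (intro sum.cong) (auto simp: is_eigen_def)
    finally have 1: "app y a = e k * r k a + (\<Sum>i<k. (\<beta> i + s i * e i) * r i a)"
      using \<beta>[OF that] by (simp add: distrib_right sum.distrib mult.assoc)
    have 2: "\<beta> i + s i * e i = e k * s i + \<xi> i" for i
      by (auto simp: s_def \<xi>_def field_simps)
    then show ?thesis
      unfolding 1 2 y_def x_def
      by (simp add: distrib_left distrib_right sum_distrib_left sum.distrib mult.assoc)
  qed
  have "is_eigen (e k) x"
    unfolding is_eigen_def
  proof safe
    fix a assume "a < n"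
    have "app x a = (\<Sum>i<k. \<xi> i * app (r i) a)"
      unfolding x_def app_sum ..
    also have "\<dots> = (\<Sum>i<k. e k * (\<xi> i * r i a))"
      using eig \<open>a < n\<close> by (intro sum.cong) (auto simp: is_eigen_def \<xi>_def)
    finally show "app x a = e k * x a"
      by (simp add: x_def sum_distrib_left)
  qed
  \<comment> \<open>Otherwise \<open>e k\<close> is real, and moving \<open>app\<close> from
    \<open>y\<close> to \<open>x\<close> shows
    \<open>e k * hinner n y x + hinner n x x = e k * hinner n y x\<close>.\<close>
  have "hinner n x x = 0"
  proof (rule ccontr)
    assume nz: "hinner n x x \<noteq> 0"
    have "hinner n (app y) x = hinner n (\<lambda>a. e k * y a + x a) x"
      using app_y by (intro hinner_cong) auto
    also have "\<dots> = e k * hinner n y x + hinner n x x"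
      by (simp add: hinner_def algebra_simps sum.distrib sum_distrib_left)
    finally show False
      using hinner_app[of y x] hinner_eigen_right[OF \<open>is_eigen (e k) x\<close>, of y] eigen_real[OF \<open>is_eigen (e k) x\<close> nz] nz by simp
  qed
  then have eig_y: "is_eigen (e k) y"
    using app_y by (simp add: hinner_self_eq_0_iff is_eigen_def)
  define r' where "r' = r(k := y)"
  have r'_other: "r' j = r j" if "j \<noteq> k" for j using that by (simp add: r'_def)
  have r'_k: "r' k = y" by (simp add: r'_def)
  have "triangular_family (Suc k) r'"
    unfolding triangular_family_def
  proof (intro conjI allI impI)
    fix c j
    assume c: "\<forall>a<n. (\<Sum>j<n. c j * r' j a) = 0" and j: "j < n"
    \<comment> \<open>The coefficients of the same combination with respect to the old
      vectors.\<close>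
    define d where "d j = c j + (if j < k then c k * s j else 0)" for j
    have "(\<Sum>j<n. d j * r j a) = 0" if "a < n" for a
    proof -
      have "(\<Sum>j<n. c j * r' j a) = (\<Sum>j<n. c j * r j a + (if j = k then c k * (\<Sum>i<k. s i * r i a) else 0))"
        by (intro sum.cong) (auto simp: r'_def y_def distrib_left)
      also have "\<dots> = (\<Sum>j<n. c j * r j a) + c k * (\<Sum>i<k. s i * r i a)"
        using k by (simp add: sum.distrib)
      also have "c k * (\<Sum>i<k. s i * r i a) = (\<Sum>i<n. (if i < k then c k * s i else 0) * r i a)"
        unfolding sum_distrib_left using k
        by (intro sum.mono_neutral_cong_left) auto
      also have "(\<Sum>j<n. c j * r j a) + \<dots> = (\<Sum>j<n. d j * r j a)"
        by (simp add: d_def distrib_right sum.distrib)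
      finally show ?thesis using c that by simp
    qed
    then have d: "\<And>j. j < n \<Longrightarrow> d j = 0" using inj by blast
    from d[OF k] have "c k = 0" by (simp add: d_def)
    with d[OF j] show "c j = 0" by (simp add: d_def split: if_splits)
  next
    fix j assume "j < n"
    consider "j < k" | "j = k" | "j > k" by linarith
    then show "\<exists>\<beta>. \<forall>a<n. app (r' j) a = e j * r' j a + (\<Sum>i<j. \<beta> i * r' i a)"
    proof cases
      case 1
      then show ?thesis using eig[OF 1] unfolding is_eigen_def by (intro exI[of _ "\<lambda>_. 0"]) (auto simp: r'_def)
    next
      case 2
      then show ?thesis using eig_y unfolding is_eigen_def by (intro exI[of _ "\<lambda>_. 0"]) (auto simp: r'_def)
    next
      case 3
      obtain b where b: "\<And>a. a < n \<Longrightarrow> app (r j) a = e j * r j a + (\<Sum>i<j. b i * r i a)"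
        using tri[OF \<open>j < n\<close>] by blast
      \<comment> \<open>Writing \<open>r k\<close> as \<open>y\<close> minus its corrections
        redistributes \<open>b k\<close> over the first \<open>k\<close> vectors.\<close>
      define b' where "b' i = b i - (if i < k then b k * s i else 0)" for i
      have "(\<Sum>i<j. b i * r i a) = (\<Sum>i<j. b' i * r' i a)" for a
      proof -
        have "(\<Sum>i<j. b' i * r' i a) = (\<Sum>i<j. b i * r i a - (if i < k then b k * s i * r i a else 0)
            + (if i = k then b k * (\<Sum>i<k. s i * r i a) else 0))"
          by (intro sum.cong) (auto simp: b'_def r'_def y_def algebra_simps)
        also have "\<dots> = (\<Sum>i<j. b i * r i a) - (\<Sum>i<j. if i < k then b k * s i * r i a else 0)
            + b k * (\<Sum>i<k. s i * r i a)"
          using 3 by (simp add: sum.distrib sum_subtractf)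
        also have "(\<Sum>i<j. if i < k then b k * s i * r i a else 0) = b k * (\<Sum>i<k. s i * r i a)"
          unfolding sum_distrib_left using 3
          by (intro sum.mono_neutral_cong_right) auto
        finally show ?thesis by simp
      qed
      then show ?thesis using b 3 by (intro exI[of _ b']) (auto simp: r'_other)
    qed
  next
    fix j assume "j < Suc k"
    then show "is_eigen (e j) (r' j)"
      using eig eig_y by (cases "j = k") (auto simp: r'_k r'_other)
  qed
  then show ?thesis by blast
qed

lemma triangular_family_diagonalise:
  assumes "triangular_family 0 r"
  shows "\<exists>r'. triangular_family n r'"
proof -
  have "k \<le> n \<Longrightarrow> \<exists>r'. triangular_family k r'" for k
  proof (induction k)
    case (Suc k)
    then show ?case using triangular_family_Suc by (metis Suc_le_lessD less_imp_le)
  qed (use assms in blast)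
  then show ?thesis by blast
qed

text \<open>The difference of the two sides is the squared norm of \<open>z\<close>, obtained from
  \<open>v\<close> by weighting with the roots of \<open>e j - \<mu>\<close>. Mixed terms cause no
  harm: for equal eigenvalues the weights agree, and for distinct ones the vectors are
  orthogonal.\<close>

lemma rayleigh_ge:
  fixes \<mu> :: real and c :: "nat \<Rightarrow> complex"
  assumes r: "triangular_family n r" and J: "J \<subseteq> {..<n}" and e: "\<And>j. j \<in> J \<Longrightarrow> Re (e j) \<ge> \<mu>"
  defines "v \<equiv> \<lambda>a. \<Sum>j\<in>J. c j * r j a"
  shows "Re (hinner n (app v) v) \<ge> \<mu> * Re (hinner n v v)"
proof -
  have fin: "finite J" using J finite_subset by blast
  have inj: "\<And>c. (\<forall>a<n. (\<Sum>j<n. c j * r j a) = 0) \<Longrightarrow> (\<forall>j<n. c j = 0)"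
    and eig: "\<And>j. j < n \<Longrightarrow> is_eigen (e j) (r j)"
    using r unfolding triangular_family_def by blast+
  have nz: "hinner n (r j) (r j) \<noteq> 0" if "j < n" for j
  proof
    assume "hinner n (r j) (r j) = 0"
    then have "\<forall>a<n. r j a = 0" by (simp add: hinner_self_eq_0_iff)
    then have "\<forall>a<n. (\<Sum>i<n. (if i = j then 1 else 0) * r i a) = 0"
      using that by (simp add: if_distrib[of "\<lambda>x. x * _"] cong: if_cong)
    from inj[OF this] that show False by auto
  qed
  have real: "e j = of_real (Re (e j))" if "j < n" for j
    using eigen_real[OF eig nz, OF that that] by (metis Reals_cnj_iff of_real_Re)
  define t where "t j = complex_of_real (sqrt (Re (e j) - \<mu>))" for j
  define z where "z = (\<lambda>a. \<Sum>j\<in>J. (c j * t j) * r j a)"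
  have key: "(e i - \<mu>) * hinner n (r i) (r j) = t i * cnj (t j) * hinner n (r i) (r j)" if "i \<in> J" "j \<in> J" for i j
  proof (cases "e i = e j")
    case True
    have "t i * cnj (t j) = of_real (Re (e i) - \<mu>)"
      using e[OF that(2)] unfolding t_def True by (simp flip: of_real_mult)
    also have "\<dots> = e i - \<mu>" using real[of i] that J by force
    finally show ?thesis by simp
  next
    case False
    then show ?thesis using eigen_orthogonal[OF eig[of i] eig[of j] nz[of j]] that J by auto
  qed
  have "hinner n (app v) v = hinner n (\<lambda>a. \<Sum>j\<in>J. (c j * e j) * r j a) v"
  proof (rule hinner_cong)
    fix a assume "a < n"
    then show "app v a = (\<Sum>j\<in>J. (c j * e j) * r j a)"
      unfolding v_def app_sum using eig J by (intro sum.cong) (auto simp: is_eigen_def)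
  qed simp
  then have "hinner n (app v) v - \<mu> * hinner n v v = (\<Sum>i\<in>J. \<Sum>j\<in>J. c i * cnj (c j) * ((e i - \<mu>) * hinner n (r i) (r j)))"
    unfolding v_def hinner_sum_left hinner_sum_right
    by (simp add: sum_distrib_left left_diff_distrib right_diff_distrib sum_subtractf mult_ac)
  also have "\<dots> = (\<Sum>i\<in>J. \<Sum>j\<in>J. c i * cnj (c j) * (t i * cnj (t j) * hinner n (r i) (r j)))"
    using key by (intro sum.cong) auto
  also have "\<dots> = hinner n z z"
    unfolding z_def hinner_sum_left hinner_sum_right by (simp add: sum_distrib_left mult_ac)
  finally have "Re (hinner n (app v) v - \<mu> * hinner n v v) = Re (hinner n z z)" by simp
  also have "\<dots> \<ge> 0" unfolding hinner_self by (simp add: sum_nonneg)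
  finally show ?thesis by simp
qed

end

section \<open>The Gram matrix and a min-max bound for singular values\<close>

lemma mat_adjoint_index:
  "i < dim_col A \<Longrightarrow> j < dim_row A \<Longrightarrow> mat_adjoint A $$ (i, j) = cnj ((A :: complex mat) $$ (j, i))"
  unfolding mat_adjoint_def by (simp add: mat_of_rows_index)

lemma mat_adjoint_dim [simp]:
  "dim_row (mat_adjoint A) = dim_col A" "dim_col (mat_adjoint A) = dim_row A"
  unfolding mat_adjoint_def by simp_all

lemma mult_mat_vec_index:
  "i < dim_row A \<Longrightarrow> dim_vec v = dim_col A \<Longrightarrow> (A *\<^sub>v v) $ i = (\<Sum>k<dim_col A. A $$ (i, k) * v $ k)"
  by (simp add: scalar_prod_def atLeast0LessThan)

lemma mult_mat_index:
  "i < dim_row A \<Longrightarrow> j < dim_col B \<Longrightarrow> dim_row B = dim_col A \<Longrightarrow> (A * B) $$ (i, j) = (\<Sum>k<dim_col A. A $$ (i, k) * B $$ (k, j))"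
  by (simp add: scalar_prod_def atLeast0LessThan)

lemma vec_norm2_square: "(vec_norm2 v)\<^sup>2 = (\<Sum>i<dim_vec v. (cmod (v $ i))\<^sup>2)"
  unfolding vec_norm2_def L2_set_def by (simp add: sum_nonneg)

lemma vec_norm2_nonneg [simp]: "vec_norm2 v \<ge> 0"
  unfolding vec_norm2_def by (rule L2_set_nonneg)

text \<open>A zero row completes the \<open>N\<close> equations to a square system with vanishing
  determinant.\<close>

lemma underdetermined_system_nontrivial:
  fixes G :: "nat \<Rightarrow> nat \<Rightarrow> complex"
  obtains c where "\<exists>j\<le>N. c j \<noteq> 0" "\<And>i. i < N \<Longrightarrow> (\<Sum>j\<le>N. G i j * c j) = 0"
proof -
  define M where "M = mat (Suc N) (Suc N) (\<lambda>(i, j). if i < N then G i j else 0)"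
  have M: "M \<in> carrier_mat (Suc N) (Suc N)" by (simp add: M_def)
  have "M = mat\<^sub>r (Suc N) (Suc N) (\<lambda>i. if i = N then 0\<^sub>v (Suc N) else row M i)"
    by (intro eq_matI) (auto simp: M_def)
  then have "det M = det (mat\<^sub>r (Suc N) (Suc N) (\<lambda>i. if i = N then 0\<^sub>v (Suc N) else row M i))"
    by (rule arg_cong)
  also have "\<dots> = 0"
    by (rule det_row_0) (auto simp: M_def)
  finally have "det M = 0" .
  then obtain w where w: "w \<in> carrier_vec (Suc N)" "w \<noteq> 0\<^sub>v (Suc N)" "M *\<^sub>v w = 0\<^sub>v (Suc N)"
    using det_0_iff_vec_prod_zero[OF M] by blast
  show ?thesis
  proof (rule that[of "\<lambda>j. w $ j"])
    show "\<exists>j\<le>N. w $ j \<noteq> 0"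
    proof (rule ccontr)
      assume "\<not> ?thesis"
      then have "w = 0\<^sub>v (Suc N)" using w(1) by (intro eq_vecI) (auto simp: less_Suc_eq_le)
      then show False using w(2) by blast
    qed
    fix i assume i: "i < N"
    have "(M *\<^sub>v w) $ i = (\<Sum>k<Suc N. M $$ (i, k) * w $ k)"
      using i w(1) by (subst mult_mat_vec_index) (auto simp: M_def)
    also have "\<dots> = (\<Sum>k\<le>N. G i k * w $ k)"
      using i unfolding lessThan_Suc_atMost by (intro sum.cong) (auto simp: M_def)
    finally show "(\<Sum>j\<le>N. G i j * w $ j) = 0"
      using i w(3) by simp
  qed
qed

lemma gram_index:
  assumes "a < dim_col A" "b < dim_col A"
  shows "(mat_adjoint A * A) $$ (a, b) = (\<Sum>i<dim_row A. cnj (A $$ (i, a)) * A $$ (i, b))"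
  using assms by (simp add: mult_mat_index mat_adjoint_index del: index_mult_mat(1))

lemma gram_hermitian_matrix: "hermitian_matrix (dim_col A) (\<lambda>a b. (mat_adjoint A * A) $$ (a, b))"
  by unfold_locales (simp add: gram_index mult.commute del: index_mult_mat(1))

lemma vec_norm2_mult_mat_vec:
  fixes A :: "complex mat" and v :: "nat \<Rightarrow> complex"
  defines "n \<equiv> dim_col A"
  shows "of_real ((vec_norm2 (A *\<^sub>v vec n v))\<^sup>2) =
    hinner n (hermitian_matrix.app n (\<lambda>a b. (mat_adjoint A * A) $$ (a, b)) v) v"
proof -
  have "complex_of_real ((vec_norm2 (A *\<^sub>v vec n v))\<^sup>2) = (\<Sum>i<dim_row A. (A *\<^sub>v vec n v) $ i * cnj ((A *\<^sub>v vec n v) $ i))"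
    unfolding vec_norm2_square of_real_sum complex_norm_square by simp
  also have "\<dots> = (\<Sum>i<dim_row A. (\<Sum>k<n. A $$ (i, k) * v k) * cnj (\<Sum>l<n. A $$ (i, l) * v l))"
    by (intro sum.cong refl) (simp add: mult_mat_vec_index n_def del: index_mult_mat_vec)
  also have "\<dots> = (\<Sum>i<dim_row A. \<Sum>l<n. \<Sum>k<n. cnj (A $$ (i, l)) * A $$ (i, k) * v k * cnj (v l))"
    unfolding cnj_sum sum_product by (rule sum.cong[OF refl], rule trans[OF sum.swap]) (simp add: mult_ac)
  also have "\<dots> = (\<Sum>l<n. \<Sum>k<n. \<Sum>i<dim_row A. cnj (A $$ (i, l)) * A $$ (i, k) * v k * cnj (v l))"
    by (rule trans[OF sum.swap], rule sum.cong[OF refl], rule sum.swap)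
  also have "\<dots> = (\<Sum>l<n. (\<Sum>k<n. (mat_adjoint A * A) $$ (l, k) * v k) * cnj (v l))"
  proof (rule sum.cong[OF refl])
    fix l assume l: "l \<in> {..<n}"
    have "(\<Sum>i<dim_row A. cnj (A $$ (i, l)) * A $$ (i, k) * v k * cnj (v l)) = (mat_adjoint A * A) $$ (l, k) * v k * cnj (v l)"
      if "k \<in> {..<n}" for k
      using l that by (simp add: gram_index n_def sum_distrib_right del: index_mult_mat(1))
    then show "(\<Sum>k<n. \<Sum>i<dim_row A. cnj (A $$ (i, l)) * A $$ (i, k) * v k * cnj (v l)) =
        (\<Sum>k<n. (mat_adjoint A * A) $$ (l, k) * v k) * cnj (v l)"
      unfolding sum_distrib_right by (rule sum.cong[OF refl])
  qed
  also have "\<dots> = hinner n (hermitian_matrix.app n (\<lambda>a b. (mat_adjoint A * A) $$ (a, b)) v) v"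
    unfolding hinner_def hermitian_matrix.app_def[OF gram_hermitian_matrix[of A], folded n_def] ..
  finally show ?thesis .
qed

text \<open>One half of the Courant-Fischer principle. On the span of the eigenvectors for the
  \<open>N + 1\<close> largest eigenvalues of the Gram matrix, \<open>A\<close> stretches by at
  least the singular value, and \<open>N\<close> linear conditions leave a nonzero vector in that
  span.\<close>

theorem singular_value_le:
  fixes A :: "complex mat"
  assumes \<delta>: "\<delta> \<ge> 0"
    and bound: "\<And>v. v \<in> carrier_vec (dim_col A) \<Longrightarrow> (\<And>i. i < N \<Longrightarrow> (\<Sum>k<dim_col A. g i k * v $ k) = 0) \<Longrightarrow>
      vec_norm2 (A *\<^sub>v v) \<le> \<delta> * vec_norm2 v"
  shows "singular_value A (N + 1) \<le> \<delta>"
proof (cases "N + 1 \<le> min (dim_row A) (dim_col A)")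
  case False
  then show ?thesis using \<delta> by (auto simp: singular_value_def)
next
  case True
  define n where "n = dim_col A"
  have Nn: "N < n" using True by (simp add: n_def)
  define M where "M = mat_adjoint A * A"
  have M: "M \<in> carrier_mat n n" unfolding M_def n_def by (intro carrier_matI) simp_all
  define key where "key z = sqrt (Re z)" for z
  obtain es0 where es0: "char_poly M = (\<Prod>a\<leftarrow>es0. [:- a, 1:])" "length es0 = n"
    using char_poly_factorized[OF M] by blast
  \<comment> \<open>\<open>schur_decomposition\<close> realises any prescribed order of the
    eigenvalues; this is the order used by \<open>singular_value\<close>.\<close>
  define es where "es = rev (sort_key key es0)"
  have len: "length es = n" by (simp add: es_def es0)
  have ms: "mset es = mset es0" by (simp add: es_def)
  have cp: "char_poly M = (\<Prod>a\<leftarrow>es. [:- a, 1:])"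
    unfolding es0 using ms by (metis mset_map prod_mset_prod_list)
  have "proots (char_poly M) = mset es"
    unfolding cp
  proof (induction es)
    case (Cons a es)
    have "(\<Prod>a\<leftarrow>es. [:- a, 1:]) \<noteq> 0" unfolding prod_list_zero_iff by auto
    then have "proots ([:- a, 1:] * (\<Prod>a\<leftarrow>es. [:- a, 1:])) = proots [:- a, 1:] + proots (\<Prod>a\<leftarrow>es. [:- a, 1:])"
      by (intro proots_mult) auto
    then show ?case using Cons by (simp del: mult_pCons_left)
  qed simp
  moreover have "sort (map key es) = rev (map key es)"
    by (rule properties_for_sort) (auto simp: es_def rev_map)
  ultimately have sv: "singular_value A (N + 1) = key (es ! N)"
    using True Nn len unfolding singular_value_def M_def[symmetric] key_def[abs_def]
    by (simp flip: mset_map)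
  have ge: "key (es ! j) \<ge> key (es ! N)" if "j \<le> N" for j
  proof -
    have "sorted (rev (map key es))" by (simp add: es_def rev_map)
    then have "sorted_wrt (\<ge>) (map key es)" by (simp add: sorted_wrt_rev)
    then show ?thesis
      using that Nn len sorted_wrt_nth_less[of "(\<ge>)" "map key es" j N] by (cases "j = N") auto
  qed
  define \<sigma> where "\<sigma> = key (es ! N)"
  show ?thesis
  \<comment> \<open>\<open>sqrt\<close> is negative on negative reals, so a positive \<sigma> forces
    the real parts to be at least its square. The sign of the eigenvalues does not have to be
    established first.\<close>
  proof (cases "\<sigma> \<le> 0")
    case True
    then show ?thesis using sv \<delta> by (simp add: \<sigma>_def)
  next
    case False
    have Re_ge: "Re (es ! j) \<ge> \<sigma>\<^sup>2" if "j \<le> N" for j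
    proof -
      have "sqrt (Re (es ! j)) \<ge> \<sigma>" using ge[OF that] by (simp add: \<sigma>_def key_def)
      then show ?thesis using False by (metis real_sqrt_le_iff real_sqrt_abs abs_of_pos not_le)
    qed
    interpret hermitian_matrix n "\<lambda>a b. M $$ (a, b)" "\<lambda>j. es ! j"
      unfolding M_def n_def by (rule gram_hermitian_matrix)
    obtain B P R where BPR: "schur_decomposition M es = (B, P, R)" by (metis prod_cases3)
    from schur_decomposition[OF M cp BPR] have
      sim: "similar_mat_wit M B P R" and ut: "upper_triangular B" and dg: "diag_mat B = es" by auto
    note D = similar_mat_witD2[OF M sim]
    have Bdiag: "B $$ (j, j) = es ! j" if "j < n" for j
      using that D(5) unfolding dg[symmetric] diag_mat_def by simp
    have MP: "M * P = P * B"
    proof -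
      have "M * P = P * B * (R * P)" using D by (simp add: assoc_mult_mat[of _ n n _ n _ n])
      then show ?thesis using D by simp
    qed
    have "triangular_family 0 (\<lambda>j a. P $$ (a, j))"
      unfolding triangular_family_def
    proof (intro conjI allI impI)
      fix c j
      assume c: "\<forall>a<n. (\<Sum>j<n. c j * P $$ (a, j)) = 0" and j: "j < n"
      have "P *\<^sub>v vec n c = 0\<^sub>v n"
      proof (rule eq_vecI)
        fix a assume "a < dim_vec (0\<^sub>v n)"
        then have a: "a < n" by simp
        then have "(P *\<^sub>v vec n c) $ a = (\<Sum>j<n. P $$ (a, j) * c j)"
          using D(6) by (subst mult_mat_vec_index) auto
        then show "(P *\<^sub>v vec n c) $ a = 0\<^sub>v n $ a"
          using c a by (simp add: mult.commute del: index_mult_mat_vec)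
      qed (use D(6) in simp)
      moreover have "R *\<^sub>v 0\<^sub>v n = 0\<^sub>v n"
        using D(7) by (intro eq_vecI) (auto simp: scalar_prod_def)
      ultimately have "R *\<^sub>v (P *\<^sub>v vec n c) = 0\<^sub>v n" by simp
      moreover have "R *\<^sub>v (P *\<^sub>v vec n c) = vec n c"
        using D by (simp add: assoc_mult_mat_vec[symmetric, of _ n n _ n])
      ultimately show "c j = 0" using j by (metis index_vec index_zero_vec(1))
    next
      fix j assume j: "j < n"
      have "app (\<lambda>a. P $$ (a, j)) a = es ! j * P $$ (a, j) + (\<Sum>i<j. B $$ (i, j) * P $$ (a, i))" if a: "a < n" for a
      proof -
        have "app (\<lambda>a. P $$ (a, j)) a = (M * P) $$ (a, j)"
          unfolding app_def using a j D by (subst mult_mat_index) auto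
        also have "\<dots> = (\<Sum>i<n. P $$ (a, i) * B $$ (i, j))"
          unfolding MP using a j D by (subst mult_mat_index) auto
        also have "\<dots> = (\<Sum>i<Suc j. P $$ (a, i) * B $$ (i, j))"
          using j ut D(5) by (intro sum.mono_neutral_right) (auto simp: upper_triangular_def)
        finally show ?thesis using Bdiag[OF j] by (simp add: mult.commute)
      qed
      then show "\<exists>\<beta>. \<forall>a<n. app (\<lambda>a. P $$ (a, j)) a = es ! j * P $$ (a, j) + (\<Sum>i<j. \<beta> i * P $$ (a, i))"
        by (intro exI[of _ "\<lambda>i. B $$ (i, j)"]) simp
    qed auto
    then obtain r where r: "triangular_family n r" using triangular_family_diagonalise by blast
    have inj: "\<And>c. (\<forall>a<n. (\<Sum>j<n. c j * r j a) = 0) \<Longrightarrow> (\<forall>j<n. c j = 0)"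
      using r unfolding triangular_family_def by blast
    \<comment> \<open>The \<open>N\<close> conditions become equations for the \<open>N + 1\<close>
      coefficients with respect to the leading eigenvectors.\<close>
    obtain c where c: "\<exists>j\<le>N. c j \<noteq> 0" "\<And>i. i < N \<Longrightarrow> (\<Sum>j\<le>N. (\<Sum>k<n. g i k * r j k) * c j) = 0"
      using underdetermined_system_nontrivial[of N "\<lambda>i j. \<Sum>k<n. g i k * r j k"] by blast
    define v where "v = (\<lambda>a. \<Sum>j\<in>{..N}. c j * r j a)"
    have J: "{..N} \<subseteq> {..<n}" using Nn by auto
    have "(\<Sum>k<dim_col A. g i k * vec n v $ k) = 0" if "i < N" for i
    proof -
      have "(\<Sum>k<dim_col A. g i k * vec n v $ k) = (\<Sum>k<n. \<Sum>j\<le>N. g i k * r j k * c j)"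
        unfolding n_def v_def by (intro sum.cong refl) (simp add: sum_distrib_left mult_ac)
      also have "\<dots> = (\<Sum>j\<le>N. (\<Sum>k<n. g i k * r j k) * c j)"
        by (subst sum.swap) (simp add: sum_distrib_right)
      finally show ?thesis using c(2)[OF that] by simp
    qed
    then have le: "vec_norm2 (A *\<^sub>v vec n v) \<le> \<delta> * vec_norm2 (vec n v)"
      by (intro bound) (auto simp: n_def)
    have ipv: "Re (hinner n v v) = (vec_norm2 (vec n v))\<^sup>2"
      unfolding hinner_self vec_norm2_square by simp
    have "\<sigma>\<^sup>2 * (vec_norm2 (vec n v))\<^sup>2 \<le> (vec_norm2 (A *\<^sub>v vec n v))\<^sup>2"
    proof -
      have "complex_of_real ((vec_norm2 (A *\<^sub>v vec n v))\<^sup>2) = hinner n (app v) v"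
        using vec_norm2_mult_mat_vec[of A v] unfolding n_def M_def .
      then have "(vec_norm2 (A *\<^sub>v vec n v))\<^sup>2 = Re (hinner n (app v) v)"
        by (metis Re_complex_of_real)
      then show ?thesis
        using rayleigh_ge[OF r J, of "\<sigma>\<^sup>2" c] Re_ge ipv unfolding v_def[symmetric] by simp
    qed
    also have "\<dots> \<le> (\<delta> * vec_norm2 (vec n v))\<^sup>2"
      using le by (intro power_mono) auto
    finally have "(\<sigma> * vec_norm2 (vec n v))\<^sup>2 \<le> (\<delta> * vec_norm2 (vec n v))\<^sup>2"
      by (simp add: power_mult_distrib)
    then have "\<sigma> * vec_norm2 (vec n v) \<le> \<delta> * vec_norm2 (vec n v)"
      by (rule power2_le_imp_le) (use \<delta> in simp)
    \<comment> \<open>Linear independence of the eigenvectors: some \<open>c j\<close> with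
      \<open>j \<le> N\<close> is nonzero.\<close>
    moreover have "vec_norm2 (vec n v) > 0"
    proof (rule ccontr)
      assume "\<not> ?thesis"
      then have "vec_norm2 (vec n v) = 0" using vec_norm2_nonneg[of "vec n v"] by linarith
      then have "hinner n v v = 0" using ipv by (simp add: hinner_self)
      then have "\<forall>a<n. v a = 0" by (simp add: hinner_self_eq_0_iff)
      moreover have "(\<Sum>j<n. (if j \<le> N then c j else 0) * r j a) = v a" for a
        unfolding v_def using J by (intro sum.mono_neutral_cong_right) auto
      ultimately have "\<forall>a<n. (\<Sum>j<n. (if j \<le> N then c j else 0) * r j a) = 0"
        by (simp only: simp_thms)
      then have "\<forall>j<n. (if j \<le> N then c j else 0) = 0"
        by (rule inj)
      then show False using c(1) Nn by (meson le_less_trans)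
    qed
    ultimately have "\<sigma> \<le> \<delta>" by simp
    then show ?thesis using sv by (simp add: \<sigma>_def)
  qed
qed

text \<open>The set in the definition of the norm is bounded by the sum \<open>F\<close> of the
  moduli of all entries, so its supremum is an upper bound; scaling does the rest.\<close>

lemma vec_norm2_mult_le_spectral_norm:
  assumes v: "v \<in> carrier_vec (dim_col X)"
  shows "vec_norm2 (X *\<^sub>v v) \<le> spectral_norm X * vec_norm2 v"
proof -
  let ?S = "{vec_norm2 (X *\<^sub>v v) | v. v \<in> carrier_vec (dim_col X) \<and> vec_norm2 v \<le> 1}"
  define F where "F = (\<Sum>i<dim_row X. \<Sum>k<dim_col X. cmod (X $$ (i, k)))"
  have bdd: "bdd_above ?S"
  proof (rule bdd_aboveI)
    fix x assume "x \<in> ?S"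
    then obtain u where x: "x = vec_norm2 (X *\<^sub>v u)" and u: "u \<in> carrier_vec (dim_col X)" "vec_norm2 u \<le> 1" by blast
    have u1: "cmod (u $ k) \<le> 1" if "k < dim_col X" for k
    proof -
      have "cmod (u $ k) \<le> vec_norm2 u"
        unfolding vec_norm2_def using that u(1) by (intro member_le_L2_set) auto
      then show ?thesis using u(2) by linarith
    qed
    have "x \<le> (\<Sum>i<dim_row X. cmod ((X *\<^sub>v u) $ i))"
      unfolding x vec_norm2_def by (rule order_trans[OF L2_set_le_sum]) auto
    also have "\<dots> \<le> F"
      unfolding F_def
    proof (intro sum_mono)
      fix i assume i: "i \<in> {..<dim_row X}"
      have "cmod ((X *\<^sub>v u) $ i) = cmod (\<Sum>k<dim_col X. X $$ (i, k) * u $ k)"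
        using i u(1) by (subst mult_mat_vec_index) auto
      also have "\<dots> \<le> (\<Sum>k<dim_col X. cmod (X $$ (i, k)))"
        using u1 by (intro sum_norm_le) (auto simp: norm_mult intro: mult_left_le)
      finally show "cmod ((X *\<^sub>v u) $ i) \<le> (\<Sum>k<dim_col X. cmod (X $$ (i, k)))" .
    qed
    finally show "x \<le> F" .
  qed
  show ?thesis
  proof (cases "vec_norm2 v = 0")
    case True
    then have "\<forall>k<dim_vec v. v $ k = 0"
      unfolding vec_norm2_def by (subst (asm) L2_set_eq_0_iff) auto
    then have "(X *\<^sub>v v) $ i = 0" if "i < dim_row X" for i
      using v that by (subst mult_mat_vec_index) auto
    then have "vec_norm2 (X *\<^sub>v v) = 0"
      unfolding vec_norm2_def by (subst L2_set_eq_0_iff) auto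
    then show ?thesis using True by simp
  next
    case False
    then have pos: "vec_norm2 v > 0" using vec_norm2_nonneg[of v] by linarith
    have scale: "vec_norm2 (of_real c \<cdot>\<^sub>v w) = c * vec_norm2 w" if "c \<ge> 0" for c w
      unfolding vec_norm2_def L2_set_right_distrib[OF that] using that
      by (intro L2_set_cong) (auto simp: norm_mult)
    define c where "c = 1 / vec_norm2 v"
    have c: "c \<ge> 0" using pos by (simp add: c_def)
    have "vec_norm2 (X *\<^sub>v (of_real c \<cdot>\<^sub>v v)) \<in> ?S"
      using v scale[OF c, of v] pos by (auto simp: c_def intro!: exI[of _ "of_real c \<cdot>\<^sub>v v"])
    then have "vec_norm2 (X *\<^sub>v (of_real c \<cdot>\<^sub>v v)) \<le> spectral_norm X"
      unfolding spectral_norm_def using bdd by (intro cSup_upper) auto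
    moreover have "X *\<^sub>v (of_real c \<cdot>\<^sub>v v) = of_real c \<cdot>\<^sub>v (X *\<^sub>v v)"
      using v by (intro mult_mat_vec[of _ "dim_row X" "dim_col X"]) auto
    ultimately have "c * vec_norm2 (X *\<^sub>v v) \<le> spectral_norm X"
      using scale[OF c] by simp
    then show ?thesis using pos by (simp add: c_def field_simps)
  qed
qed

lemma spectral_norm_nonneg: "spectral_norm X \<ge> 0"
proof (cases "dim_col X = 0")
  case True
  have "{vec_norm2 (X *\<^sub>v v) | v. v \<in> carrier_vec (dim_col X) \<and> vec_norm2 v \<le> 1} = {0}"
  proof -
    have "vec_norm2 (X *\<^sub>v v) = 0" if "v \<in> carrier_vec (dim_col X)" for v
      unfolding vec_norm2_def using that True
      by (subst L2_set_eq_0_iff) (auto simp: mult_mat_vec_index simp del: index_mult_mat_vec)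
    moreover have "0\<^sub>v (dim_col X) \<in> carrier_vec (dim_col X)" "vec_norm2 (0\<^sub>v (dim_col X) :: complex vec) \<le> 1"
      using True by (auto simp: vec_norm2_def)
    ultimately show ?thesis by (auto intro!: exI[of _ "0\<^sub>v (dim_col X)"])
  qed
  then show ?thesis unfolding spectral_norm_def by simp
next
  case False
  define v :: "complex vec" where "v = unit_vec (dim_col X) 0"
  have v: "v \<in> carrier_vec (dim_col X)" by (simp add: v_def)
  have "vec_norm2 v \<ge> cmod (v $ 0)"
    unfolding vec_norm2_def using False v by (intro member_le_L2_set) auto
  then have "vec_norm2 v > 0" using False by (simp add: v_def)
  moreover have "0 \<le> spectral_norm X * vec_norm2 v"
    using vec_norm2_mult_le_spectral_norm[OF v] vec_norm2_nonneg[of "X *\<^sub>v v"] by linarith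
  ultimately show ?thesis by (simp add: zero_le_mult_iff)
qed

section \<open>Displacement structure and low rank corrections\<close>

text \<open>The factors are exchanged one at a time. Each summand later becomes a matrix of rank
  one.\<close>

lemma prod_diff_telescope:
  fixes \<alpha> \<beta> :: "nat \<Rightarrow> 'a :: comm_ring_1"
  shows "(\<Prod>i<N. \<alpha> i) - (\<Prod>i<N. \<beta> i) = (\<Sum>i<N. (\<Prod>l<i. \<alpha> l) * (\<alpha> i - \<beta> i) * (\<Prod>l\<in>{Suc i..<N}. \<beta> l))"
proof (induction N)
  case (Suc N)
  have "(\<Sum>i<N. (\<Prod>l<i. \<alpha> l) * (\<alpha> i - \<beta> i) * (\<Prod>l\<in>{Suc i..<Suc N}. \<beta> l)) =
     (\<Sum>i<N. (\<Prod>l<i. \<alpha> l) * (\<alpha> i - \<beta> i) * (\<Prod>l\<in>{Suc i..<N}. \<beta> l)) * \<beta> N"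
    unfolding sum_distrib_right by (intro sum.cong refl) (simp add: mult.assoc)
  then show ?case
    unfolding sum.lessThan_Suc Suc[symmetric] by (simp add: algebra_simps)
qed simp

lemma vec_norm2_mono:
  fixes v w :: "complex vec"
  assumes "dim_vec v = dim_vec w" "c \<ge> 0" "\<And>i. i < dim_vec v \<Longrightarrow> cmod (v $ i) \<le> c * cmod (w $ i)"
  shows "vec_norm2 v \<le> c * vec_norm2 w"
  unfolding vec_norm2_def L2_set_right_distrib[OF assms(2)] assms(1)[symmetric]
  using assms(3) by (intro L2_set_mono) auto

text \<open>The pairs are homogeneous coordinates of the points \<open>xs k / xc k\<close> and
  \<open>ys j / yc j\<close>, the latter possibly infinite. With \<open>B\<close> the Blaschke
  product, \<open>\<tau> k\<close> is its value at the column point and \<open>\<rho> j\<close> its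
  reciprocal value at the row point; both are bounded by \<delta>. The entries
  \<open>A $$ (j, k) * (1 - \<rho> j * \<tau> k)\<close> form a matrix of rank at most
  \<open>N\<close>, and on the common kernel of its row functionals \<open>g i\<close> both small
  factors act.\<close>

theorem singular_value_displacement_le:
  fixes A :: "complex mat" and a ys yc xs xc :: "nat \<Rightarrow> real" and u w :: "nat \<Rightarrow> complex"
  assumes rel: "\<And>j k. j < dim_row A \<Longrightarrow> k < dim_col A \<Longrightarrow>
      A $$ (j, k) * of_real (ys j * xc k - yc j * xs k) = u j * w k"
    and a: "\<And>i. \<bar>a i\<bar> < 1" and C: "C \<le> 1" and \<delta>: "\<delta> \<ge> 0"
    and bl: "\<And>x. \<bar>x\<bar> \<le> C \<Longrightarrow> (\<Prod>i<N. \<bar>x - a i\<bar>) \<le> \<delta> * (\<Prod>i<N. \<bar>1 - a i * x\<bar>)"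
    and y: "\<And>j. j < dim_row A \<Longrightarrow> ys j \<noteq> 0 \<and> \<bar>yc j\<bar> \<le> C * \<bar>ys j\<bar>"
    and x: "\<And>k. k < dim_col A \<Longrightarrow> xc k \<noteq> 0 \<and> \<bar>xs k\<bar> \<le> C * \<bar>xc k\<bar>"
  shows "singular_value A (N + 1) \<le> \<delta>\<^sup>2 * spectral_norm A"
proof -
  define P where "P s c = (\<Prod>i<N. s - a i * c)" for s c :: real
  have P: "P c s \<noteq> 0 \<and> \<bar>P s c / P c s\<bar> \<le> \<delta>" if "c \<noteq> 0" "\<bar>s\<bar> \<le> C * \<bar>c\<bar>" for s c
  proof -
    define z where "z = s / c"
    have z: "s = z * c" using that by (simp add: z_def)
    have zC: "\<bar>z\<bar> \<le> C" using that by (simp add: z_def abs_mult divide_le_eq)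
    have nz: "1 - a i * z \<noteq> 0" for i
    proof -
      have "\<bar>a i * z\<bar> \<le> \<bar>a i\<bar> * 1" unfolding abs_mult using zC C by (intro mult_left_mono) auto
      then have "\<bar>a i * z\<bar> < 1" using a[of i] by simp
      then show ?thesis by auto
    qed
    have 1: "P s c = c ^ N * (\<Prod>i<N. z - a i)"
      unfolding P_def z by (simp add: prod.distrib flip: left_diff_distrib)
    have 2: "P c s = c ^ N * (\<Prod>i<N. 1 - a i * z)"
    proof -
      have "c - a i * (z * c) = c * (1 - a i * z)" for i by (simp add: algebra_simps)
      then show ?thesis unfolding P_def z by (simp add: prod.distrib)
    qed
    have "(\<Prod>i<N. 1 - a i * z) \<noteq> 0" using nz by simp
    moreover have "\<bar>\<Prod>i<N. z - a i\<bar> \<le> \<delta> * \<bar>\<Prod>i<N. 1 - a i * z\<bar>"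
      using bl[OF zC] by (simp add: abs_prod)
    ultimately show ?thesis
      unfolding 1 2 using that(1) by (simp add: abs_divide divide_le_eq)
  qed
  \<comment> \<open>\<open>f i\<close> and \<open>g i\<close> separate the \<open>i\<close>-th
    telescoping summand into its dependence on the row and on the column.\<close>
  define f where "f i j = u j * of_real ((1 - (a i)\<^sup>2) * (\<Prod>l<i. ys j - a l * yc j) * (\<Prod>l\<in>{Suc i..<N}. yc j - a l * ys j) / P (ys j) (yc j))" for i j
  define g where "g i k = w k * of_real ((\<Prod>l<i. xc k - a l * xs k) * (\<Prod>l\<in>{Suc i..<N}. xs k - a l * xc k) / P (xc k) (xs k))" for i k
  define \<rho> where "\<rho> j = P (yc j) (ys j) / P (ys j) (yc j)" for j
  define \<tau> where "\<tau> k = P (xs k) (xc k) / P (xc k) (xs k)" for k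
  have \<rho>: "P (ys j) (yc j) \<noteq> 0" "\<bar>\<rho> j\<bar> \<le> \<delta>" if "j < dim_row A" for j
    using P[of "ys j" "yc j"] y[OF that] by (auto simp: \<rho>_def)
  have \<tau>: "P (xc k) (xs k) \<noteq> 0" "\<bar>\<tau> k\<bar> \<le> \<delta>" if "k < dim_col A" for k
    using P[of "xc k" "xs k"] x[OF that] by (auto simp: \<tau>_def)
  have entry: "A $$ (j, k) = (\<Sum>i<N. f i j * g i k) + of_real (\<rho> j) * (A $$ (j, k) * of_real (\<tau> k))"
    if jk: "j < dim_row A" "k < dim_col A" for j k
  proof -
    define D where "D = P (ys j) (yc j) * P (xc k) (xs k)"
    have D: "D \<noteq> 0" using \<rho>(1)[OF jk(1)] \<tau>(1)[OF jk(2)] by (simp add: D_def)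
    define E where "E = ys j * xc k - yc j * xs k"
    define p where "p i = (\<Prod>l<i. ys j - a l * yc j) * (\<Prod>l\<in>{Suc i..<N}. yc j - a l * ys j)" for i
    define q where "q i = (\<Prod>l<i. xc k - a l * xs k) * (\<Prod>l\<in>{Suc i..<N}. xs k - a l * xc k)" for i
    \<comment> \<open>Every single exchange of factors contributes
      \<open>E * (1 - (a i)\<^sup>2)\<close>, where \<open>E\<close> is the cross product of the two
      coordinate pairs. The displacement relation then replaces \<open>A $$ (j, k) * E\<close> by
      \<open>u j * w k\<close>.\<close>
    have "D - P (yc j) (ys j) * P (xs k) (xc k) = (\<Sum>i<N. E * ((1 - (a i)\<^sup>2) * p i * q i))"
      unfolding D_def P_def prod.distrib[symmetric] prod_diff_telescope
    proof (intro sum.cong refl)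
      fix i
      have "(ys j - a i * yc j) * (xc k - a i * xs k) - (yc j - a i * ys j) * (xs k - a i * xc k) = E * (1 - (a i)\<^sup>2)"
        by (simp add: E_def power2_eq_square algebra_simps)
      then show "(\<Prod>l<i. (ys j - a l * yc j) * (xc k - a l * xs k)) *
         ((ys j - a i * yc j) * (xc k - a i * xs k) - (yc j - a i * ys j) * (xs k - a i * xc k)) *
         (\<Prod>l = Suc i..<N. (yc j - a l * ys j) * (xs k - a l * xc k)) = E * ((1 - (a i)\<^sup>2) * p i * q i)"
        unfolding p_def q_def prod.distrib by (simp only: mult_ac)
    qed
    then have "A $$ (j, k) * of_real (D - P (yc j) (ys j) * P (xs k) (xc k)) =
       A $$ (j, k) * of_real E * of_real (\<Sum>i<N. (1 - (a i)\<^sup>2) * p i * q i)"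
      by (simp add: sum_distrib_left[symmetric])
    also have "A $$ (j, k) * of_real E = u j * w k"
      unfolding E_def by (rule rel[OF jk])
    finally have "A $$ (j, k) * of_real (D - P (yc j) (ys j) * P (xs k) (xc k)) / of_real D =
       u j * w k * of_real (\<Sum>i<N. (1 - (a i)\<^sup>2) * p i * q i) / of_real D"
      by (simp only:)
    also have "\<dots> = (\<Sum>i<N. u j * w k * of_real ((1 - (a i)\<^sup>2) * p i * q i) / of_real D)"
      by (simp add: sum_distrib_left sum_divide_distrib)
    also have "\<dots> = (\<Sum>i<N. f i j * g i k)"
      by (intro sum.cong refl) (simp add: f_def g_def p_def q_def D_def)
    also have "A $$ (j, k) * of_real (D - P (yc j) (ys j) * P (xs k) (xc k)) / of_real D =
       A $$ (j, k) - of_real (\<rho> j) * (A $$ (j, k) * of_real (\<tau> k))"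
      using D by (simp add: \<rho>_def \<tau>_def D_def diff_divide_distrib right_diff_distrib mult_ac)
    finally show ?thesis by (simp only: diff_eq_eq)
  qed
  show ?thesis
  proof (rule singular_value_le[where g = g])
    show "\<delta>\<^sup>2 * spectral_norm A \<ge> 0" using spectral_norm_nonneg by simp
    fix v :: "complex vec"
    assume v: "v \<in> carrier_vec (dim_col A)" and g: "\<And>i. i < N \<Longrightarrow> (\<Sum>k<dim_col A. g i k * v $ k) = 0"
    \<comment> \<open>On the kernel of the \<open>g i\<close>, applying \<open>A\<close> to
      \<open>v\<close> is the same as scaling by \<tau>, applying \<open>A\<close> and scaling by
      \<rho>.\<close>
    define v' where "v' = vec (dim_col A) (\<lambda>k. of_real (\<tau> k) * v $ k)"
    have v': "v' \<in> carrier_vec (dim_col A)" by (simp add: v'_def)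
    have "(A *\<^sub>v v) $ j = of_real (\<rho> j) * (A *\<^sub>v v') $ j" if j: "j < dim_row A" for j
    proof -
      have "(A *\<^sub>v v) $ j = (\<Sum>k<dim_col A. ((\<Sum>i<N. f i j * g i k) + of_real (\<rho> j) * (A $$ (j, k) * of_real (\<tau> k))) * v $ k)"
        using j v by (subst mult_mat_vec_index) (auto intro!: sum.cong simp: entry[symmetric])
      also have "\<dots> = (\<Sum>k<dim_col A. \<Sum>i<N. f i j * (g i k * v $ k)) + of_real (\<rho> j) * (\<Sum>k<dim_col A. A $$ (j, k) * (of_real (\<tau> k) * v $ k))"
        unfolding distrib_right sum.distrib by (simp add: sum_distrib_left sum_distrib_right mult_ac)
      also have "(\<Sum>k<dim_col A. \<Sum>i<N. f i j * (g i k * v $ k)) = 0"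
        by (subst sum.swap) (simp add: g flip: sum_distrib_left)
      also have "(\<Sum>k<dim_col A. A $$ (j, k) * (of_real (\<tau> k) * v $ k)) = (A *\<^sub>v v') $ j"
        using j by (subst mult_mat_vec_index) (auto simp: v'_def)
      finally show ?thesis by simp
    qed
    then have "vec_norm2 (A *\<^sub>v v) \<le> \<delta> * vec_norm2 (A *\<^sub>v v')"
      using \<delta> \<rho>(2) by (intro vec_norm2_mono) (auto simp: norm_mult mult_right_mono simp del: index_mult_mat_vec)
    also have "\<dots> \<le> \<delta> * (spectral_norm A * vec_norm2 v')"
      using \<delta> by (intro mult_left_mono vec_norm2_mult_le_spectral_norm v')
    also have "\<dots> \<le> \<delta> * (spectral_norm A * (\<delta> * vec_norm2 v))"
    proof -
      have "vec_norm2 v' \<le> \<delta> * vec_norm2 v"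
        using \<delta> \<tau>(2) v by (intro vec_norm2_mono) (auto simp: v'_def norm_mult mult_right_mono)
      then show ?thesis using \<delta> spectral_norm_nonneg by (intro mult_left_mono)
    qed
    finally show "vec_norm2 (A *\<^sub>v v) \<le> \<delta>\<^sup>2 * spectral_norm A * vec_norm2 v"
      by (simp add: power2_eq_square mult_ac)
  qed
qed

section \<open>The rank and the entries of submatrices\<close>

lemma eps_rank_le:
  "singular_value A (N + 1) \<le> \<epsilon> * spectral_norm A \<Longrightarrow> eps_rank \<epsilon> A \<le> N"
  unfolding eps_rank_def by (rule Least_le)

lemma pick_in:
  assumes "i < card {a. a < m \<and> a \<in> I}"
  shows "pick I i < m" "pick I i \<in> I"
proof -
  have "pick {a. a < m \<and> a \<in> I} i \<in> {a. a < m \<and> a \<in> I}"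
    using assms by (rule pick_in_set_le)
  then show "pick I i < m" "pick I i \<in> I"
    unfolding pick_reduce_set[OF assms, symmetric] by auto
qed

lemma submatrix_entries:
  fixes A :: "'a mat"
  obtains f g where "\<And>j. j < dim_row (submatrix A I L) \<Longrightarrow> f j < dim_row A \<and> f j \<in> I"
    "\<And>k. k < dim_col (submatrix A I L) \<Longrightarrow> g k < dim_col A \<and> g k \<in> L"
    "\<And>j k. j < dim_row (submatrix A I L) \<Longrightarrow> k < dim_col (submatrix A I L) \<Longrightarrow>
       submatrix A I L $$ (j, k) = A $$ (f j, g k)"
proof (rule that[of "pick I" "pick L"])
  show "pick I j < dim_row A \<and> pick I j \<in> I" if "j < dim_row (submatrix A I L)" for j
    using pick_in[of j "dim_row A" I] that unfolding dim_submatrix by blast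
  show "pick L k < dim_col A \<and> pick L k \<in> L" if "k < dim_col (submatrix A I L)" for k
    using pick_in[of k "dim_col A" L] that unfolding dim_submatrix by blast
  show "submatrix A I L $$ (j, k) = A $$ (pick I j, pick L k)"
    if "j < dim_row (submatrix A I L)" "k < dim_col (submatrix A I L)" for j k
    using that unfolding dim_submatrix by (rule submatrix_index)
qed

text \<open>Index maps treat a block and any submatrix of it alike. They are 0-based, hence the
  \<open>+ 1\<close> in the membership conditions.\<close>

lemma block_entries:
  assumes "A = block X J K \<or> (\<exists>I L. A = submatrix (block X J K) I L)"
  obtains f g where "\<And>j. j < dim_row A \<Longrightarrow> f j < dim_row X \<and> f j + 1 \<in> J"
    "\<And>k. k < dim_col A \<Longrightarrow> g k < dim_col X \<and> g k + 1 \<in> K"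
    "\<And>j k. j < dim_row A \<Longrightarrow> k < dim_col A \<Longrightarrow> A $$ (j, k) = X $$ (f j, g k)"
proof -
  obtain f1 g1 where E: "\<And>j. j < dim_row (block X J K) \<Longrightarrow> f1 j < dim_row X \<and> f1 j + 1 \<in> J"
    "\<And>k. k < dim_col (block X J K) \<Longrightarrow> g1 k < dim_col X \<and> g1 k + 1 \<in> K"
    "\<And>j k. j < dim_row (block X J K) \<Longrightarrow> k < dim_col (block X J K) \<Longrightarrow> block X J K $$ (j, k) = X $$ (f1 j, g1 k)"
    unfolding block_def by (rule submatrix_entries[of X "{i. i + 1 \<in> J}" "{k. k + 1 \<in> K}"]) auto
  from assms consider "A = block X J K" | I L where "A = submatrix (block X J K) I L" by blast
  then show thesis
  proof cases
    case 1
    then show thesis using E that[of f1 g1] by simp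
  next
    case (2 I L)
    obtain f g where "\<And>j. j < dim_row A \<Longrightarrow> f j < dim_row (block X J K) \<and> f j \<in> I"
      "\<And>k. k < dim_col A \<Longrightarrow> g k < dim_col (block X J K) \<and> g k \<in> L"
      "\<And>j k. j < dim_row A \<Longrightarrow> k < dim_col A \<Longrightarrow> A $$ (j, k) = block X J K $$ (f j, g k)"
      unfolding 2 by (rule submatrix_entries[of "block X J K" I L]) auto
    then show thesis using E that[of "f1 \<circ> f" "g1 \<circ> g"] by simp
  qed
qed

section \<open>The matrix and its arcs\<close>

lemma node_cis: "node p j = cis (- 2 * pi * p j)"
  unfolding node_def cis_conv_exp by (simp add: mult_ac)

text \<open>The entry is a geometric series in
  \<open>\<zeta> = \<gamma> * cis (- 2 * \<phi>)\<close> with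
  \<open>\<zeta> ^ n = \<gamma> ^ n\<close>. In half angles \<open>1 - \<zeta>\<close> is a sine
  times a phase, and the phase of the column cancels, so the right side depends on the row
  alone.\<close>

lemma C_mat_displacement:
  assumes "j < m" "k < n" and \<theta>: "cis (2 * \<theta>) = node p (j + 1)"
  shows "C_mat m n p $$ (j, k) * of_real (sin (\<theta> - pi * real (k + 1) / real n)) =
     \<i> / 2 * (1 - node p (j + 1) ^ n) * cis (- \<theta>) / of_real (sqrt (real n))"
proof -
  define \<phi> where "\<phi> = pi * real (k + 1) / real n"
  define \<gamma> where "\<gamma> = node p (j + 1)"
  have n: "n > 0" using assms by auto
  have om: "omega n ^ l = cis (pi * real l / real n)" for l
  proof -
    have "omega n = cis (pi / real n)" unfolding omega_def cis_conv_exp by (simp add: mult_ac)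
    then show ?thesis by (simp add: Complex.DeMoivre mult_ac)
  qed
  have F: "mat_adjoint (fourier_mat n) $$ (l, k) = cis (- \<phi>) * cis (- 2 * \<phi>) ^ l / of_real (sqrt (real n))" if "l < n" for l
  proof -
    have "mat_adjoint (fourier_mat n) $$ (l, k) = cnj (fourier_mat n $$ (k, l))"
      using that assms by (intro mat_adjoint_index) (auto simp: fourier_mat_def)
    also have "fourier_mat n $$ (k, l) = omega n ^ ((k + 1) * (2 * l + 1)) / of_real (sqrt (real n))"
      using that assms by (simp add: fourier_mat_def)
    also have "cnj \<dots> = cis (- (pi * real ((k + 1) * (2 * l + 1)) / real n)) / of_real (sqrt (real n))"
      unfolding om by (simp add: cis_cnj)
    also have "- (pi * real ((k + 1) * (2 * l + 1)) / real n) = - \<phi> + real l * (- 2 * \<phi>)"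
      using n unfolding \<phi>_def by (simp add: field_simps)
    finally show ?thesis by (simp add: Complex.DeMoivre cis_mult)
  qed
  define \<zeta> where "\<zeta> = cis (2 * (\<theta> - \<phi>))"
  have \<zeta>: "\<gamma> * cis (- 2 * \<phi>) = \<zeta>"
    unfolding \<gamma>_def \<theta>[symmetric] \<zeta>_def by (simp add: cis_mult algebra_simps)
  have "C_mat m n p $$ (j, k) = (\<Sum>l<n. vandermonde m n (node p) $$ (j, l) * mat_adjoint (fourier_mat n) $$ (l, k))"
    unfolding C_mat_def using assms by (subst mult_mat_index) (auto simp: vandermonde_def fourier_mat_def)
  also have "\<dots> = (\<Sum>l<n. cis (- \<phi>) / of_real (sqrt (real n)) * \<zeta> ^ l)"
  proof (intro sum.cong refl)
    fix l assume "l \<in> {..<n}"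
    then have "vandermonde m n (node p) $$ (j, l) = \<gamma> ^ l"
      using assms by (simp add: vandermonde_def \<gamma>_def)
    then show "vandermonde m n (node p) $$ (j, l) * mat_adjoint (fourier_mat n) $$ (l, k) = cis (- \<phi>) / of_real (sqrt (real n)) * \<zeta> ^ l"
      using F[of l] \<open>l \<in> {..<n}\<close> by (simp add: \<zeta>[symmetric] power_mult_distrib)
  qed
  finally have Ce: "C_mat m n p $$ (j, k) = cis (- \<phi>) / of_real (sqrt (real n)) * (\<Sum>l<n. \<zeta> ^ l)"
    by (simp add: sum_distrib_left)
  have "cis (- 2 * \<phi>) ^ n = 1"
  proof -
    have "real n * (- 2 * \<phi>) = 2 * pi * of_int (- int (k + 1))"
    proof -
      have "real n * \<phi> = pi * real (k + 1)" using n by (simp add: \<phi>_def)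
      then have "- 2 * (real n * \<phi>) = 2 * pi * of_int (- int (k + 1))" by (simp add: algebra_simps)
      then show ?thesis by (simp add: mult_ac)
    qed
    then show ?thesis by (simp only: Complex.DeMoivre cis_multiple_2pi Ints_of_int)
  qed
  then have \<zeta>n: "\<zeta> ^ n = \<gamma> ^ n" unfolding \<zeta>[symmetric] power_mult_distrib by simp
  have geo: "(1 - \<zeta>) * (\<Sum>l<n. \<zeta> ^ l) = 1 - \<gamma> ^ n"
    using one_diff_power_eq[of \<zeta> n] \<zeta>n by simp
  have z1: "1 - \<zeta> = - (2 * \<i> * of_real (sin (\<theta> - \<phi>)) * cis (\<theta> - \<phi>))"
    unfolding \<zeta>_def by (rule one_minus_cis)
  have "cis (- \<phi>) = cis (\<theta> - \<phi>) * cis (- \<theta>)" by (simp add: cis_mult)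
  then have "C_mat m n p $$ (j, k) * of_real (sin (\<theta> - \<phi>)) =
     \<i> / 2 * ((- (2 * \<i> * of_real (sin (\<theta> - \<phi>)) * cis (\<theta> - \<phi>))) * (\<Sum>l<n. \<zeta> ^ l)) * cis (- \<theta>) / of_real (sqrt (real n))"
    unfolding Ce by (simp add: algebra_simps)
  then show ?thesis
    unfolding z1[symmetric] geo unfolding \<gamma>_def \<phi>_def .
qed

section \<open>Separation of arcs and choice of parameters\<close>

text \<open>On \<open>[0, pi / 2]\<close> the sine is concave and lies above its chord.\<close>

lemma sin_half_pi_ge:
  assumes "n \<ge> 1"
  shows "1 / real n \<le> sin (pi / (2 * real n))"
proof -
  have "concave_on {0..pi / 2} sin"
    by (rule f''_le0_imp_concave[where f' = cos and f'' = "\<lambda>x. - sin x"])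
       (auto intro!: derivative_eq_intros sin_ge_zero)
  then have "sin ((1 - t) *\<^sub>R 0 + t *\<^sub>R (pi / 2)) \<ge> (1 - t) * sin 0 + t * sin (pi / 2)" if "0 \<le> t" "t \<le> 1" for t
    using that by (intro concave_onD) auto
  from this[of "1 / real n"] show ?thesis using assms by (simp add: mult.commute)
qed

lemma arc_range:
  fixes M n :: nat
  assumes M: "M < n"
  shows "0 \<le> pi * real M / (2 * real n)" "pi * real M / (2 * real n) < pi / 2"
    "0 < pi * (real M + 1) / (2 * real n)" "pi * (real M + 1) / (2 * real n) \<le> pi / 2"
proof -
  have e: "pi * real M / (2 * real n) = pi / 2 * (real M / real n)"
    "pi * (real M + 1) / (2 * real n) = pi / 2 * ((real M + 1) / real n)"
    by simp_all
  have "real M / real n < 1" "(real M + 1) / real n \<le> 1" using M by simp_all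
  then have "pi / 2 * (real M / real n) < pi / 2 * 1" "pi / 2 * ((real M + 1) / real n) \<le> pi / 2 * 1"
    by (intro mult_strict_left_mono mult_left_mono; simp)+
  then show "pi * real M / (2 * real n) < pi / 2" "pi * (real M + 1) / (2 * real n) \<le> pi / 2"
    unfolding e by simp_all
  show "0 \<le> pi * real M / (2 * real n)" "0 < pi * (real M + 1) / (2 * real n)"
    using M by (simp_all add: zero_less_mult_iff add_pos_pos)
qed

text \<open>In half angles the two arcs end at \<alpha> and \<beta>. A scale \<mu> with
  \<open>tan \<alpha> \<le> c * \<mu>\<close> and \<open>\<mu> \<le> c * tan \<beta>\<close> exists
  when \<open>tan \<alpha> \<le> c\<^sup>2 * tan \<beta>\<close>, and the gap
  \<open>pi / (2 * n)\<close> ensures this.\<close>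

lemma arc_separation:
  fixes M n :: nat and c :: real
  defines "\<alpha> \<equiv> pi * real M / (2 * real n)" and "\<beta> \<equiv> pi * (real M + 1) / (2 * real n)"
  assumes M: "M < n" and c: "0 < c" "c < 1" and y: "(1 - c\<^sup>2) / (1 + c\<^sup>2) \<le> 1 / real n"
  obtains \<mu> where "\<mu> > 0" "sin \<alpha> \<le> c * (\<mu> * cos \<alpha>)" "\<mu> * cos \<beta> \<le> c * sin \<beta>"
proof -
  have n: "n \<ge> 1" using M by auto
  have ab: "\<beta> - \<alpha> = pi / (2 * real n)" using n by (simp add: \<alpha>_def \<beta>_def field_simps)
  have ran: "0 \<le> \<alpha>" "\<alpha> < pi / 2" "0 < \<beta>" "\<beta> \<le> pi / 2"
    unfolding \<alpha>_def \<beta>_def by (rule arc_range[OF M])+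
  have cosa: "cos \<alpha> > 0" using ran by (intro cos_gt_zero_pi) auto
  have sinb: "sin \<beta> > 0" using ran by (intro sin_gt_zero) auto
  have cosb: "cos \<beta> \<ge> 0" using ran by (intro cos_ge_zero) auto
  \<comment> \<open>Equivalent to \<open>sin (\<alpha> + \<beta>) * (1 - c\<^sup>2) \<le> sin
    (\<beta> - \<alpha>) * (1 + c\<^sup>2)\<close>; the first sine is at most \<open>1\<close>, the
    second at least \<open>1 / n\<close>.\<close>
  have key: "sin \<alpha> * cos \<beta> \<le> c\<^sup>2 * (cos \<alpha> * sin \<beta>)"
  proof -
    have D: "sin (\<beta> - \<alpha>) \<ge> (1 - c\<^sup>2) / (1 + c\<^sup>2)"
      using y sin_half_pi_ge[OF n] unfolding ab by linarith
    have "1 + c\<^sup>2 > 0" by (intro add_pos_nonneg) auto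
    then have "1 - c\<^sup>2 \<le> sin (\<beta> - \<alpha>) * (1 + c\<^sup>2)"
      using D by (simp add: divide_le_eq)
    moreover have "sin (\<alpha> + \<beta>) * (1 - c\<^sup>2) \<le> 1 - c\<^sup>2"
      using mult_right_mono[of "sin (\<alpha> + \<beta>)" 1 "1 - c\<^sup>2"] c by (simp add: power_le_one)
    ultimately have "sin (\<alpha> + \<beta>) * (1 - c\<^sup>2) \<le> sin (\<beta> - \<alpha>) * (1 + c\<^sup>2)" by (rule order_trans[rotated])
    then show ?thesis by (simp add: sin_add sin_diff algebra_simps)
  qed
  show thesis
  \<comment> \<open>The natural choice \<open>tan \<alpha> / c\<close> is zero for
    \<open>M = 0\<close>, where a positive scale is taken from \<beta> instead.\<close>
  proof (cases "M = 0")
    case True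
    have "c * sin \<beta> * cos \<beta> \<le> c * sin \<beta> * 1"
      using c sinb by (intro mult_left_mono) auto
    then show thesis
      using that[of "c * sin \<beta>"] c sinb cosa True by (simp add: \<alpha>_def)
  next
    case False
    then have "sin \<alpha> > 0" using ran M by (intro sin_gt_zero) (auto simp: \<alpha>_def)
    then show thesis
      using that[of "sin \<alpha> / (c * cos \<alpha>)"] c cosa key by (simp add: field_simps power2_eq_square)
  qed
qed

lemma near_arc:
  fixes \<psi> \<alpha> :: real
  assumes "\<bar>\<psi>\<bar> \<le> \<alpha>" "\<alpha> < pi / 2"
  shows "cos \<psi> \<noteq> 0" "\<bar>sin \<psi>\<bar> \<le> sin \<alpha>" "cos \<alpha> \<le> \<bar>cos \<psi>\<bar>"
proof -
  have "cos \<alpha> \<le> cos \<bar>\<psi>\<bar>" using assms by (intro cos_monotone_0_pi_le) auto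
  moreover have "cos \<alpha> > 0" using assms by (intro cos_gt_zero_pi) auto
  ultimately show "cos \<psi> \<noteq> 0" "cos \<alpha> \<le> \<bar>cos \<psi>\<bar>" by (auto simp: cos_abs_real)
  have "sin \<bar>\<psi>\<bar> \<le> sin \<alpha>" using assms by (intro sin_monotone_2pi_le) auto
  moreover have "sin \<bar>\<psi>\<bar> \<ge> 0" using assms by (intro sin_ge_zero) auto
  ultimately show "\<bar>sin \<psi>\<bar> \<le> sin \<alpha>" by (auto simp: abs_if split: if_splits)
qed

lemma far_arc:
  fixes \<psi> \<beta> :: real
  assumes "\<beta> \<le> \<bar>\<psi>\<bar>" "\<bar>\<psi>\<bar> \<le> pi - \<beta>" "0 < \<beta>" "\<beta> \<le> pi / 2"
  shows "sin \<psi> \<noteq> 0" "sin \<beta> \<le> \<bar>sin \<psi>\<bar>" "\<bar>cos \<psi>\<bar> \<le> cos \<beta>"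
proof -
  have "cos \<bar>\<psi>\<bar> \<le> cos \<beta>" using assms by (intro cos_monotone_0_pi_le) auto
  moreover have "cos (pi - \<beta>) \<le> cos \<bar>\<psi>\<bar>" using assms by (intro cos_monotone_0_pi_le) auto
  ultimately show c: "\<bar>cos \<psi>\<bar> \<le> cos \<beta>" by (auto simp: cos_abs_real cos_pi_minus)
  then have "(cos \<psi>)\<^sup>2 \<le> (cos \<beta>)\<^sup>2" by (metis abs_ge_zero power2_abs power_mono)
  then have "(sin \<beta>)\<^sup>2 \<le> (sin \<psi>)\<^sup>2" by (simp add: sin_squared_eq)
  then have s: "\<bar>sin \<beta>\<bar> \<le> \<bar>sin \<psi>\<bar>" by (simp add: abs_le_square_iff)
  moreover have "sin \<beta> > 0" using assms by (intro sin_gt_zero) auto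
  ultimately show "sin \<psi> \<noteq> 0" "sin \<beta> \<le> \<bar>sin \<psi>\<bar>" by auto
qed

text \<open>Stated with sine and cosine instead of the tangent because the far arc contains half
  angles with vanishing cosine.\<close>

lemma arc_separation_bounds:
  fixes M n :: nat and c :: real
  assumes M: "M < n" and c: "0 < c" "c < 1" and y: "(1 - c\<^sup>2) / (1 + c\<^sup>2) \<le> 1 / real n"
  obtains \<mu> where "\<mu> > 0"
    "\<And>\<psi>. \<bar>\<psi>\<bar> \<le> pi / (2 * real n) * real M \<Longrightarrow> \<mu> * cos \<psi> \<noteq> 0 \<and> \<bar>sin \<psi>\<bar> \<le> c * \<bar>\<mu> * cos \<psi>\<bar>"
    "\<And>\<psi>. pi / (2 * real n) * (real M + 1) \<le> \<bar>\<psi>\<bar> \<Longrightarrow> \<bar>\<psi>\<bar> \<le> pi - pi / (2 * real n) * (real M + 1) \<Longrightarrow>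
       sin \<psi> \<noteq> 0 \<and> \<bar>\<mu> * cos \<psi>\<bar> \<le> c * \<bar>sin \<psi>\<bar>"
proof -
  define \<alpha> where "\<alpha> = pi * real M / (2 * real n)"
  define \<beta> where "\<beta> = pi * (real M + 1) / (2 * real n)"
  obtain \<mu> where \<mu>: "\<mu> > 0" "sin \<alpha> \<le> c * (\<mu> * cos \<alpha>)" "\<mu> * cos \<beta> \<le> c * sin \<beta>"
    using arc_separation[OF M c y] unfolding \<alpha>_def \<beta>_def by blast
  have ran: "\<alpha> < pi / 2" "0 < \<beta>" "\<beta> \<le> pi / 2"
    using arc_range[OF M] unfolding \<alpha>_def \<beta>_def by blast+
  show thesis
  proof (rule that[OF \<mu>(1)])
    fix \<psi> :: real assume "\<bar>\<psi>\<bar> \<le> pi / (2 * real n) * real M"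
    then have "\<bar>\<psi>\<bar> \<le> \<alpha>" by (simp add: \<alpha>_def)
    note near = near_arc[OF this ran(1)]
    have "\<bar>sin \<psi>\<bar> \<le> c * (\<mu> * cos \<alpha>)" using near(2) \<mu>(2) by linarith
    also have "\<dots> \<le> c * (\<mu> * \<bar>cos \<psi>\<bar>)" using c \<mu>(1) near(3) by (intro mult_left_mono) auto
    finally show "\<mu> * cos \<psi> \<noteq> 0 \<and> \<bar>sin \<psi>\<bar> \<le> c * \<bar>\<mu> * cos \<psi>\<bar>"
      using near(1) \<mu>(1) by (simp add: abs_mult)
  next
    fix \<psi> :: real
    assume "pi / (2 * real n) * (real M + 1) \<le> \<bar>\<psi>\<bar>" "\<bar>\<psi>\<bar> \<le> pi - pi / (2 * real n) * (real M + 1)"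
    then have "\<beta> \<le> \<bar>\<psi>\<bar>" "\<bar>\<psi>\<bar> \<le> pi - \<beta>" by (simp_all add: \<beta>_def)
    note far = far_arc[OF this ran(2,3)]
    have "\<mu> * \<bar>cos \<psi>\<bar> \<le> \<mu> * cos \<beta>" using \<mu>(1) far(3) by (intro mult_left_mono) auto
    also have "\<dots> \<le> c * sin \<beta>" by (rule \<mu>(3))
    also have "\<dots> \<le> c * \<bar>sin \<psi>\<bar>" using c far(2) by (intro mult_left_mono) auto
    finally show "sin \<psi> \<noteq> 0 \<and> \<bar>\<mu> * cos \<psi>\<bar> \<le> c * \<bar>sin \<psi>\<bar>"
      using far(1) \<mu>(1) by (simp add: abs_mult)
  qed
qed

text \<open>\<open>h\<close> is chosen so that
  \<open>4 * exp (- pi\<^sup>2 / (2 * h)) = 1 / n\<close>, which is the separation required of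
  \<open>c = jsn r (pi / 2)\<close>. With \<open>\<delta> = 2 * r ^ N\<close> one has
  \<open>\<delta>\<^sup>2 = 4 * exp (- N * h)\<close>, and the condition on \<open>N\<close> says
  exactly that this is at most \<epsilon>.\<close>

lemma blaschke_parameters:
  assumes "n \<ge> 1" and \<epsilon>: "0 < \<epsilon>" "\<epsilon> < 1"
    and N: "2 * ln (4 / \<epsilon>) * ln (4 * real n) / pi\<^sup>2 \<le> real N"
  obtains a :: "nat \<Rightarrow> real" and c \<delta> where "\<And>i. \<bar>a i\<bar> < 1" "0 < c" "c < 1" "0 \<le> \<delta>" "\<delta>\<^sup>2 \<le> \<epsilon>"
    "(1 - c\<^sup>2) / (1 + c\<^sup>2) \<le> 1 / real n"
    "\<And>x. \<bar>x\<bar> \<le> c \<Longrightarrow> (\<Prod>i<N. \<bar>x - a i\<bar>) \<le> \<delta> * (\<Prod>i<N. \<bar>1 - a i * x\<bar>)"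
proof -
  define h where "h = pi\<^sup>2 / (2 * ln (4 * real n))"
  define r where "r = exp (- h / 2)"
  have l: "ln (4 * real n) > 0" "ln (4 / \<epsilon>) > 0" using assms by auto
  have h: "h > 0" using l by (simp add: h_def)
  have r: "0 < r" "r < 1" using h by (auto simp: r_def)
  have "N > 0"
  proof (rule ccontr)
    assume "\<not> N > 0"
    then have "2 * ln (4 / \<epsilon>) * ln (4 * real n) / pi\<^sup>2 \<le> 0" using N by simp
    moreover have "2 * ln (4 / \<epsilon>) * ln (4 * real n) / pi\<^sup>2 > 0" using l by simp
    ultimately show False by linarith
  qed
  obtain a where a: "\<And>j. \<bar>a j\<bar> < 1"
    "\<And>x. \<bar>x\<bar> \<le> jsn r (pi / 2) \<Longrightarrow> (\<Prod>j<N. \<bar>x - a j\<bar>) \<le> 2 * r ^ N * (\<Prod>j<N. \<bar>1 - a j * x\<bar>)"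
    using blaschke_product_small[OF r \<open>N > 0\<close>] by metis
  have "compl_ratio r \<le> 4 * exp (- pi\<^sup>2 / (2 * h))"
    unfolding r_def by (rule compl_ratio_le[OF h])
  also have "- pi\<^sup>2 / (2 * h) = - ln (4 * real n)"
    using l by (simp add: h_def)
  also have "4 * exp (- ln (4 * real n)) = 1 / real n"
    using assms by (simp add: exp_minus field_simps)
  finally have y: "(1 - (jsn r (pi / 2))\<^sup>2) / (1 + (jsn r (pi / 2))\<^sup>2) \<le> 1 / real n"
    unfolding compl_ratio_def .
  have "(2 * r ^ N)\<^sup>2 = 4 * exp (- (real N * h))"
    unfolding r_def by (simp add: power_mult_distrib power2_eq_square flip: exp_of_nat_mult exp_add)
  also have "\<dots> \<le> 4 * exp (- ln (4 / \<epsilon>))"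
  proof -
    have "2 * ln (4 / \<epsilon>) * ln (4 * real n) \<le> real N * pi\<^sup>2"
      using N by (simp add: divide_le_eq)
    then have "ln (4 / \<epsilon>) \<le> real N * h"
      using l by (simp add: h_def field_simps)
    then show ?thesis by simp
  qed
  also have "\<dots> = \<epsilon>" using \<epsilon> by (simp add: exp_minus)
  finally have "(2 * r ^ N)\<^sup>2 \<le> \<epsilon>" .
  moreover have "0 < jsn r (pi / 2)" "jsn r (pi / 2) < 1"
    using jsn_half_pi_pos[OF r] abs_jsn_less_1[OF r, of "pi / 2"] by auto
  ultimately show thesis
    using that[of a "jsn r (pi / 2)" "2 * r ^ N"] a y r by simp
qed

section \<open>Half angles of the row nodes and the column nodes\<close>

text \<open>The clusters extend half a step beyond the outer columns, so the half width, measured in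
  steps, is \<open>(\<kappa>2 - \<kappa>1 + 1) / 2\<close>.\<close>

lemma node_in_row_set:
  assumes "j \<in> row_set m n p {\<kappa>1..\<kappa>2}"
  obtains \<theta> where "cis (2 * \<theta>) = node p j" "\<bar>\<theta> - pi * (real \<kappa>1 + real \<kappa>2) / (2 * real n)\<bar> \<le> pi * (real \<kappa>2 - real \<kappa>1 + 1) / (2 * real n)"
proof -
  obtain \<kappa> t where \<kappa>: "\<kappa> \<in> {\<kappa>1..\<kappa>2}" "real \<kappa> - 1/2 < t" "t \<le> real \<kappa> + 1/2"
    and t: "node p j = exp (2 * of_real pi * \<i> * of_real t / of_nat n)"
    using assms unfolding row_set_def cluster_def by auto
  have "cis (2 * (pi * t / real n)) = node p j"
    unfolding t cis_conv_exp by (simp add: mult_ac)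
  moreover have "\<bar>t - (real \<kappa>1 + real \<kappa>2) / 2\<bar> \<le> (real \<kappa>2 - real \<kappa>1 + 1) / 2"
  proof -
    have "real \<kappa>1 \<le> real \<kappa>" "real \<kappa> \<le> real \<kappa>2" using \<kappa>(1) by auto
    then show ?thesis using \<kappa>(2,3) unfolding abs_le_iff by (simp add: field_simps)
  qed
  then have "pi / real n * \<bar>t - (real \<kappa>1 + real \<kappa>2) / 2\<bar> \<le> pi / real n * ((real \<kappa>2 - real \<kappa>1 + 1) / 2)"
    by (intro mult_left_mono) auto
  then have "\<bar>pi * t / real n - pi * (real \<kappa>1 + real \<kappa>2) / (2 * real n)\<bar> \<le> pi * (real \<kappa>2 - real \<kappa>1 + 1) / (2 * real n)"
  proof -
    have "pi * t / real n - pi * (real \<kappa>1 + real \<kappa>2) / (2 * real n) = pi / real n * (t - (real \<kappa>1 + real \<kappa>2) / 2)"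
      by (simp add: right_diff_distrib mult_ac)
    then have "\<bar>pi * t / real n - pi * (real \<kappa>1 + real \<kappa>2) / (2 * real n)\<bar> = pi / real n * \<bar>t - (real \<kappa>1 + real \<kappa>2) / 2\<bar>"
      by (simp add: abs_mult)
    then show ?thesis
      using \<open>pi / real n * \<bar>_\<bar> \<le> _\<close> by (simp add: mult_ac)
  qed
  ultimately show thesis using that by blast
qed

text \<open>Lift the node to a full period that starts where the first cluster starts. Its parameter
  must then lie beyond the end of the last cluster, and the length of the period bounds it on the
  other side.\<close>

lemma node_not_in_row_set:
  assumes n: "n \<ge> 1" and \<kappa>: "1 \<le> \<kappa>1" "\<kappa>1 \<le> \<kappa>2" "\<kappa>2 \<le> n"
    and j: "j \<in> {1..m} - row_set m n p {\<kappa>1..\<kappa>2}"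
  obtains \<theta> where "cis (2 * \<theta>) = node p j"
    "pi * (real \<kappa>2 - real \<kappa>1 + 1) / (2 * real n) \<le> \<bar>\<theta> - pi * (real \<kappa>1 + real \<kappa>2) / (2 * real n)\<bar>"
    "\<bar>\<theta> - pi * (real \<kappa>1 + real \<kappa>2) / (2 * real n)\<bar> \<le> pi - pi * (real \<kappa>2 - real \<kappa>1 + 1) / (2 * real n)"
proof -
  define s where "s = - real n * p j"
  \<comment> \<open>The ceiling minus one makes the period open on the left and closed on the right,
    like the clusters.\<close>
  define q where "q = \<lceil>(s - (real \<kappa>1 - 1/2)) / real n\<rceil> - 1"
  define t where "t = s - real n * of_int q"
  have q: "of_int q < (s - (real \<kappa>1 - 1/2)) / real n" "(s - (real \<kappa>1 - 1/2)) / real n \<le> of_int q + 1"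
    unfolding q_def by linarith+
  have t: "real \<kappa>1 - 1/2 < t" "t \<le> real \<kappa>1 - 1/2 + real n"
    using q n unfolding t_def by (auto simp: field_simps)
  have node: "node p j = cis (2 * (pi * t / real n))"
  proof -
    have "2 * (pi * t / real n) = - 2 * pi * p j + 2 * pi * of_int (- q)"
      using n unfolding t_def s_def by (simp add: field_simps)
    then have "cis (2 * (pi * t / real n)) = cis (- 2 * pi * p j) * cis (2 * pi * of_int (- q))"
      by (simp only: cis_mult)
    also have "cis (2 * pi * of_int (- q)) = 1" by (rule cis_multiple_2pi) simp
    finally show ?thesis by (simp add: node_cis)
  qed
  have "t > real \<kappa>2 + 1/2"
  proof (rule ccontr)
    assume neg: "\<not> t > real \<kappa>2 + 1/2"
    \<comment> \<open>The index of the cluster that contains \<open>t\<close>, by the same half-open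
      convention.\<close>
    define k where "k = nat \<lceil>t - 1/2\<rceil>"
    have "\<lceil>t - 1/2\<rceil> \<ge> int \<kappa>1" "\<lceil>t - 1/2\<rceil> \<le> int \<kappa>2" using t(1) neg by linarith+
    moreover have "nat z \<in> {\<kappa>1..\<kappa>2} \<and> real (nat z) = of_int z" if "int \<kappa>1 \<le> z" "z \<le> int \<kappa>2" for z
      using that by auto
    ultimately have k: "k \<in> {\<kappa>1..\<kappa>2}" and rk: "real k = of_int \<lceil>t - 1/2\<rceil>"
      unfolding k_def by blast+
    have "real k - 1/2 < t" "t \<le> real k + 1/2" unfolding rk by linarith+
    moreover have "node p j = exp (2 * of_real pi * \<i> * of_real t / of_nat n)"
      unfolding node cis_conv_exp by (simp add: mult_ac)
    ultimately have "j \<in> cluster m n p k"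
      using j unfolding cluster_def by auto
    then show False using j k unfolding row_set_def by blast
  qed
  define d where "d = t - (real \<kappa>1 + real \<kappa>2) / 2"
  have d: "(real \<kappa>2 - real \<kappa>1 + 1) / 2 \<le> d" "d \<le> real n - (real \<kappa>2 - real \<kappa>1 + 1) / 2"
    using t \<open>t > real \<kappa>2 + 1/2\<close> unfolding d_def by (auto simp: field_simps)
  have d0: "d \<ge> 0" using d(1) \<kappa> by simp
  have e: "pi * t / real n - pi * (real \<kappa>1 + real \<kappa>2) / (2 * real n) = pi / real n * d"
    by (simp add: d_def right_diff_distrib mult_ac)
  have abs: "\<bar>pi * t / real n - pi * (real \<kappa>1 + real \<kappa>2) / (2 * real n)\<bar> = pi / real n * d"
    unfolding e using d0 by (simp add: abs_mult)
  have "pi / real n * ((real \<kappa>2 - real \<kappa>1 + 1) / 2) \<le> pi / real n * d"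
    using d(1) by (intro mult_left_mono) auto
  moreover have "pi / real n * d \<le> pi / real n * (real n - (real \<kappa>2 - real \<kappa>1 + 1) / 2)"
    using d(2) by (intro mult_left_mono) auto
  moreover have "pi / real n * (real n - (real \<kappa>2 - real \<kappa>1 + 1) / 2) = pi - pi * (real \<kappa>2 - real \<kappa>1 + 1) / (2 * real n)"
    using n by (simp add: right_diff_distrib mult_ac)
  ultimately show thesis
    using that[OF node[symmetric]] unfolding abs by (simp add: mult_ac)
qed

lemma abs_angle_diff:
  "\<bar>pi * x / real n - pi * y / (2 * real n)\<bar> = pi / (2 * real n) * \<bar>2 * x - y\<bar>"
proof -
  have "pi * x / real n - pi * y / (2 * real n) = pi / (2 * real n) * (2 * x - y)"
    by (cases "n = 0") (simp_all add: field_simps)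
  then show ?thesis by (simp add: abs_mult)
qed

lemma midpoint_dist_inside:
  fixes x y z :: real
  assumes "y \<le> x" "x \<le> z"
  shows "\<bar>2 * x - (y + z)\<bar> \<le> z - y"
  using assms by (simp add: abs_le_iff)

text \<open>Distances are doubled to avoid half-integral midpoints. The second bound is the distance
  measured the other way round the circle.\<close>

lemma midpoint_dist_outside:
  fixes n x y z :: real
  assumes "1 \<le> x" "x \<le> n" "x + 1 \<le> y \<or> z + 1 \<le> x" "1 \<le> y" "y \<le> z" "z \<le> n"
  shows "z - y + 1 + 1 \<le> \<bar>2 * x - (y + z)\<bar>" "\<bar>2 * x - (y + z)\<bar> \<le> 2 * n - (z - y + 1 + 1)"
  using assms by (auto simp: abs_if)

section \<open>The bound for HSS columns and rows\<close>

theorem theorem3p2: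
  fixes m n t :: nat and p :: "nat \<Rightarrow> real" and \<epsilon> :: real
    and T :: "nat set" and K :: "nat \<Rightarrow> nat set" and H A :: "complex mat"
  assumes "1 \<le> n" and "n \<le> m"
    and "0 \<le> p m" and "strict_antimono_on {1..m} p" and "p 1 < 1"
    and "cluster_tree n T K"
    and "0 < \<epsilon>" and "\<epsilon> < 1"
    and "t \<in> T"
    and "H = hss_col m n p (K t) \<or> H = hss_row m n p (K t)"
    and "A = H \<or> (\<exists>I L. A = submatrix H I L)"
  shows "int (eps_rank \<epsilon> A) \<le> \<lceil>2 * ln (4 / \<epsilon>) * ln (4 * real n) / pi\<^sup>2\<rceil>"
proof -
  define N where "N = nat \<lceil>2 * ln (4 / \<epsilon>) * ln (4 * real n) / pi\<^sup>2\<rceil>"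
  have "2 * ln (4 / \<epsilon>) * ln (4 * real n) / pi\<^sup>2 \<ge> 0"
    using assms(1,7,8) by simp
  then have intN: "int N = \<lceil>2 * ln (4 / \<epsilon>) * ln (4 * real n) / pi\<^sup>2\<rceil>"
    unfolding N_def by simp
  then have "2 * ln (4 / \<epsilon>) * ln (4 * real n) / pi\<^sup>2 \<le> real N"
    by (metis le_of_int_ceiling of_int_of_nat_eq)
  then obtain a c \<delta> where a: "\<And>i. \<bar>a i\<bar> < 1" and c: "0 < c" "c < 1" and \<delta>: "0 \<le> \<delta>" "\<delta>\<^sup>2 \<le> \<epsilon>"
    and y: "(1 - c\<^sup>2) / (1 + c\<^sup>2) \<le> 1 / real n"
    and bl: "\<And>x. \<bar>x\<bar> \<le> c \<Longrightarrow> (\<Prod>i<N. \<bar>x - a i\<bar>) \<le> \<delta> * (\<Prod>i<N. \<bar>1 - a i * x\<bar>)"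
    using blaschke_parameters[OF assms(1,7,8)] by metis
  obtain \<kappa>1 \<kappa>2 where \<kappa>: "1 \<le> \<kappa>1" "\<kappa>1 \<le> \<kappa>2" "\<kappa>2 \<le> n" and Kt: "K t = {\<kappa>1..\<kappa>2}"
    using assms(6,9) unfolding cluster_tree_def by metis
  define \<tau> where "\<tau> = pi * (real \<kappa>1 + real \<kappa>2) / (2 * real n)"
  define \<phi> where "\<phi> k = pi * real (k + 1) / real n" for k
  define u where "u j \<theta> = \<i> / 2 * (1 - node p (j + 1) ^ n) * cis (- \<theta>) / of_real (sqrt (real n))" for j \<theta>
  have disp: "C_mat m n p $$ (j, k) * of_real (sin (\<theta> - \<phi> k)) = u j \<theta>"
    if "j < m" "k < n" "cis (2 * \<theta>) = node p (j + 1)" for j k \<theta>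
    using C_mat_displacement[OF that] unfolding \<phi>_def u_def .
  have dimC: "dim_row (C_mat m n p) = m" "dim_col (C_mat m n p) = n"
    by (simp_all add: C_mat_def vandermonde_def fourier_mat_def)
  have "singular_value A (N + 1) \<le> \<epsilon> * spectral_norm A"
    using assms(10)
  proof
    assume H: "H = hss_col m n p (K t)"
    obtain f g where f: "\<And>j. j < dim_row A \<Longrightarrow> f j < m \<and> f j + 1 \<in> {1..m} - row_set m n p {\<kappa>1..\<kappa>2}"
      and g: "\<And>k. k < dim_col A \<Longrightarrow> g k < n \<and> g k + 1 \<in> {\<kappa>1..\<kappa>2}"
      and A: "\<And>j k. j < dim_row A \<Longrightarrow> k < dim_col A \<Longrightarrow> A $$ (j, k) = C_mat m n p $$ (f j, g k)"
      using assms(11) unfolding H hss_col_def Kt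
      by (rule block_entries) (auto simp: dimC)
    \<comment> \<open>The columns span \<open>\<kappa>2 - \<kappa>1\<close> steps and form the near
      arc; the excluded rows begin half a step further on each side.\<close>
    define M where "M = \<kappa>2 - \<kappa>1"
    have rM: "real M = real \<kappa>2 - real \<kappa>1" and Mn: "M < n" using \<kappa> by (auto simp: M_def)
    obtain \<mu> where \<mu>: "\<mu> > 0"
      and near: "\<And>\<psi>. \<bar>\<psi>\<bar> \<le> pi / (2 * real n) * real M \<Longrightarrow> \<mu> * cos \<psi> \<noteq> 0 \<and> \<bar>sin \<psi>\<bar> \<le> c * \<bar>\<mu> * cos \<psi>\<bar>"
      and far: "\<And>\<psi>. pi / (2 * real n) * (real M + 1) \<le> \<bar>\<psi>\<bar> \<Longrightarrow> \<bar>\<psi>\<bar> \<le> pi - pi / (2 * real n) * (real M + 1) \<Longrightarrow>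
       sin \<psi> \<noteq> 0 \<and> \<bar>\<mu> * cos \<psi>\<bar> \<le> c * \<bar>sin \<psi>\<bar>"
      using arc_separation_bounds[OF Mn c y] by metis
    have "\<exists>\<theta>. cis (2 * \<theta>) = node p (f j + 1) \<and> pi / (2 * real n) * (real M + 1) \<le> \<bar>\<theta> - \<tau>\<bar> \<and> \<bar>\<theta> - \<tau>\<bar> \<le> pi - pi / (2 * real n) * (real M + 1)"
      if "j < dim_row A" for j
      using node_not_in_row_set[OF assms(1) \<kappa>, of "f j + 1" m p] f[OF that] unfolding \<tau>_def rM
      by (metis times_divide_eq_left)
    then obtain \<theta> where \<theta>: "\<And>j. j < dim_row A \<Longrightarrow> cis (2 * \<theta> j) = node p (f j + 1)"
      "\<And>j. j < dim_row A \<Longrightarrow> pi / (2 * real n) * (real M + 1) \<le> \<bar>\<theta> j - \<tau>\<bar>"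
      "\<And>j. j < dim_row A \<Longrightarrow> \<bar>\<theta> j - \<tau>\<bar> \<le> pi - pi / (2 * real n) * (real M + 1)"
      by metis
    have "singular_value A (N + 1) \<le> \<delta>\<^sup>2 * spectral_norm A"
    \<comment> \<open>Sine and scaled cosine are the homogeneous coordinates. Their cross product is
      \<open>\<mu> * sin (\<theta> j - \<phi> (g k))\<close>, the factor in the displacement
      relation.\<close>
    proof (rule singular_value_displacement_le[where ys = "\<lambda>j. sin (\<theta> j - \<tau>)" and yc = "\<lambda>j. \<mu> * cos (\<theta> j - \<tau>)"
          and xs = "\<lambda>k. sin (\<phi> (g k) - \<tau>)" and xc = "\<lambda>k. \<mu> * cos (\<phi> (g k) - \<tau>)"
          and u = "\<lambda>j. of_real \<mu> * u (f j) (\<theta> j)" and w = "\<lambda>_. 1", OF _ a _ \<delta>(1) bl])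
      fix j k assume jk: "j < dim_row A" "k < dim_col A"
      have "sin (\<theta> j - \<tau>) * (\<mu> * cos (\<phi> (g k) - \<tau>)) - \<mu> * cos (\<theta> j - \<tau>) * sin (\<phi> (g k) - \<tau>) =
          \<mu> * sin ((\<theta> j - \<tau>) - (\<phi> (g k) - \<tau>))"
        unfolding sin_diff[of "\<theta> j - \<tau>"] by (simp add: algebra_simps)
      then show "A $$ (j, k) * of_real (sin (\<theta> j - \<tau>) * (\<mu> * cos (\<phi> (g k) - \<tau>)) - \<mu> * cos (\<theta> j - \<tau>) * sin (\<phi> (g k) - \<tau>)) =
          of_real \<mu> * u (f j) (\<theta> j) * 1"
        using disp[of "f j" "g k" "\<theta> j"] f[OF jk(1)] g[OF jk(2)] \<theta>(1)[OF jk(1)] A[OF jk] by (simp add: mult_ac)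
    next
      fix j assume "j < dim_row A"
      then show "sin (\<theta> j - \<tau>) \<noteq> 0 \<and> \<bar>\<mu> * cos (\<theta> j - \<tau>)\<bar> \<le> c * \<bar>sin (\<theta> j - \<tau>)\<bar>"
        using far \<theta>(2,3) by blast
    next
      fix k assume "k < dim_col A"
      then have k: "\<kappa>1 \<le> g k + 1" "g k + 1 \<le> \<kappa>2" using g by auto
      have "real \<kappa>1 \<le> real (g k + 1)" "real (g k + 1) \<le> real \<kappa>2"
        using k by (simp_all only: of_nat_le_iff)
      then have "\<bar>2 * real (g k + 1) - (real \<kappa>1 + real \<kappa>2)\<bar> \<le> real M"
        unfolding rM by (rule midpoint_dist_inside)
      then have "\<bar>\<phi> (g k) - \<tau>\<bar> \<le> pi / (2 * real n) * real M"
        unfolding \<phi>_def \<tau>_def abs_angle_diff by (intro mult_left_mono) auto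
      then show "\<mu> * cos (\<phi> (g k) - \<tau>) \<noteq> 0 \<and> \<bar>sin (\<phi> (g k) - \<tau>)\<bar> \<le> c * \<bar>\<mu> * cos (\<phi> (g k) - \<tau>)\<bar>"
        by (rule near)
    qed (use c in auto)
    also have "\<dots> \<le> \<epsilon> * spectral_norm A"
      using \<delta> spectral_norm_nonneg by (intro mult_right_mono)
    finally show ?thesis .
  next
    assume H: "H = hss_row m n p (K t)"
    obtain f g where f: "\<And>j. j < dim_row A \<Longrightarrow> f j < m \<and> f j + 1 \<in> row_set m n p {\<kappa>1..\<kappa>2}"
      and g: "\<And>k. k < dim_col A \<Longrightarrow> g k < n \<and> g k + 1 \<in> {1..n} - {\<kappa>1..\<kappa>2}"
      and A: "\<And>j k. j < dim_row A \<Longrightarrow> k < dim_col A \<Longrightarrow> A $$ (j, k) = C_mat m n p $$ (f j, g k)"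
      using assms(11) unfolding H hss_row_def Kt
      by (rule block_entries) (auto simp: dimC)
    show ?thesis
    \<comment> \<open>A column outside \<open>K t\<close> is what guarantees \<open>M < n\<close>
      below.\<close>
    proof (cases "dim_col A = 0")
      case True
      then show ?thesis using assms(7) spectral_norm_nonneg by (simp add: singular_value_def)
    next
      case False
      \<comment> \<open>Now the rows form the near arc, half a step wider on each side than the span
        of \<open>K t\<close>; the remaining columns begin another half step further.\<close>
      define M where "M = \<kappa>2 - \<kappa>1 + 1"
      have rM: "real M = real \<kappa>2 - real \<kappa>1 + 1" using \<kappa> by (auto simp: M_def)
      have Mn: "M < n" using g[of 0] False \<kappa> unfolding M_def by auto
      obtain \<mu> where \<mu>: "\<mu> > 0"
        and near: "\<And>\<psi>. \<bar>\<psi>\<bar> \<le> pi / (2 * real n) * real M \<Longrightarrow> \<mu> * cos \<psi> \<noteq> 0 \<and> \<bar>sin \<psi>\<bar> \<le> c * \<bar>\<mu> * cos \<psi>\<bar>"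
        and far: "\<And>\<psi>. pi / (2 * real n) * (real M + 1) \<le> \<bar>\<psi>\<bar> \<Longrightarrow> \<bar>\<psi>\<bar> \<le> pi - pi / (2 * real n) * (real M + 1) \<Longrightarrow>
         sin \<psi> \<noteq> 0 \<and> \<bar>\<mu> * cos \<psi>\<bar> \<le> c * \<bar>sin \<psi>\<bar>"
        using arc_separation_bounds[OF Mn c y] by metis
      have "\<exists>\<theta>. cis (2 * \<theta>) = node p (f j + 1) \<and> \<bar>\<theta> - \<tau>\<bar> \<le> pi / (2 * real n) * real M"
        if "j < dim_row A" for j
        using node_in_row_set[of "f j + 1" m n p \<kappa>1 \<kappa>2] f[OF that] unfolding \<tau>_def rM
        by (metis times_divide_eq_left)
      then obtain \<theta> where \<theta>: "\<And>j. j < dim_row A \<Longrightarrow> cis (2 * \<theta> j) = node p (f j + 1)"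
        "\<And>j. j < dim_row A \<Longrightarrow> \<bar>\<theta> j - \<tau>\<bar> \<le> pi / (2 * real n) * real M"
        by metis
      have "singular_value A (N + 1) \<le> \<delta>\<^sup>2 * spectral_norm A"
      \<comment> \<open>The arcs have changed roles, so sine and cosine are exchanged; this reverses
        the sign of the cross product.\<close>
      proof (rule singular_value_displacement_le[where ys = "\<lambda>j. \<mu> * cos (\<theta> j - \<tau>)" and yc = "\<lambda>j. sin (\<theta> j - \<tau>)"
            and xs = "\<lambda>k. \<mu> * cos (\<phi> (g k) - \<tau>)" and xc = "\<lambda>k. sin (\<phi> (g k) - \<tau>)"
            and u = "\<lambda>j. - of_real \<mu> * u (f j) (\<theta> j)" and w = "\<lambda>_. 1", OF _ a _ \<delta>(1) bl])
        fix j k assume jk: "j < dim_row A" "k < dim_col A"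
        have "\<mu> * cos (\<theta> j - \<tau>) * sin (\<phi> (g k) - \<tau>) - sin (\<theta> j - \<tau>) * (\<mu> * cos (\<phi> (g k) - \<tau>)) =
            - \<mu> * sin ((\<theta> j - \<tau>) - (\<phi> (g k) - \<tau>))"
          unfolding sin_diff[of "\<theta> j - \<tau>"] by (simp add: algebra_simps)
        then show "A $$ (j, k) * of_real (\<mu> * cos (\<theta> j - \<tau>) * sin (\<phi> (g k) - \<tau>) - sin (\<theta> j - \<tau>) * (\<mu> * cos (\<phi> (g k) - \<tau>))) =
            - of_real \<mu> * u (f j) (\<theta> j) * 1"
          using disp[of "f j" "g k" "\<theta> j"] f[OF jk(1)] g[OF jk(2)] \<theta>(1)[OF jk(1)] A[OF jk] by (simp add: mult_ac)
      next
        fix j assume "j < dim_row A"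
        then show "\<mu> * cos (\<theta> j - \<tau>) \<noteq> 0 \<and> \<bar>sin (\<theta> j - \<tau>)\<bar> \<le> c * \<bar>\<mu> * cos (\<theta> j - \<tau>)\<bar>"
          using near \<theta>(2) by blast
      next
        fix k assume "k < dim_col A"
        then have "g k < n" "g k + 1 < \<kappa>1 \<or> \<kappa>2 < g k + 1" using g[of k] by auto
        then have "1 \<le> real (g k + 1)" "real (g k + 1) \<le> real n"
          "real (g k + 1) + 1 \<le> real \<kappa>1 \<or> real \<kappa>2 + 1 \<le> real (g k + 1)"
          by auto
        moreover have "1 \<le> real \<kappa>1" "real \<kappa>1 \<le> real \<kappa>2" "real \<kappa>2 \<le> real n" using \<kappa> by auto
        ultimately have "real M + 1 \<le> \<bar>2 * real (g k + 1) - (real \<kappa>1 + real \<kappa>2)\<bar>"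
          "\<bar>2 * real (g k + 1) - (real \<kappa>1 + real \<kappa>2)\<bar> \<le> 2 * real n - (real M + 1)"
          using midpoint_dist_outside[of "real (g k + 1)" "real n" "real \<kappa>1" "real \<kappa>2"]
          unfolding rM by simp_all
        then have "pi / (2 * real n) * (real M + 1) \<le> pi / (2 * real n) * \<bar>2 * real (g k + 1) - (real \<kappa>1 + real \<kappa>2)\<bar>"
          "pi / (2 * real n) * \<bar>2 * real (g k + 1) - (real \<kappa>1 + real \<kappa>2)\<bar> \<le> pi / (2 * real n) * (2 * real n - (real M + 1))"
          by (intro mult_left_mono; simp)+
        moreover have "pi / (2 * real n) * (2 * real n - (real M + 1)) = pi - pi / (2 * real n) * (real M + 1)"
          using assms(1) by (simp add: right_diff_distrib)
        ultimately show "sin (\<phi> (g k) - \<tau>) \<noteq> 0 \<and> \<bar>\<mu> * cos (\<phi> (g k) - \<tau>)\<bar> \<le> c * \<bar>sin (\<phi> (g k) - \<tau>)\<bar>"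
          by (intro far) (simp_all only: \<phi>_def \<tau>_def abs_angle_diff)
      qed (use c in auto)
      also have "\<dots> \<le> \<epsilon> * spectral_norm A"
        using \<delta> spectral_norm_nonneg by (intro mult_right_mono)
      finally show ?thesis .
    qed
  qed
  then have "eps_rank \<epsilon> A \<le> N" by (rule eps_rank_le)
  then show ?thesis unfolding intN[symmetric] by simp
qed

end
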